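(* Let $(M,g)$ be a simple manifold with $g\in C^k(M)$ for some $k\ge 2$. Then $I^\ast I = N$ on $L^2(M)$.
   Context: Simple manifold: let $k\ge 2$ be an integer, $M$ a compact smooth manifold with smooth boundary, and $g$ a $C^k$ Riemannian metric on $M$. $(M,g)$ is called simple if $M$ is $C^k$-diffeomorphic to the closed Euclidean unit ball in $\mathbb{R}^n$, $n=\dim M$, and (1) $\partial M$ is strictly convex in the sense of the second fundamental form; (2) all geodesics hit the boundary in finite time (non-trapping); (3) there are no conjugate points in $M$. By convention $M$ is identified, via a $C^k$-diffeomorphism, with the closed unit ball in $\mathbb{R}^n$ carrying a $C^k$ metric $g$. $L^2(M)=L^2(M,d\mathrm{Vol}_g)$. Notation: $SM$ is the unit sphere bundle, $S_xM$ its fibre over $x$, $dS_x$ the standard measure on $S_xM$ induced by $g_x$, and $\partial_{\mathrm{in}}SM$ the set of inward pointing unit vectors at boundary points. For $(x,v)\in SM$, $\gamma_{x,v}$ is the geodesic with $\gamma_{x,v}(0)=x$, $\dot\gamma_{x,v}(0)=v$, defined on its maximal interval $[-\tau_-(x,v),\tau_+(x,v)]$, $\tau_\pm\ge 0$; $\tau:=\tau_+$ (so $\tau(x,-v)=\tau_-(x,v)$). $\phi_t$ is the geodesic flow, $\phi_t(x,v)=(\gamma_{x,v}(t),\dot\gamma_{x,v}(t))$. Operators: the X-ray transform of $f\in L^2(M)$ is $$If(x,v)=\int_0^{\tau(x,v)} f(\gamma_{x,v}(t))\,dt,\qquad (x,v)\in\partial_{\mathrm{in}}SM;$$ the backprojection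 of a function $h$ in $L^2(\partial_{\mathrm{in}}SM)$ is $$I^\ast h(x)=\int_{S_xM} h(\phi_{-\tau(x,-v)}(x,v))\,dS_x(v),\qquad x\in M;$$ and the normal operator on $L^2(M)$ is $$Nf(x)=2\int_{S_xM}\int_0^{\tau(x,v)} f(\gamma_{x,v}(t))\,dt\,dS_x(v).$$ Formulas for $L^2$ functions are understood almost everywhere. *)

theory Defs
  imports "HOL-Analysis.Analysis"
begin

text \<open>
  The manifold is the closed unit ball of \<open>real^'n\<close> with a metric given by its Gram matrix
  \<open>g x\<close> in the standard coordinates. Tangent vectors are elements of \<open>real^'n\<close>, and points of
  the tangent bundle are pairs (base point, vector). Only the values of \<open>g\<close> on the ball matter:
  derivatives of \<open>g\<close> are taken within the ball, where they are unique because the ball is convex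
  with nonempty interior.
\<close>

abbreviation BM :: "(real^'n) set" where
  "BM \<equiv> cball 0 1"


subsection \<open>Metrics of class \<open>C\<^sup>k\<close> and their curvature\<close>

text \<open>On a convex set with nonempty interior, this is being \<open>C\<^sup>k\<close> up to the boundary.\<close>

primrec Ck_on ::
  "nat \<Rightarrow> ('a::real_normed_vector \<Rightarrow> 'b::real_normed_vector) \<Rightarrow> 'a set \<Rightarrow> bool" where
  "Ck_on 0 f S \<longleftrightarrow> continuous_on S f"
| "Ck_on (Suc k) f S \<longleftrightarrow>
     f differentiable_on S \<and> (\<forall>v. Ck_on k (\<lambda>x. frechet_derivative f (at x within S) v) S)"

definition metric_inner :: "(real^'n \<Rightarrow> real^'n^'n) \<Rightarrow> real^'n \<Rightarrow> real^'n \<Rightarrow> real^'n \<Rightarrow> real" where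
  "metric_inner g x v w = v \<bullet> (g x *v w)"

definition metric_norm :: "(real^'n \<Rightarrow> real^'n^'n) \<Rightarrow> real^'n \<Rightarrow> real^'n \<Rightarrow> real" where
  "metric_norm g x v = sqrt (metric_inner g x v v)"

definition Ck_metric :: "nat \<Rightarrow> (real^'n \<Rightarrow> real^'n^'n) \<Rightarrow> bool" where
  "Ck_metric k g \<longleftrightarrow> Ck_on k g BM \<and>
     (\<forall>x\<in>BM. transpose (g x) = g x \<and> (\<forall>v. v \<noteq> 0 \<longrightarrow> metric_inner g x v v > 0))"

definition metric_partial ::
  "(real^'n \<Rightarrow> real^'n^'n) \<Rightarrow> real^'n \<Rightarrow> 'n \<Rightarrow> 'n \<Rightarrow> 'n \<Rightarrow> real" where
  "metric_partial g x j l m = frechet_derivative g (at x within BM) (axis j 1) $ l $ m"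

definition christoffel_symbol ::
  "(real^'n \<Rightarrow> real^'n^'n) \<Rightarrow> real^'n \<Rightarrow> 'n \<Rightarrow> 'n \<Rightarrow> 'n \<Rightarrow> real" where
  "christoffel_symbol g x i j m =
     (\<Sum>l\<in>UNIV. matrix_inv (g x) $ i $ l *
        (metric_partial g x j l m + metric_partial g x m l j - metric_partial g x l j m)) / 2"

definition christoffel ::
  "(real^'n \<Rightarrow> real^'n^'n) \<Rightarrow> real^'n \<Rightarrow> real^'n \<Rightarrow> real^'n \<Rightarrow> real^'n" where
  "christoffel g x v w =
     (\<chi> i. \<Sum>j\<in>UNIV. \<Sum>m\<in>UNIV. christoffel_symbol g x i j m * v $ j * w $ m)"

text \<open>The curvature tensor $R_x(u,v)w$, with $R(X,Y)Z = \nabla_X\nabla_Y Z -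
  \nabla_Y\nabla_X Z - \nabla_{[X,Y]}Z$, evaluated on coordinate-constant fields.\<close>

definition curvature ::
  "(real^'n \<Rightarrow> real^'n^'n) \<Rightarrow> real^'n \<Rightarrow> real^'n \<Rightarrow> real^'n \<Rightarrow> real^'n \<Rightarrow> real^'n" where
  "curvature g x u v w =
     frechet_derivative (\<lambda>y. christoffel g y v w) (at x within BM) u
     - frechet_derivative (\<lambda>y. christoffel g y u w) (at x within BM) v
     + christoffel g x u (christoffel g x v w)
     - christoffel g x v (christoffel g x u w)"


subsection \<open>Geodesics\<close>

definition sphere_bundle :: "(real^'n \<Rightarrow> real^'n^'n) \<Rightarrow> ((real^'n) \<times> (real^'n)) set" where
  "sphere_bundle g = {(x, v). x \<in> BM \<and> metric_norm g x v = 1}"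

text \<open>
  A geodesic is represented by its lift \<open>c t = (position, velocity)\<close> to the tangent bundle. The
  lift still records the initial velocity when the interval \<open>J\<close> degenerates to a point, as happens
  for geodesics that touch the boundary tangentially.
\<close>

definition geodesic_on ::
  "(real^'n \<Rightarrow> real^'n^'n) \<Rightarrow> real set \<Rightarrow> (real \<Rightarrow> (real^'n) \<times> (real^'n)) \<Rightarrow> bool" where
  "geodesic_on g J c \<longleftrightarrow>
     (\<forall>t\<in>J. fst (c t) \<in> BM \<and>
        (c has_vector_derivative
           (snd (c t), - christoffel g (fst (c t)) (snd (c t)) (snd (c t)))) (at t within J))"

definition exit_time :: "(real^'n \<Rightarrow> real^'n^'n) \<Rightarrow> (real^'n) \<times> (real^'n) \<Rightarrow> real" where
  "exit_time g p = Sup {T. 0 \<le> T \<and> (\<exists>c. geodesic_on g {0..T} c \<and> c 0 = p)}"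

definition geodesic_flow ::
  "(real^'n \<Rightarrow> real^'n^'n) \<Rightarrow> real \<Rightarrow> (real^'n) \<times> (real^'n) \<Rightarrow> (real^'n) \<times> (real^'n)" where
  "geodesic_flow g t p = (THE q. \<exists>c. geodesic_on g (closed_segment 0 t) c \<and> c 0 = p \<and> c t = q)"


subsection \<open>Simple manifolds\<close>

text \<open>
  The outward unit normal at a boundary point \<open>x\<close> is the normalised gradient of $|x|^2/2$,
  i.e. $g^{-1}x / |g^{-1}x|_g$. The same formula extends it to the ball without the origin. The
  second fundamental form only involves derivatives of it in directions tangent to the
  boundary, hence does not depend on the extension.
\<close>

definition outer_normal :: "(real^'n \<Rightarrow> real^'n^'n) \<Rightarrow> real^'n \<Rightarrow> real^'n" where
  "outer_normal g x =
     (matrix_inv (g x) *v x) /\<^sub>R metric_norm g x (matrix_inv (g x) *v x)"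

text \<open>The sign is such that the boundary of the Euclidean ball has second fundamental form
  \<open>v \<bullet> w\<close>.\<close>

definition second_fundamental_form ::
  "(real^'n \<Rightarrow> real^'n^'n) \<Rightarrow> real^'n \<Rightarrow> real^'n \<Rightarrow> real^'n \<Rightarrow> real" where
  "second_fundamental_form g x v w =
     metric_inner g x
       (frechet_derivative (outer_normal g) (at x within BM) v + christoffel g x v (outer_normal g x))
       w"

definition strictly_convex_boundary :: "(real^'n \<Rightarrow> real^'n^'n) \<Rightarrow> bool" where
  "strictly_convex_boundary g \<longleftrightarrow>
     (\<forall>x\<in>sphere 0 1. \<forall>v. v \<noteq> 0 \<and> metric_inner g x v (outer_normal g x) = 0 \<longrightarrow>
        second_fundamental_form g x v v > 0)"

definition nontrapping :: "(real^'n \<Rightarrow> real^'n^'n) \<Rightarrow> bool" where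
  "nontrapping g \<longleftrightarrow>
     (\<forall>p\<in>sphere_bundle g. \<exists>T\<ge>0. \<exists>c. geodesic_on g {0..T} c \<and> c 0 = p \<and> fst (c T) \<in> sphere 0 1)"

definition covariant_derivative_along ::
  "(real^'n \<Rightarrow> real^'n^'n) \<Rightarrow> (real \<Rightarrow> (real^'n) \<times> (real^'n)) \<Rightarrow> real set \<Rightarrow>
     (real \<Rightarrow> real^'n) \<Rightarrow> (real \<Rightarrow> real^'n) \<Rightarrow> bool" where
  "covariant_derivative_along g c J Y Z \<longleftrightarrow>
     (\<forall>t\<in>J. (Y has_vector_derivative
        (Z t - christoffel g (fst (c t)) (snd (c t)) (Y t))) (at t within J))"

definition jacobi_field_on ::
  "(real^'n \<Rightarrow> real^'n^'n) \<Rightarrow> (real \<Rightarrow> (real^'n) \<times> (real^'n)) \<Rightarrow> real set \<Rightarrow>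
     (real \<Rightarrow> real^'n) \<Rightarrow> bool" where
  "jacobi_field_on g c J Y \<longleftrightarrow>
     (\<exists>Z. covariant_derivative_along g c J Y Z \<and>
        covariant_derivative_along g c J Z
          (\<lambda>t. - curvature g (fst (c t)) (Y t) (snd (c t)) (snd (c t))))"

definition no_conjugate_points :: "(real^'n \<Rightarrow> real^'n^'n) \<Rightarrow> bool" where
  "no_conjugate_points g \<longleftrightarrow>
     (\<forall>a b c Y. a < b \<and> geodesic_on g {a..b} c \<and> c a \<in> sphere_bundle g \<and>
        jacobi_field_on g c {a..b} Y \<and> Y a = 0 \<and> Y b = 0 \<longrightarrow> (\<forall>t\<in>{a..b}. Y t = 0))"

definition simple_manifold :: "nat \<Rightarrow> (real^'n \<Rightarrow> real^'n^'n) \<Rightarrow> bool" where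
  "simple_manifold k g \<longleftrightarrow>
     Ck_metric k g \<and> strictly_convex_boundary g \<and> nontrapping g \<and> no_conjugate_points g"


subsection \<open>Measures\<close>

definition riemannian_volume :: "(real^'n \<Rightarrow> real^'n^'n) \<Rightarrow> (real^'n) measure" where
  "riemannian_volume g = density (lebesgue_on BM) (\<lambda>x. ennreal (sqrt (det (g x))))"

text \<open>
  The surface measure on the unit sphere of the inner product \<open>g x\<close> is obtained, as in polar
  coordinates, from the volume of cones: a set \<open>A\<close> of unit vectors has measure \<open>n\<close> times the
  \<open>g x\<close>-volume of $\{r v \mid v \in A,\ 0 < r \le 1\}$. In dimension one, this is the
  counting measure on the two unit vectors. The completion is needed for integrands built from
  Lebesgue (not necessarily Borel) measurable functions.
\<close>

definition sphere_measure :: "(real^'n \<Rightarrow> real^'n^'n) \<Rightarrow> real^'n \<Rightarrow> (real^'n) measure" where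
  "sphere_measure g x =
     completion (scale_measure (of_nat CARD('n))
       (distr
         (density (restrict_space lborel {v. 0 < metric_norm g x v \<and> metric_norm g x v \<le> 1})
            (\<lambda>_. ennreal (sqrt (det (g x)))))
         (restrict_space borel {v. metric_norm g x v = 1})
         (\<lambda>v. v /\<^sub>R metric_norm g x v)))"

text \<open>Functions representing elements of \<open>L\<^sup>2\<close>. Equality there is equality almost everywhere.\<close>

definition L2_fun :: "'a measure \<Rightarrow> ('a \<Rightarrow> complex) set" where
  "L2_fun \<mu> = {f. f \<in> borel_measurable \<mu> \<and> integrable \<mu> (\<lambda>x. (cmod (f x))\<^sup>2)}"


subsection \<open>The operators\<close>

text \<open>A vector \<open>v\<close> at a boundary point \<open>x\<close> points inward iff its \<open>g\<close>-inner product with the outward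
  normal is negative.\<close>

definition inward_bundle :: "(real^'n \<Rightarrow> real^'n^'n) \<Rightarrow> ((real^'n) \<times> (real^'n)) set" where
  "inward_bundle g =
     {(x, v) \<in> sphere_bundle g. x \<in> sphere 0 1 \<and> metric_inner g x v (outer_normal g x) < 0}"

definition xray_transform ::
  "(real^'n \<Rightarrow> real^'n^'n) \<Rightarrow> (real^'n \<Rightarrow> complex) \<Rightarrow> (real^'n) \<times> (real^'n) \<Rightarrow> complex" where
  "xray_transform g f =
     (\<lambda>p\<in>inward_bundle g. LINT t|lebesgue_on {0..exit_time g p}. f (fst (geodesic_flow g t p)))"

definition backprojection ::
  "(real^'n \<Rightarrow> real^'n^'n) \<Rightarrow> ((real^'n) \<times> (real^'n) \<Rightarrow> complex) \<Rightarrow> real^'n \<Rightarrow> complex" where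
  "backprojection g h x =
     (LINT v|sphere_measure g x. h (geodesic_flow g (- exit_time g (x, - v)) (x, v)))"

definition normal_operator ::
  "(real^'n \<Rightarrow> real^'n^'n) \<Rightarrow> (real^'n \<Rightarrow> complex) \<Rightarrow> real^'n \<Rightarrow> complex" where
  "normal_operator g f x =
     2 * (LINT v|sphere_measure g x.
            LINT t|lebesgue_on {0..exit_time g (x, v)}. f (fst (geodesic_flow g t (x, v))))"

end

theory Submission
  imports Defs
begin

text \<open>
  For an interior point \<open>x\<close> and a unit vector \<open>v\<close>, the geodesic that enters the ball, passes through
  \<open>x\<close> with velocity \<open>v\<close> and leaves the ball again splits at \<open>x\<close> into the rays of \<open>(x, v)\<close> and
  \<open>(x, - v)\<close>. Hence \<open>If\<close> at its entry point is \<open>F v + F (- v)\<close>, where \<open>F v\<close> is the integral of \<open>f\<close>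
  along the ray of \<open>(x, v)\<close>, and integrating over \<open>v\<close> gives \<open>2 * \<integral> F\<close>, since the measure on the
  sphere is even. Strict convexity makes the entry vector inward pointing and prevents geodesics from
  continuing beyond the boundary.

  Splitting these integrals requires \<open>f\<close> to be integrable along almost every ray. The geodesic vector
  field is Lipschitz, so it extends to a bounded Lipschitz field with a global flow. The inverse of
  the flow is Lipschitz, so the flow distorts Lebesgue measure on the phase space by a bounded factor
  in bounded time (Liouville's theorem is not needed), and Fubini's theorem gives the integrability.
\<close>


subsection \<open>Flows of bounded Lipschitz fields\<close>

text \<open>Elements of L^2 are only Lebesgue measurable and are sampled along single curves. To
  control both difficulties at once, \<open>f\<close> is replaced by a Borel function
  \<open>h\<close> together with a Borel bound \<open>u\<close> for its norm, which is infinite on a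
  null set containing all points of the ball where \<open>f\<close> and \<open>h\<close> differ. A
  finite integral of \<open>u\<close> along a ray then says two things: \<open>h\<close> is
  integrable there, and \<open>f\<close> agrees with \<open>h\<close> at almost every time. The
  finiteness estimate lives in the Lebesgue measure of phase space, whereas the operators integrate
  over unit vectors, which form a null set. Unit vectors are therefore fattened to cones. Rescaling
  a velocity only reparametrises its geodesic, and by homogeneity the cones may be truncated to
  speeds between 1/2 and 1, which keeps the new times bounded. The flow estimate also needs one time
  bound for all geodesics. Nontrapping gives a finite time for each of them; uniformity comes from
  compactness of the unit sphere bundle.\<close>

definition ode_solution ::
  "('a::real_normed_vector \<Rightarrow> 'a) \<Rightarrow> real set \<Rightarrow> (real \<Rightarrow> 'a) \<Rightarrow> bool" where
  "ode_solution X J c \<longleftrightarrow> (\<forall>t\<in>J. (c has_vector_derivative X (c t)) (at t within J))"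

lemma ode_solution_subset: "ode_solution X J c \<Longrightarrow> I \<subseteq> J \<Longrightarrow> ode_solution X I c"
  unfolding ode_solution_def by (meson has_vector_derivative_within_subset subsetD)

lemma ode_solution_continuous: "ode_solution X J c \<Longrightarrow> continuous_on J c"
  unfolding ode_solution_def
  by (meson continuous_on_eq_continuous_within has_vector_derivative_continuous)

text \<open>The squared distance stays differentiable where the two solutions meet. By
  Cauchy-Schwarz and the Lipschitz bound its derivative is at most \<open>2 * L\<close> times
  itself, so the weight \<open>exp (- 2 * L * s)\<close> turns it into the nonincreasing function
  \<open>w\<close>.\<close>

lemma ode_solution_gronwall:
  fixes X :: "'a::real_inner \<Rightarrow> 'a"
  assumes lip: "L-lipschitz_on UNIV X"
    and c: "ode_solution X {0..T} c" and d: "ode_solution X {0..T} d" and t: "t \<in> {0..T}"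
  shows "dist (c t) (d t) \<le> exp (L * t) * dist (c 0) (d 0)"
proof -
  define z where "z s = c s - d s" for s
  define w where "w s = exp (- 2 * L * s) * (z s \<bullet> z s)" for s
  have sub: "{0..t} \<subseteq> {0..T}" using t by auto
  have cd: "ode_solution X {0..t} c" "ode_solution X {0..t} d"
    using c d sub ode_solution_subset by blast+
  have "w t \<le> w 0"
  proof (rule DERIV_nonpos_imp_decreasing_open[of 0 t w])
    show "0 \<le> t" using t by auto
    show "continuous_on {0..t} w" unfolding w_def z_def
      by (intro continuous_intros cd[THEN ode_solution_continuous])
  next
    fix s assume s: "0 < s" "s < t"
    have der: "(c has_vector_derivative X (c s)) (at s)" "(d has_vector_derivative X (d s)) (at s)"
      using cd s at_within_Icc_at[of 0 s t] unfolding ode_solution_def by (metis atLeastAtMost_iff less_eq_real_def)+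
    have zder: "(z has_derivative (\<lambda>h. h *\<^sub>R (X (c s) - X (d s)))) (at s)"
      unfolding z_def using has_vector_derivative_diff[OF der]
      by (simp add: has_vector_derivative_def)
    have "((\<lambda>s. z s \<bullet> z s) has_derivative (\<lambda>h. z s \<bullet> (h *\<^sub>R (X (c s) - X (d s))) + (h *\<^sub>R (X (c s) - X (d s))) \<bullet> z s)) (at s)"
      by (rule has_derivative_inner[OF zder zder])
    then have zz: "((\<lambda>s. z s \<bullet> z s) has_field_derivative 2 * (z s \<bullet> (X (c s) - X (d s)))) (at s)"
      unfolding has_field_derivative_def
      by (rule has_derivative_eq_rhs) (auto simp: inner_commute)
    have wd: "(w has_field_derivative exp (- 2 * L * s) * (- 2 * L) * (z s \<bullet> z s)
        + exp (- 2 * L * s) * (2 * (z s \<bullet> (X (c s) - X (d s))))) (at s)"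
      unfolding w_def by (rule derivative_eq_intros zz refl)+ simp
    have "z s \<bullet> (X (c s) - X (d s)) \<le> norm (z s) * norm (X (c s) - X (d s))"
      by (rule norm_cauchy_schwarz)
    also have "\<dots> \<le> norm (z s) * (L * norm (z s))"
      using lipschitz_onD[OF lip, of "c s" "d s"]
      by (intro mult_left_mono) (auto simp: dist_norm z_def)
    also have "\<dots> = L * (z s \<bullet> z s)" by (simp add: dot_square_norm power2_eq_square)
    finally have "exp (- 2 * L * s) * (2 * (z s \<bullet> (X (c s) - X (d s)) - L * (z s \<bullet> z s))) \<le> 0"
      by (intro mult_nonneg_nonpos) auto
    then show "\<exists>y. (w has_real_derivative y) (at s) \<and> y \<le> 0"
      using wd by (intro exI[where P = "\<lambda>y. (w has_real_derivative y) (at s) \<and> y \<le> 0", OF conjI])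
        (auto simp: algebra_simps)
  qed
  then have "exp (- 2 * L * t) * (norm (z t))\<^sup>2 \<le> (norm (z 0))\<^sup>2"
    by (simp add: w_def dot_square_norm)
  then have "exp (2 * L * t) * (exp (- 2 * L * t) * (norm (z t))\<^sup>2) \<le> exp (2 * L * t) * (norm (z 0))\<^sup>2"
    by (intro mult_left_mono) auto
  then have "(norm (z t))\<^sup>2 \<le> exp (2 * L * t) * (norm (z 0))\<^sup>2"
    by (simp add: mult.assoc[symmetric] exp_minus_inverse flip: exp_add)
  also have "\<dots> = (exp (L * t) * norm (z 0))\<^sup>2"
    by (simp add: power_mult_distrib mult.assoc flip: exp_double)
  finally show ?thesis
    unfolding dist_norm z_def by (rule power2_le_imp_le) auto
qed

lemma has_vector_derivative_integral_atLeast: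
  fixes h :: "real \<Rightarrow> 'a::banach"
  assumes "continuous_on UNIV h" "0 \<le> t"
  shows "((\<lambda>u. integral {0..u} h) has_vector_derivative h t) (at t within {0..})"
proof -
  have "((\<lambda>u. integral {0..u} h) has_vector_derivative h t) (at t within {0..t+1})"
    using assms by (intro integral_has_vector_derivative continuous_on_subset[OF assms(1)]) auto
  moreover have "at t within {0..t+1} = at t within {0..}"
    by (rule at_within_nhd[of _ "{..<t+1}"]) auto
  ultimately show ?thesis by simp
qed

text \<open>The weight \<open>exp (- M * t)\<close> with \<open>M > L\<close> makes the Picard operator a contraction on the whole
  half-line.\<close>

lemma picard_exists:
  fixes X :: "'a::banach \<Rightarrow> 'a"
  assumes lip: "L-lipschitz_on UNIV X" and bdd: "\<And>p. norm (X p) \<le> B"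
  shows "\<exists>c. c 0 = p \<and> ode_solution X {0..} c"
proof -
  define M where "M = L + 1"
  have L: "0 \<le> L" "L < M" "0 < M" using lipschitz_on_nonneg[OF lip] by (auto simp: M_def)
  have Xc: "continuous_on UNIV X" using lipschitz_on_continuous_on[OF lip] .
  have B: "0 \<le> B" using bdd[of undefined] norm_ge_zero order_trans by blast
  \<comment> \<open>The fixed point \<open>y\<close> will be the damped deviation of the curve from
    \<open>p\<close>: \<open>c s = p + exp (M * s) *\<^sub>R y s\<close>. It is bounded because
    \<open>X\<close> is, so the complete space of bounded continuous functions applies. Below,
    \<open>max 0 t\<close> extends it by a constant to negative times.\<close>
  define H where "H y s = X (p + exp (M * s) *\<^sub>R apply_bcontfun y s)" for y s
  have Hc: "continuous_on UNIV (H y)" for y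
    unfolding H_def by (intro continuous_on_compose2[OF Xc] continuous_intros) auto
  have Hi: "H y integrable_on {0..t}" for y t
    using Hc continuous_on_subset integrable_continuous_real by blast
  define P where "P y t = exp (- M * max 0 t) *\<^sub>R integral {0..max 0 t} (H y)" for y t
  have Pc: "continuous_on UNIV (P y)" for y
  proof -
    have "continuous_on {0..} (\<lambda>u. integral {0..u} (H y))"
      using has_vector_derivative_integral_atLeast[OF Hc]
      by (meson atLeast_iff continuous_on_eq_continuous_within has_vector_derivative_continuous)
    then have "continuous_on UNIV (\<lambda>t. integral {0..max 0 t} (H y))"
      by (rule continuous_on_compose2) (auto intro!: continuous_intros)
    then show ?thesis unfolding P_def by (intro continuous_intros)
  qed
  have Pb: "norm (P y t) \<le> B / M" for y t
  proof -
    let ?u = "max 0 t"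
    have "norm (integral {0..?u} (H y)) \<le> B * ?u"
      using integral_bound[of 0 ?u "H y" B] Hc bdd
      by (auto simp: H_def intro: continuous_on_subset)
    then have "norm (P y t) \<le> exp (- M * ?u) * (B * ?u)"
      unfolding P_def by (simp add: mult_left_mono)
    also have "\<dots> \<le> B / M"
    proof -
      have "M * ?u \<le> exp (M * ?u)" using exp_ge_add_one_self[of "M * ?u"] by linarith
      then have "B * (M * ?u) \<le> B * exp (M * ?u)" using B by (rule mult_left_mono)
      then show ?thesis using L by (simp add: exp_minus field_simps)
    qed
    finally show ?thesis .
  qed
  have Pbc: "P y \<in> bcontfun" for y by (rule bcontfun_normI[OF Pc Pb])
  define F where "F y = Bcontfun (P y)" for y
  have F: "apply_bcontfun (F y) t = P y t" for y t
    unfolding F_def using Bcontfun_inverse[OF Pbc] by simp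
  have "\<exists>!y. F y = y"
  proof (rule banach_fix_type[of "L / M"])
    show "0 \<le> L / M" "L / M < 1" using L by auto
    show "\<forall>y z. dist (F y) (F z) \<le> L / M * dist y z"
    proof (intro allI dist_bound)
      fix y z :: "real \<Rightarrow>\<^sub>C 'a" and t :: real
      let ?u = "max 0 t"
      let ?D = "dist y z"
      have expi: "((\<lambda>s. exp (M * s)) has_integral (exp (M * ?u) / M - exp (M * 0) / M)) {0..?u}"
        using L by (intro fundamental_theorem_of_calculus)
          (auto intro!: derivative_eq_intros simp flip: has_real_derivative_iff_has_vector_derivative)
      have "norm (integral {0..?u} (\<lambda>s. H y s - H z s)) \<le> integral {0..?u} (\<lambda>s. L * ?D * exp (M * s))"
      proof (rule integral_norm_bound_integral)
        show "(\<lambda>s. H y s - H z s) integrable_on {0..?u}" using Hi by (intro integrable_diff)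
        show "(\<lambda>s. L * ?D * exp (M * s)) integrable_on {0..?u}"
          by (intro integrable_continuous_real continuous_intros)
        fix s
        have "norm (H y s - H z s) \<le> L * dist (p + exp (M * s) *\<^sub>R y s) (p + exp (M * s) *\<^sub>R z s)"
          unfolding H_def dist_norm[symmetric] by (rule lipschitz_onD[OF lip]) auto
        also have "\<dots> = L * (exp (M * s) * dist (y s) (z s))"
          by (simp add: dist_norm flip: scaleR_diff_right)
        also have "\<dots> \<le> L * (exp (M * s) * ?D)"
          using L dist_bounded by (intro mult_left_mono) auto
        finally show "norm (H y s - H z s) \<le> L * ?D * exp (M * s)" by (simp add: mult_ac)
      qed
      also have "\<dots> = L * ?D * (exp (M * ?u) / M - exp (M * 0) / M)"
        using expi by (simp add: integral_unique)
      also have "\<dots> \<le> L * ?D * (exp (M * ?u) / M)"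
        using L by (intro mult_left_mono) auto
      finally have *: "norm (integral {0..?u} (\<lambda>s. H y s - H z s)) \<le> L * ?D * (exp (M * ?u) / M)" .
      have "dist (F y t) (F z t) = exp (- M * ?u) * norm (integral {0..?u} (\<lambda>s. H y s - H z s))"
        using Hi by (simp add: F P_def dist_norm integral_diff flip: scaleR_diff_right)
      also have "\<dots> \<le> exp (- M * ?u) * (L * ?D * (exp (M * ?u) / M))"
        by (intro mult_left_mono *) auto
      also have "\<dots> = L / M * ?D" by (simp add: exp_minus field_simps)
      finally show "dist (F y t) (F z t) \<le> L / M * ?D" .
    qed
  qed
  then obtain y where y: "F y = y" by blast
  define c where "c t = p + integral {0..t} (H y)" for t
  have cy: "c t = p + exp (M * t) *\<^sub>R apply_bcontfun y t" if "0 \<le> t" for t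
  proof -
    have "apply_bcontfun y t = exp (- M * t) *\<^sub>R integral {0..t} (H y)"
      using F[of y t] y that by (simp add: P_def max_def)
    then show ?thesis by (simp add: c_def flip: exp_add)
  qed
  have "ode_solution X {0..} c"
    unfolding ode_solution_def
  proof
    fix t :: real assume t: "t \<in> {0..}"
    have "(c has_vector_derivative 0 + H y t) (at t within {0..})"
      unfolding c_def using t
      by (intro has_vector_derivative_add has_vector_derivative_const
          has_vector_derivative_integral_atLeast Hc) auto
    moreover have "H y t = X (c t)" using t by (simp add: H_def cy)
    ultimately show "(c has_vector_derivative X (c t)) (at t within {0..})" by simp
  qed
  moreover have "c 0 = p" by (simp add: c_def)
  ultimately show ?thesis by blast
qed

text \<open>Constrained for nonnegative times only. Motion backward in time is obtained from the
  field \<open>- X\<close> or, for geodesics, by reversing the velocity.\<close>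

definition ode_flow :: "('a::real_normed_vector \<Rightarrow> 'a) \<Rightarrow> 'a \<Rightarrow> real \<Rightarrow> 'a" where
  "ode_flow X p = (SOME c. c 0 = p \<and> ode_solution X {0..} c)"

locale bounded_lipschitz_field =
  fixes X :: "'a::euclidean_space \<Rightarrow> 'a" and L B :: real
  assumes lipschitz: "L-lipschitz_on UNIV X" and bounded: "norm (X p) \<le> B"
begin

lemma flow_0 [simp]: "ode_flow X p 0 = p" and flow_solution: "ode_solution X {0..} (ode_flow X p)"
  using someI_ex[OF picard_exists[OF lipschitz bounded, of p]] by (simp_all add: ode_flow_def)

lemma flow_solution_Icc: "ode_solution X {0..T} (ode_flow X p)"
  using flow_solution by (rule ode_solution_subset) auto

lemma flow_unique:
  assumes "ode_solution X {0..T} c" "t \<in> {0..T}"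
  shows "ode_flow X (c 0) t = c t"
  using ode_solution_gronwall[OF lipschitz flow_solution_Icc assms(1,2), of "c 0"] by simp

lemma flow_lipschitz:
  assumes "0 \<le> t"
  shows "(exp (L * t))-lipschitz_on UNIV (\<lambda>p. ode_flow X p t)"
proof (rule lipschitz_onI)
  show "dist (ode_flow X p t) (ode_flow X q t) \<le> exp (L * t) * dist p q" for p q
    using ode_solution_gronwall[OF lipschitz flow_solution_Icc flow_solution_Icc, of t t p q] assms
    by simp
qed simp

lemma flow_time_lipschitz:
  assumes "0 \<le> s" "0 \<le> t"
  shows "dist (ode_flow X p s) (ode_flow X p t) \<le> B * dist s t"
proof -
  have "norm (ode_flow X p t - ode_flow X p s) \<le> B * norm (t - s)"
  proof (rule differentiable_bound[where S = "{0..}" and f' = "\<lambda>t h. h *\<^sub>R X (ode_flow X p t)"])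
    show "(ode_flow X p has_derivative (\<lambda>h. h *\<^sub>R X (ode_flow X p t))) (at t within {0..})"
      if "t \<in> {0..}" for t
      using flow_solution that by (auto simp: ode_solution_def has_vector_derivative_def)
    show "onorm (\<lambda>h. h *\<^sub>R X (ode_flow X p t)) \<le> B" for t
      by (rule onorm_le) (simp add: bounded mult.commute[of B] mult_left_mono)
  qed (use assms in auto)
  then show ?thesis by (simp add: dist_norm norm_minus_commute abs_minus_commute)
qed

text \<open>The starting point is changed at a fixed time, then the time along a fixed orbit.
  Truncating the time by \<open>max 0 t\<close> makes the flow total, so that joint Borel
  measurability on the whole product follows.\<close>

lemma continuous_on_flow: "continuous_on UNIV (\<lambda>(p, t). ode_flow X p (max 0 t))"
proof -
  have "((\<lambda>(p, t). ode_flow X p (max 0 t)) \<longlongrightarrow> ode_flow X p (max 0 t)) (at (p, t))" for p t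
  proof -
    let ?g = "\<lambda>z. exp (L * max 0 (snd z)) * dist (fst z) p + B * dist (max 0 (snd z)) (max 0 t)"
    have "continuous_on UNIV ?g" by (intro continuous_intros)
    then have "(?g \<longlongrightarrow> ?g (p, t)) (at (p, t))" by (simp only: continuous_on_def UNIV_I ball_UNIV)
    then have lim: "(?g \<longlongrightarrow> 0) (at (p, t))" by simp
    have le: "dist (ode_flow X (fst z) (max 0 (snd z))) (ode_flow X p (max 0 t))
        \<le> exp (L * max 0 (snd z)) * dist (fst z) p + B * dist (max 0 (snd z)) (max 0 t)" for z
    proof -
      have "dist (ode_flow X (fst z) (max 0 (snd z))) (ode_flow X p (max 0 (snd z)))
          \<le> exp (L * max 0 (snd z)) * dist (fst z) p"
        by (rule lipschitz_onD[OF flow_lipschitz]) simp_all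
      moreover have "dist (ode_flow X p (max 0 (snd z))) (ode_flow X p (max 0 t))
          \<le> B * dist (max 0 (snd z)) (max 0 t)" by (rule flow_time_lipschitz) auto
      ultimately show ?thesis
        by (rule order_trans[OF dist_triangle add_mono])
    qed
    have "((\<lambda>z. dist (ode_flow X (fst z) (max 0 (snd z))) (ode_flow X p (max 0 t))) \<longlongrightarrow> 0) (at (p, t))"
      by (rule Lim_null_comparison[where g = ?g, OF _ lim])
        (rule always_eventually, rule allI, subst real_norm_def, subst abs_of_nonneg, rule zero_le_dist, rule le)
    then show ?thesis by (subst tendsto_dist_iff) (simp only: case_prod_beta)
  qed
  then show ?thesis by (auto simp: continuous_on_def)
qed

lemma flow_add:
  assumes "0 \<le> s" "0 \<le> t"
  shows "ode_flow X p (s + t) = ode_flow X (ode_flow X p s) t"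
proof -
  let ?d = "\<lambda>r. ode_flow X p (s + r)"
  have "ode_solution X {0..t} ?d"
    unfolding ode_solution_def
  proof
    fix r assume r: "r \<in> {0..t}"
    have "((ode_flow X p \<circ> (\<lambda>r. s + r)) has_vector_derivative 1 *\<^sub>R X (ode_flow X p (s + r)))
        (at r within {0..t})"
    proof (rule vector_diff_chain_within)
      show "((\<lambda>r. s + r) has_vector_derivative 1) (at r within {0..t})"
        by (auto intro!: derivative_eq_intros)
      show "(ode_flow X p has_vector_derivative X (ode_flow X p (s + r)))
          (at (s + r) within (\<lambda>r. s + r) ` {0..t})"
      proof (rule has_vector_derivative_within_subset)
        show "(ode_flow X p has_vector_derivative X (ode_flow X p (s + r))) (at (s + r) within {0..})"
          using flow_solution[of p] r assms by (simp add: ode_solution_def)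
      qed (use assms in auto)
    qed
    then show "(?d has_vector_derivative X (?d r)) (at r within {0..t})" by (simp add: o_def)
  qed
  from flow_unique[OF this, of t] assms show ?thesis by simp
qed

lemma continuous_on_flow_at: "0 \<le> t \<Longrightarrow> continuous_on S (\<lambda>p. ode_flow X p t)"
  by (rule continuous_on_subset[OF lipschitz_on_continuous_on[OF flow_lipschitz]]) auto

lemma uminus_field: "bounded_lipschitz_field (\<lambda>p. - X p) L B"
  by standard (use lipschitz bounded in auto)

text \<open>The time-reversed orbit solves the equation of \<open>- X\<close>, and uniqueness
  identifies it. With \<open>flow_lipschitz\<close> for \<open>- X\<close> this supplies the
  Lipschitz inverse that controls the distortion of Lebesgue measure.\<close>

lemma flow_reverse:
  assumes "0 \<le> T"
  shows "ode_flow (\<lambda>p. - X p) (ode_flow X p T) T = p"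
proof -
  interpret r: bounded_lipschitz_field "\<lambda>p. - X p" L B by (rule uminus_field)
  let ?d = "\<lambda>t. ode_flow X p (T - t)"
  have "ode_solution (\<lambda>p. - X p) {0..T} ?d"
    unfolding ode_solution_def
  proof
    fix t assume t: "t \<in> {0..T}"
    have "((ode_flow X p \<circ> (\<lambda>t. T - t)) has_vector_derivative (-1) *\<^sub>R X (ode_flow X p (T - t)))
        (at t within {0..T})"
    proof (rule vector_diff_chain_within)
      show "((\<lambda>t. T - t) has_vector_derivative -1) (at t within {0..T})"
        by (auto intro!: derivative_eq_intros)
      show "(ode_flow X p has_vector_derivative X (ode_flow X p (T - t)))
          (at (T - t) within (\<lambda>t. T - t) ` {0..T})"
        using flow_solution_Icc[of T p] t unfolding ode_solution_def by auto
    qed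
    then show "(?d has_vector_derivative - X (?d t)) (at t within {0..T})" by (simp add: o_def)
  qed
  from r.flow_unique[OF this, of T] assms show ?thesis by simp
qed

end


subsection \<open>Lipschitz maps and the measure of unit spheres\<close>

text \<open>The preimage of a ball lies in a ball of \<open>L\<close> times the radius; Vitali's covering theorem
  passes from balls to open sets.\<close>

lemma emeasure_vimage_le_of_lipschitz_inverse_open:
  fixes \<Phi> \<Psi> :: "'a::euclidean_space \<Rightarrow> 'a"
  assumes lip: "L-lipschitz_on UNIV \<Psi>" and inv: "\<And>p. \<Psi> (\<Phi> p) = p"
    and cont: "continuous_on UNIV \<Phi>" and U: "open U"
  shows "emeasure lborel (\<Phi> -` U) \<le> ennreal (L ^ DIM('a)) * emeasure lborel U"
proof -
  have L: "0 \<le> L" using lipschitz_on_nonneg[OF lip] .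
  have [measurable]: "\<Phi> \<in> borel_measurable borel" using cont by (rule borel_measurable_continuous_onI)
  let ?\<nu> = "distr lborel lborel \<Phi>"
  let ?K = "{(a, r). 0 < r \<and> ball a r \<subseteq> U}"
  have vitali: "\<exists>i. i \<in> ?K \<and> x \<in> ball (fst i) (snd i) \<and> snd i < d" if "x \<in> U" "0 < d" for x d
  proof -
    obtain e where "0 < e" "ball x e \<subseteq> U" using U \<open>x \<in> U\<close> open_contains_ball by blast
    then show ?thesis using \<open>0 < d\<close>
      by (intro exI[of _ "(x, min e (d/2))"]) (auto simp: min_def)
  qed
  obtain C where C: "countable C" "C \<subseteq> ?K"
    and disj: "pairwise (\<lambda>i j. disjnt (ball (fst i) (snd i)) (ball (fst j) (snd j))) C"
    and neg: "negligible (U - (\<Union>i\<in>C. ball (fst i) (snd i)))"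
    using Vitali_covering_theorem_balls[of U ?K fst snd, OF vitali] by blast
  let ?b = "\<lambda>i. ball (fst i) (snd i)"
  define V where "V = \<Union> (?b ` C)"
  have V: "open V" "V \<subseteq> U" using C unfolding V_def by (auto, fastforce)
  have disj': "disjoint_family_on ?b C"
    using disj unfolding disjoint_family_on_def pairwise_def disjnt_def by blast
  \<comment> \<open>Vitali's theorem leaves a null set uncovered. Its preimage under
    \<open>\<Phi>\<close> lies in its image under the Lipschitz map \<open>\<Psi>\<close>, and
    Lipschitz images of null sets are null.\<close>
  have null: "\<Phi> -` (U - V) \<in> null_sets lborel"
  proof -
    have "negligible (\<Psi> ` (U - V))"
    proof (rule negligible_locally_Lipschitz_image)
      show "negligible (U - V)" using neg by (simp add: V_def)
      show "\<exists>T B. open T \<and> x \<in> T \<and> (\<forall>y\<in>(U - V) \<inter> T. norm (\<Psi> y - \<Psi> x) \<le> B * norm (y - x))" for x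
        using lipschitz_onD[OF lip] by (intro exI[of _ UNIV] exI[of _ L]) (auto simp: dist_norm)
    qed simp
    moreover have "\<Phi> -` (U - V) \<subseteq> \<Psi> ` (U - V)" using inv by (metis image_eqI subsetI vimageD)
    ultimately have "negligible (\<Phi> -` (U - V))" by (rule negligible_subset)
    moreover have "\<Phi> -` (U - V) \<in> sets lborel"
      using measurable_sets[of \<Phi> borel borel "U - V"] U V by simp
    ultimately show ?thesis by (simp add: negligible_iff_null_sets null_sets_completion_iff)
  qed
  have ball: "emeasure ?\<nu> (?b i) \<le> ennreal (L ^ DIM('a)) * emeasure lborel (?b i)" if "i \<in> C" for i
  proof -
    have r: "0 < snd i" using C that by auto
    have "\<Phi> -` ?b i \<subseteq> cball (\<Psi> (fst i)) (L * snd i)"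
    proof
      fix p assume p: "p \<in> \<Phi> -` ?b i"
      have "dist (\<Psi> (fst i)) (\<Psi> (\<Phi> p)) \<le> L * dist (fst i) (\<Phi> p)"
        by (rule lipschitz_onD[OF lip]) auto
      also have "\<dots> \<le> L * snd i" using p L by (intro mult_left_mono) auto
      finally show "p \<in> cball (\<Psi> (fst i)) (L * snd i)" by (simp add: inv)
    qed
    then have "emeasure ?\<nu> (?b i) \<le> emeasure lborel (cball (\<Psi> (fst i)) (L * snd i))"
      by (simp add: emeasure_distr) (intro emeasure_mono, auto)
    also have "\<dots> = ennreal (L ^ DIM('a)) * emeasure lborel (?b i)"
      using L r by (simp add: emeasure_cball emeasure_ball power_mult_distrib mult_ac flip: ennreal_mult)
    finally show ?thesis .
  qed
  have "emeasure lborel (\<Phi> -` U) = emeasure lborel (\<Phi> -` V \<union> \<Phi> -` (U - V))"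
    using V by (auto intro!: arg_cong[where f = "emeasure lborel"])
  also have "\<dots> = emeasure lborel (\<Phi> -` V)"
    using measurable_sets[of \<Phi> borel borel V] V null by (intro emeasure_Un_null_set) auto
  also have "\<dots> = emeasure ?\<nu> V" using V by (simp add: emeasure_distr)
  also have "\<dots> = (\<integral>\<^sup>+i. emeasure ?\<nu> (?b i) \<partial>count_space C)"
    unfolding V_def by (rule emeasure_UN_countable) (use C disj' in auto)
  also have "\<dots> \<le> (\<integral>\<^sup>+i. ennreal (L ^ DIM('a)) * emeasure lborel (?b i) \<partial>count_space C)"
    by (intro nn_integral_mono) (use ball in auto)
  also have "\<dots> = ennreal (L ^ DIM('a)) * (\<integral>\<^sup>+i. emeasure lborel (?b i) \<partial>count_space C)"
    by (rule nn_integral_cmult) auto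
  also have "(\<integral>\<^sup>+i. emeasure lborel (?b i) \<partial>count_space C) = emeasure lborel V"
    unfolding V_def by (rule emeasure_UN_countable[symmetric]) (use C disj' in auto)
  also have "\<dots> \<le> emeasure lborel U" using V U by (intro emeasure_mono) auto
  finally show ?thesis by (simp add: mult_left_mono)
qed

text \<open>Outer regularity reduces Borel sets to open sets.\<close>

lemma emeasure_vimage_le_of_lipschitz_inverse:
  fixes \<Phi> \<Psi> :: "'a::euclidean_space \<Rightarrow> 'a"
  assumes lip: "L-lipschitz_on UNIV \<Psi>" and inv: "\<And>p. \<Psi> (\<Phi> p) = p"
    and cont: "continuous_on UNIV \<Phi>" and A: "A \<in> sets borel"
  shows "emeasure lborel (\<Phi> -` A) \<le> ennreal (L ^ DIM('a)) * emeasure lborel A"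
proof -
  let ?c = "L ^ DIM('a)"
  have c: "0 \<le> ?c" using lipschitz_on_nonneg[OF lip] by simp
  have [measurable]: "\<Phi> \<in> borel_measurable borel" using cont by (rule borel_measurable_continuous_onI)
  show ?thesis
  proof (rule ennreal_le_epsilon)
    fix e :: real assume "0 < e"
    \<comment> \<open>\<open>?c\<close> is known only to be nonnegative, so the excess measure is
      chosen relative to \<open>?c + 1\<close>.\<close>
    then have e': "0 < e / (?c + 1)" using c by auto
    obtain U where U: "open U" "A \<subseteq> U" "emeasure lborel (U - A) < e / (?c + 1)"
      using outer_regular_lborel[OF A e'] by metis
    have "emeasure lborel (\<Phi> -` A) \<le> emeasure lborel (\<Phi> -` U)"
      using U measurable_sets[of \<Phi> borel borel U] by (intro emeasure_mono) auto
    also have "\<dots> \<le> ennreal ?c * emeasure lborel U"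
      by (rule emeasure_vimage_le_of_lipschitz_inverse_open[OF lip inv cont U(1)])
    also have "emeasure lborel U \<le> emeasure lborel A + emeasure lborel (U - A)"
      using emeasure_subadditive[of A lborel "U - A"] U A by (auto simp: Un_absorb1)
    also have "\<dots> \<le> emeasure lborel A + ennreal (e / (?c + 1))"
      using U by (intro add_left_mono) auto
    also have "ennreal ?c * \<dots> = ennreal ?c * emeasure lborel A + ennreal (?c * (e / (?c + 1)))"
      using c \<open>0 < e\<close> by (simp add: distrib_left flip: ennreal_mult)
    also have "\<dots> \<le> ennreal ?c * emeasure lborel A + ennreal e"
      using c \<open>0 < e\<close> by (intro add_left_mono ennreal_leI) (simp add: field_simps)
    finally show "emeasure lborel (\<Phi> -` A) \<le> ennreal ?c * emeasure lborel A + ennreal e"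
      by (simp add: mult_left_mono)
  qed
qed

text \<open>A change of variables inequality without a Jacobian: the push-forward of Lebesgue
  measure is dominated by a multiple of it.\<close>

lemma nn_integral_compose_le_of_lipschitz_inverse:
  fixes \<Phi> \<Psi> :: "'a::euclidean_space \<Rightarrow> 'a" and u :: "'a \<Rightarrow> ennreal"
  assumes lip: "L-lipschitz_on UNIV \<Psi>" and inv: "\<And>p. \<Psi> (\<Phi> p) = p"
    and cont: "continuous_on UNIV \<Phi>" and u: "u \<in> borel_measurable borel"
  shows "(\<integral>\<^sup>+p. u (\<Phi> p) \<partial>lborel) \<le> ennreal (L ^ DIM('a)) * (\<integral>\<^sup>+p. u p \<partial>lborel)"
proof -
  have [measurable]: "\<Phi> \<in> borel_measurable borel" using cont by (rule borel_measurable_continuous_onI)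
  have "(\<integral>\<^sup>+p. u (\<Phi> p) \<partial>lborel) = (\<integral>\<^sup>+p. u p \<partial>distr lborel borel \<Phi>)"
    using u by (simp add: nn_integral_distr)
  also have "\<dots> \<le> (\<integral>\<^sup>+p. u p \<partial>scale_measure (ennreal (L ^ DIM('a))) lborel)"
  proof (rule nn_integral_mono_measure)
    show "distr lborel borel \<Phi> \<le> scale_measure (ennreal (L ^ DIM('a))) lborel"
      using emeasure_vimage_le_of_lipschitz_inverse[OF lip inv cont]
      by (subst le_measure) (auto simp: emeasure_distr)
  qed simp
  finally show ?thesis using u by (simp add: nn_integral_scale_measure)
qed


section \<open>Cones over the unit sphere of a metric norm\<close>

lemma metric_norm_scaleR: "metric_norm g x (c *\<^sub>R v) = \<bar>c\<bar> * metric_norm g x v"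
  by (simp add: metric_norm_def metric_inner_def matrix_vector_mult_scaleR real_sqrt_mult
      flip: power2_eq_square mult.assoc)

lemma metric_norm_uminus [simp]: "metric_norm g x (- v) = metric_norm g x v"
  using metric_norm_scaleR[of g x "-1" v] by simp

lemma metric_norm_normalize:
  "0 < metric_norm g x v \<Longrightarrow> metric_norm g x (v /\<^sub>R metric_norm g x v) = 1"
  by (simp add: metric_norm_scaleR)

lemma normalize_scaleR:
  assumes "0 < c"
  shows "(c *\<^sub>R v) /\<^sub>R metric_norm g x (c *\<^sub>R v) = v /\<^sub>R metric_norm g x v"
  using assms by (simp add: metric_norm_scaleR)

lemma continuous_on_metric_norm [continuous_intros]: "continuous_on S (metric_norm g x)"
  unfolding metric_norm_def metric_inner_def
  by (intro continuous_intros)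

lemma borel_measurable_metric_norm [measurable]: "metric_norm g x \<in> borel_measurable borel"
  by (intro borel_measurable_continuous_onI continuous_intros)

text \<open>The lower speed \<open>a\<close> takes two values: 0 gives the punctured unit ball from
  which \<open>sphere_measure\<close> is built, and 1/2 gives vectors whose speed stays away from
  0.\<close>

definition shell :: "(real^'n \<Rightarrow> real^'n^'n) \<Rightarrow> real^'n \<Rightarrow> real \<Rightarrow> (real^'n) set" where
  "shell g x a = {v. a < metric_norm g x v \<and> metric_norm g x v \<le> 1}"

definition shell_measure :: "(real^'n \<Rightarrow> real^'n^'n) \<Rightarrow> real^'n \<Rightarrow> real \<Rightarrow> (real^'n) measure" where
  "shell_measure g x a = distr (restrict_space lborel (shell g x a))
     (restrict_space borel {v. metric_norm g x v = 1}) (\<lambda>v. v /\<^sub>R metric_norm g x v)"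

lemma shell_measurable [measurable]: "shell g x a \<in> sets borel"
  unfolding shell_def by measurable

lemma unit_sphere_measurable [measurable]: "{v. metric_norm g x v = 1} \<in> sets borel"
  by measurable

lemma normalize_measurable:
  assumes "0 \<le> a"
  shows "(\<lambda>v. v /\<^sub>R metric_norm g x v) \<in> restrict_space lborel (shell g x a)
    \<rightarrow>\<^sub>M restrict_space borel {v. metric_norm g x v = 1}"
proof (rule measurable_restrict_space2)
  show "(\<lambda>v. v /\<^sub>R metric_norm g x v)
      \<in> space (restrict_space lborel (shell g x a)) \<rightarrow> {v. metric_norm g x v = 1}"
    using assms by (auto simp: shell_def space_restrict_space intro!: metric_norm_normalize)
  show "(\<lambda>v. v /\<^sub>R metric_norm g x v) \<in> borel_measurable (restrict_space lborel (shell g x a))"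
    by (intro measurable_restrict_space1) measurable
qed

lemma sets_shell_measure [measurable_cong]:
  "sets (shell_measure g x a) = sets (restrict_space borel {v. metric_norm g x v = 1})"
  by (simp add: shell_measure_def)

lemma space_shell_measure: "space (shell_measure g x a) = {v. metric_norm g x v = 1}"
  by (simp add: shell_measure_def space_restrict_space)

lemma emeasure_shell_measure:
  assumes a: "0 \<le> a" and A: "A \<in> sets (shell_measure g x a)"
  shows "emeasure (shell_measure g x a) A
    = emeasure lborel {v \<in> shell g x a. v /\<^sub>R metric_norm g x v \<in> A}"
proof -
  have "emeasure (shell_measure g x a) A = emeasure (restrict_space lborel (shell g x a))
      ((\<lambda>v. v /\<^sub>R metric_norm g x v) -` A \<inter> shell g x a)"
    unfolding shell_measure_def
    using normalize_measurable[OF a] A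
    by (subst emeasure_distr) (auto simp: shell_measure_def space_restrict_space)
  also have "(\<lambda>v. v /\<^sub>R metric_norm g x v) -` A \<inter> shell g x a = {v \<in> shell g x a. v /\<^sub>R metric_norm g x v \<in> A}"
    by auto
  finally show ?thesis by (subst (asm) emeasure_restrict_space) auto
qed

lemma shell_cone_measurable:
  assumes A: "A \<in> sets (shell_measure g x a)"
  shows "{v \<in> shell g x b. v /\<^sub>R metric_norm g x v \<in> A} \<in> sets borel"
proof -
  have [measurable]: "A \<in> sets borel"
    using A by (auto simp: sets_shell_measure sets_restrict_space)
  show ?thesis by measurable
qed

text \<open>The cone over \<open>- A\<close> is the negative of the cone over \<open>A\<close>, and
  negation preserves Lebesgue measure.\<close>

lemma emeasure_shell_measure_uminus:
  assumes a: "0 \<le> a" and A: "A \<in> sets (shell_measure g x a)"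
  shows "emeasure (shell_measure g x a) (uminus -` A) = emeasure (shell_measure g x a) A"
proof -
  let ?D = "{v \<in> shell g x a. v /\<^sub>R metric_norm g x v \<in> A}"
  have A': "uminus -` A \<in> sets (shell_measure g x a)"
  proof -
    obtain B where B: "B \<in> sets borel" "A = {v. metric_norm g x v = 1} \<inter> B"
      using A by (auto simp: sets_shell_measure sets_restrict_space)
    have "uminus -` B \<in> sets borel" using measurable_sets[of uminus borel borel B] B by simp
    moreover have "uminus -` A = {v. metric_norm g x v = 1} \<inter> uminus -` B" using B by auto
    ultimately show ?thesis by (auto simp: sets_shell_measure sets_restrict_space)
  qed
  have eq: "{v \<in> shell g x a. v /\<^sub>R metric_norm g x v \<in> uminus -` A} = (\<lambda>v. (-1) *\<^sub>R v + 0) ` ?D"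
  proof (intro equalityI subsetI)
    fix v assume "v \<in> {v \<in> shell g x a. v /\<^sub>R metric_norm g x v \<in> uminus -` A}"
    then have "- v \<in> ?D" by (simp add: shell_def)
    then show "v \<in> (\<lambda>v. (-1) *\<^sub>R v + 0) ` ?D" by (rule rev_image_eqI) simp
  qed (auto simp: shell_def)
  have "emeasure lborel {v \<in> shell g x a. v /\<^sub>R metric_norm g x v \<in> uminus -` A} = emeasure lborel ?D"
  proof -
    have "emeasure lborel {v \<in> shell g x a. v /\<^sub>R metric_norm g x v \<in> uminus -` A}
        = emeasure lebesgue {v \<in> shell g x a. v /\<^sub>R metric_norm g x v \<in> uminus -` A}"
      using shell_cone_measurable[OF A', of a] by simp
    also have "\<dots> = emeasure lebesgue ?D"
      unfolding eq emeasure_lebesgue_affine by simp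
    finally show ?thesis using shell_cone_measurable[OF A, of a] by simp
  qed
  then show ?thesis using a A A' by (simp add: emeasure_shell_measure)
qed

text \<open>The metric norm attains a positive minimum on the compact Euclidean unit sphere, and
  homogeneity spreads this bound to all vectors.\<close>

lemma metric_norm_lower_bound:
  assumes pos: "\<And>v. v \<noteq> 0 \<Longrightarrow> 0 < metric_inner g x v v"
  obtains m where "0 < m" "\<And>v. m * norm v \<le> metric_norm g x v"
proof -
  have "compact (sphere (0::real^'n) 1)" "sphere (0::real^'n) 1 \<noteq> {}" by auto
  then obtain w where w: "w \<in> sphere 0 1" "\<And>v. v \<in> sphere 0 1 \<Longrightarrow> metric_norm g x w \<le> metric_norm g x v"
    using continuous_attains_inf[OF _ _ continuous_on_metric_norm, of "sphere 0 1" g x] by blast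
  have "0 < metric_norm g x w" using w(1) pos[of w] by (cases "w = 0") (auto simp: metric_norm_def)
  moreover have "metric_norm g x w * norm v \<le> metric_norm g x v" for v
  proof (cases "v = 0")
    case False
    then have "metric_norm g x w \<le> metric_norm g x (v /\<^sub>R norm v)" by (intro w(2)) auto
    then show ?thesis using False by (simp add: metric_norm_scaleR field_simps)
  qed (simp add: metric_norm_def metric_inner_def)
  ultimately show ?thesis using that by blast
qed

text \<open>The halving argument subtracts half of the volume of a cone from both sides of an
  inequality, which requires that volume to be finite.\<close>

lemma emeasure_shell_finite:
  assumes pos: "\<And>v. v \<noteq> 0 \<Longrightarrow> 0 < metric_inner g x v v"
  shows "emeasure lborel (shell g x a) < \<infinity>"
proof -
  obtain m where m: "0 < m" "\<And>v. m * norm v \<le> metric_norm g x v"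
    using metric_norm_lower_bound[of g x] pos by blast
  have "norm v \<le> 1 / m" if "v \<in> shell g x a" for v
    using m(1) m(2)[of v] that by (simp add: shell_def field_simps)
  then have "bounded (shell g x a)" by (auto simp: bounded_iff)
  then show ?thesis using emeasure_bounded_finite by blast
qed

text \<open>Halving maps a cone onto its part of norm at most \<open>1/2\<close>, which therefore carries at most
  half of its volume.\<close>

lemma shell_measure_0_le:
  assumes pos: "\<And>v. v \<noteq> 0 \<Longrightarrow> 0 < metric_inner g x v v"
  shows "shell_measure g x 0 \<le> scale_measure 2 (shell_measure g x (1/2))"
proof (subst le_measure)
  show "\<forall>A\<in>sets (shell_measure g x 0). emeasure (shell_measure g x 0) A
      \<le> emeasure (scale_measure 2 (shell_measure g x (1/2))) A"
  proof
    fix A assume A: "A \<in> sets (shell_measure g x 0)"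
    let ?n = "\<lambda>v. v /\<^sub>R metric_norm g x v"
    let ?D = "\<lambda>a. {v \<in> shell g x a. ?n v \<in> A}"
    let ?H = "(\<lambda>v. (1/2) *\<^sub>R v + 0) ` ?D 0"
    have D: "?D a \<in> sets borel" for a using shell_cone_measurable[OF A] .
    have Heq: "?H = {v. 0 < metric_norm g x v \<and> metric_norm g x v \<le> 1/2 \<and> ?n v \<in> A}"
    proof (intro equalityI subsetI)
      fix v assume "v \<in> {v. 0 < metric_norm g x v \<and> metric_norm g x v \<le> 1/2 \<and> ?n v \<in> A}"
      then have "2 *\<^sub>R v \<in> ?D 0" by (auto simp: shell_def metric_norm_scaleR)
      then show "v \<in> ?H" by (rule rev_image_eqI) simp
    next
      fix v assume "v \<in> ?H"
      then obtain w where w: "w \<in> ?D 0" and v: "v = (1/2) *\<^sub>R w" by auto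
      have "?n v \<in> A" unfolding v using w by (subst normalize_scaleR) auto
      then show "v \<in> {v. 0 < metric_norm g x v \<and> metric_norm g x v \<le> 1/2 \<and> ?n v \<in> A}"
        using w by (simp add: v shell_def metric_norm_scaleR)
    qed
    have [measurable]: "A \<in> sets borel" using A by (auto simp: sets_shell_measure sets_restrict_space)
    have Hm: "?H \<in> sets borel" unfolding Heq by measurable
    have fin: "emeasure lborel (?D 0) < \<infinity>"
      using emeasure_mono[of "?D 0" "shell g x 0" lborel] emeasure_shell_finite[of g x 0, OF pos]
      by (auto simp: less_top[symmetric] top_unique)
    have "emeasure lborel ?H = ennreal ((1/2) ^ CARD('a)) * emeasure lborel (?D 0)"
      using emeasure_lebesgue_affine[of "1/2" 0 "?D 0"] D[of 0] Hm by simp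
    also have "\<dots> \<le> ennreal (1/2) * emeasure lborel (?D 0)"
      using power_decreasing[of 1 "CARD('a)" "1/2::real"]
      by (intro mult_right_mono ennreal_leI) (auto simp: Suc_le_eq)
    finally have H: "emeasure lborel ?H \<le> ennreal (1/2) * emeasure lborel (?D 0)" .
    have "?D 0 = ?D (1/2) \<union> ?H" unfolding Heq by (auto simp: shell_def)
    then have "emeasure lborel (?D 0) \<le> emeasure lborel (?D (1/2)) + emeasure lborel ?H"
      using emeasure_subadditive[of "?D (1/2)" lborel ?H] D[of "1/2"] Hm by simp
    also have "\<dots> \<le> emeasure lborel (?D (1/2)) + ennreal (1/2) * emeasure lborel (?D 0)"
      by (intro add_left_mono H)
    finally have le: "emeasure lborel (?D 0) \<le> emeasure lborel (?D (1/2)) + ennreal (1/2) * emeasure lborel (?D 0)" .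
    have "emeasure lborel (?D 0) \<le> 2 * emeasure lborel (?D (1/2))"
    proof (cases "emeasure lborel (?D (1/2))" rule: ennreal_cases)
      case (real r)
      obtain s where s: "0 \<le> s" "emeasure lborel (?D 0) = ennreal s"
        using fin by (cases "emeasure lborel (?D 0)" rule: ennreal_cases) auto
      have "ennreal (1/2) * ennreal s = ennreal (1/2 * s)"
        using s by (subst ennreal_mult) auto
      then have "ennreal s \<le> ennreal (r + 1/2 * s)"
        using le real s by (simp del: ennreal_half)
      then have "s \<le> r + 1/2 * s"
        by (subst (asm) ennreal_le_iff) (use real s in auto)
      then have "ennreal s \<le> ennreal (2 * r)" by (intro ennreal_leI) simp
      then show ?thesis using real s by (simp add: ennreal_mult)
    qed (simp add: ennreal_mult_eq_top_iff)
    then show "emeasure (shell_measure g x 0) A \<le> emeasure (scale_measure 2 (shell_measure g x (1/2))) A"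
      using A by (simp add: emeasure_shell_measure sets_shell_measure)
  qed
qed (simp add: sets_shell_measure)

text \<open>The density is constant in \<open>v\<close>, so it passes through the projection to the
  sphere as a scalar factor.\<close>

lemma sphere_measure_eq:
  "sphere_measure g x
    = completion (scale_measure (of_nat CARD('n) * ennreal (sqrt (det (g x)))) (shell_measure g x 0))"
  for g :: "real^'n \<Rightarrow> real^'n^'n"
proof -
  let ?c = "ennreal (sqrt (det (g x)))"
  let ?R = "restrict_space lborel (shell g x 0)"
  let ?S = "restrict_space borel {v. metric_norm g x v = 1}"
  let ?n = "\<lambda>v. v /\<^sub>R metric_norm g x v"
  have "distr (density ?R (\<lambda>_. ?c)) ?S ?n = scale_measure ?c (distr ?R ?S ?n)"
  proof (rule measure_eqI)
    fix A assume "A \<in> sets (distr (density ?R (\<lambda>_. ?c)) ?S ?n)"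
    then have A: "A \<in> sets ?S" by simp
    have n: "?n \<in> density ?R (\<lambda>_. ?c) \<rightarrow>\<^sub>M ?S" using normalize_measurable[of 0 g x] by simp
    have "?n -` A \<inter> space ?R \<in> sets ?R" using measurable_sets[OF normalize_measurable[of 0 g x] A] by simp
    then show "emeasure (distr (density ?R (\<lambda>_. ?c)) ?S ?n) A = emeasure (scale_measure ?c (distr ?R ?S ?n)) A"
      using A n normalize_measurable[of 0 g x] by (simp add: emeasure_distr emeasure_density_const)
  qed simp
  then show ?thesis unfolding sphere_measure_def shell_measure_def by (simp add: shell_def)
qed


subsection \<open>Lipschitz functions and inverse matrices\<close>

text \<open>Hiding the constant lets the regularity of the Christoffel symbols be derived by closure
  rules, in the way continuity is.\<close>

definition lipschitz_fun :: "'a::metric_space set \<Rightarrow> ('a \<Rightarrow> 'b::metric_space) \<Rightarrow> bool" where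
  "lipschitz_fun S f \<longleftrightarrow> (\<exists>L. L-lipschitz_on S f)"

lemma lipschitz_fun_const: "lipschitz_fun S (\<lambda>x. c)"
  unfolding lipschitz_fun_def using lipschitz_on_constant by blast

lemma lipschitz_fun_add:
  fixes f g :: "'a::metric_space \<Rightarrow> 'b::real_normed_vector"
  shows "lipschitz_fun S f \<Longrightarrow> lipschitz_fun S g \<Longrightarrow> lipschitz_fun S (\<lambda>x. f x + g x)"
  unfolding lipschitz_fun_def using lipschitz_on_add by blast

lemma lipschitz_fun_minus:
  fixes f :: "'a::metric_space \<Rightarrow> 'b::real_normed_vector"
  shows "lipschitz_fun S f \<Longrightarrow> lipschitz_fun S (\<lambda>x. - f x)"
  unfolding lipschitz_fun_def by simp

lemma lipschitz_fun_diff: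
  fixes f g :: "'a::metric_space \<Rightarrow> 'b::real_normed_vector"
  shows "lipschitz_fun S f \<Longrightarrow> lipschitz_fun S g \<Longrightarrow> lipschitz_fun S (\<lambda>x. f x - g x)"
  unfolding lipschitz_fun_def using lipschitz_on_diff by blast

lemma lipschitz_fun_compose:
  assumes "lipschitz_fun T f" "lipschitz_fun S g" "g ` S \<subseteq> T"
  shows "lipschitz_fun S (\<lambda>x. f (g x))"
proof -
  obtain L M where L: "L-lipschitz_on T f" and M: "M-lipschitz_on S g"
    using assms unfolding lipschitz_fun_def by blast
  have "(L * M)-lipschitz_on S (\<lambda>x. f (g x))"
    by (rule lipschitz_on_compose2[OF M]) (rule lipschitz_on_subset[OF L assms(3)])
  then show ?thesis unfolding lipschitz_fun_def by blast
qed

lemma lipschitz_fun_bounded: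
  assumes "lipschitz_fun S f" "bounded S"
  shows "bounded (f ` S)"
proof (cases "S = {}")
  case False
  then obtain a where a: "a \<in> S" by blast
  obtain L where L: "L-lipschitz_on S f" using assms(1) unfolding lipschitz_fun_def by blast
  obtain e where e: "\<And>x. x \<in> S \<Longrightarrow> dist a x \<le> e" using assms(2) bounded_any_center[of S a] by blast
  have "dist (f a) (f x) \<le> L * e" if "x \<in> S" for x
    using lipschitz_onD[OF L a that] e[OF that] lipschitz_on_nonneg[OF L]
    by (meson mult_left_mono order_trans)
  then show ?thesis unfolding bounded_def by blast
qed simp

lemma lipschitz_fun_mult:
  fixes f g :: "'a::metric_space \<Rightarrow> real"
  assumes f: "lipschitz_fun S f" and g: "lipschitz_fun S g" and S: "bounded S"
  shows "lipschitz_fun S (\<lambda>x. f x * g x)"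
proof -
  obtain L M where L: "L-lipschitz_on S f" and M: "M-lipschitz_on S g"
    using f g unfolding lipschitz_fun_def by blast
  obtain A B where A: "0 < A" "\<And>x. x \<in> S \<Longrightarrow> \<bar>f x\<bar> \<le> A" and B: "0 < B" "\<And>x. x \<in> S \<Longrightarrow> \<bar>g x\<bar> \<le> B"
    using lipschitz_fun_bounded[OF f S] lipschitz_fun_bounded[OF g S]
    unfolding bounded_pos by auto
  have "(L * B + A * M)-lipschitz_on S (\<lambda>x. f x * g x)"
  proof (rule lipschitz_onI)
    show "0 \<le> L * B + A * M" using lipschitz_on_nonneg[OF L] lipschitz_on_nonneg[OF M] A B by simp
    fix x y assume xy: "x \<in> S" "y \<in> S"
    have "f x * g x - f y * g y = (f x - f y) * g x + f y * (g x - g y)" by (simp add: algebra_simps)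
    then have "dist (f x * g x) (f y * g y) \<le> dist (f x) (f y) * \<bar>g x\<bar> + \<bar>f y\<bar> * dist (g x) (g y)"
      using abs_triangle_ineq[of "(f x - f y) * g x" "f y * (g x - g y)"]
      by (simp add: dist_real_def abs_mult)
    also have "\<dots> \<le> (L * dist x y) * B + A * (M * dist x y)"
      by (intro add_mono mult_mono lipschitz_onD[OF L] lipschitz_onD[OF M] A B xy
          mult_nonneg_nonneg lipschitz_on_nonneg[OF L] zero_le_dist abs_ge_zero less_imp_le[OF A(1)])
    finally show "dist (f x * g x) (f y * g y) \<le> (L * B + A * M) * dist x y" by (simp add: algebra_simps)
  qed
  then show ?thesis unfolding lipschitz_fun_def by blast
qed

lemma lipschitz_fun_inverse:
  fixes f :: "'a::metric_space \<Rightarrow> real"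
  assumes f: "lipschitz_fun S f" and m: "0 < m" "\<And>x. x \<in> S \<Longrightarrow> m \<le> \<bar>f x\<bar>"
  shows "lipschitz_fun S (\<lambda>x. inverse (f x))"
proof -
  obtain L where L: "L-lipschitz_on S f" using f unfolding lipschitz_fun_def by blast
  have "(L / (m * m))-lipschitz_on S (\<lambda>x. inverse (f x))"
  proof (rule lipschitz_onI)
    show "0 \<le> L / (m * m)" using lipschitz_on_nonneg[OF L] m by simp
    fix x y assume xy: "x \<in> S" "y \<in> S"
    have nz: "f x \<noteq> 0" "f y \<noteq> 0" using m(1) m(2)[OF xy(1)] m(2)[OF xy(2)] by auto
    have "dist (inverse (f x)) (inverse (f y)) = dist (f x) (f y) / (\<bar>f x\<bar> * \<bar>f y\<bar>)"
      using nz by (simp add: dist_real_def inverse_diff_inverse abs_mult divide_simps)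
    also have "\<dots> \<le> (L * dist x y) / (m * m)"
      using m xy lipschitz_onD[OF L] lipschitz_on_nonneg[OF L] by (intro frac_le mult_mono) auto
    finally show "dist (inverse (f x)) (inverse (f y)) \<le> L / (m * m) * dist x y" by simp
  qed
  then show ?thesis unfolding lipschitz_fun_def by blast
qed

lemma lipschitz_fun_sum:
  fixes f :: "'i \<Rightarrow> 'a::metric_space \<Rightarrow> 'b::real_normed_vector"
  assumes "\<And>i. i \<in> I \<Longrightarrow> lipschitz_fun S (f i)"
  shows "lipschitz_fun S (\<lambda>x. \<Sum>i\<in>I. f i x)"
  using assms by (induction I rule: infinite_finite_induct) (auto intro: lipschitz_fun_const lipschitz_fun_add)

lemma lipschitz_fun_prod:
  fixes f :: "'i \<Rightarrow> 'a::metric_space \<Rightarrow> real"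
  assumes "\<And>i. i \<in> I \<Longrightarrow> lipschitz_fun S (f i)" and "bounded S"
  shows "lipschitz_fun S (\<lambda>x. \<Prod>i\<in>I. f i x)"
  using assms by (induction I rule: infinite_finite_induct) (auto intro: lipschitz_fun_const lipschitz_fun_mult)

lemma lipschitz_fun_component: "lipschitz_fun S f \<Longrightarrow> lipschitz_fun S (\<lambda>x. f x $ i)"
  unfolding lipschitz_fun_def lipschitz_on_def using dist_vec_nth_le order_trans by metis

lemma lipschitz_fun_vec:
  fixes f :: "'a::metric_space \<Rightarrow> real^'m"
  assumes "\<And>i. lipschitz_fun S (\<lambda>x. f x $ i)"
  shows "lipschitz_fun S f"
proof -
  obtain L where L: "\<And>i. (L i)-lipschitz_on S (\<lambda>x. f x $ i)"
    using assms unfolding lipschitz_fun_def by metis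
  have "(\<Sum>i\<in>UNIV. L i)-lipschitz_on S f"
  proof (rule lipschitz_onI)
    show "0 \<le> (\<Sum>i\<in>UNIV. L i)" by (intro sum_nonneg lipschitz_on_nonneg[OF L])
    fix x y assume xy: "x \<in> S" "y \<in> S"
    have "dist (f x) (f y) \<le> (\<Sum>i\<in>UNIV. dist (f x $ i) (f y $ i))"
      using norm_le_l1_cart[of "f x - f y"] by (simp add: dist_norm)
    also have "\<dots> \<le> (\<Sum>i\<in>UNIV. L i * dist x y)"
      using lipschitz_onD[OF L xy] by (intro sum_mono)
    finally show "dist (f x) (f y) \<le> (\<Sum>i\<in>UNIV. L i) * dist x y" by (simp add: sum_distrib_right)
  qed
  then show ?thesis unfolding lipschitz_fun_def by blast
qed

lemma lipschitz_fun_cong: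
  assumes "\<And>x. x \<in> S \<Longrightarrow> f x = h x"
  shows "lipschitz_fun S f \<longleftrightarrow> lipschitz_fun S h"
  using assms by (auto simp: lipschitz_fun_def lipschitz_on_def)

lemma lipschitz_fun_Pair:
  "lipschitz_fun S f \<Longrightarrow> lipschitz_fun S h \<Longrightarrow> lipschitz_fun S (\<lambda>x. (f x, h x))"
  unfolding lipschitz_fun_def using lipschitz_on_Pair by blast

lemma lipschitz_fun_fst: "lipschitz_fun S fst" and lipschitz_fun_snd: "lipschitz_fun S snd"
  unfolding lipschitz_fun_def lipschitz_on_def
  using dist_fst_le dist_snd_le by (auto intro!: exI[of _ 1])

lemma lipschitz_fun_det:
  fixes A :: "'a::metric_space \<Rightarrow> real^'n^'n"
  assumes "\<And>i j. lipschitz_fun S (\<lambda>x. A x $ i $ j)" "bounded S"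
  shows "lipschitz_fun S (\<lambda>x. det (A x))"
  unfolding det_def using assms
  by (intro lipschitz_fun_sum lipschitz_fun_mult lipschitz_fun_prod lipschitz_fun_const) auto

text \<open>Continuity of the derivative is given for each fixed direction, so the operator norm is
  bounded through the finitely many basis directions. Convexity then allows the mean value
  inequality.\<close>

lemma lipschitz_fun_C1:
  fixes h :: "'a::euclidean_space \<Rightarrow> 'b::real_normed_vector"
  assumes S: "convex S" "compact S" and diff: "h differentiable_on S"
    and cont: "\<And>v. continuous_on S (\<lambda>x. frechet_derivative h (at x within S) v)"
  shows "lipschitz_fun S h"
proof -
  let ?D = "\<lambda>x. frechet_derivative h (at x within S)"
  have der: "(h has_derivative ?D x) (at x within S)" if "x \<in> S" for x
    using diff that by (auto simp: differentiable_on_def frechet_derivative_works)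
  have "\<exists>M. \<forall>x\<in>S. norm (?D x b) \<le> M" for b
    using compact_imp_bounded[OF compact_continuous_image[OF cont S(2)], of b]
    by (auto simp: bounded_iff)
  then obtain M where M: "\<And>b x. x \<in> S \<Longrightarrow> norm (?D x b) \<le> M b" by metis
  have on: "onorm (?D x) \<le> (\<Sum>b\<in>Basis. \<bar>M b\<bar>)" if "x \<in> S" for x
  proof (rule onorm_le)
    fix v
    have lin: "linear (?D x)" using has_derivative_linear[OF der[OF that]] .
    have "?D x v = ?D x (\<Sum>b\<in>Basis. (v \<bullet> b) *\<^sub>R b)" by (simp add: euclidean_representation)
    also have "\<dots> = (\<Sum>b\<in>Basis. (v \<bullet> b) *\<^sub>R ?D x b)" using lin by (simp add: linear_sum linear_scale)
    also have "norm \<dots> \<le> (\<Sum>b\<in>Basis. norm v * \<bar>M b\<bar>)"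
    proof (rule order_trans[OF norm_sum sum_mono])
      fix b :: 'a assume b: "b \<in> Basis"
      have "norm (?D x b) \<le> \<bar>M b\<bar>" using M[OF that, of b] by linarith
      then show "norm ((v \<bullet> b) *\<^sub>R ?D x b) \<le> norm v * \<bar>M b\<bar>"
        using Basis_le_norm[OF b, of v] by (simp add: mult_mono)
    qed
    finally show "norm (?D x v) \<le> (\<Sum>b\<in>Basis. \<bar>M b\<bar>) * norm v"
      by (simp add: sum_distrib_left mult.commute)
  qed
  have "(\<Sum>b\<in>Basis. \<bar>M b\<bar>)-lipschitz_on S h"
    by (rule bounded_derivative_imp_lipschitz[OF der S(1) on]) (auto intro: sum_nonneg)
  then show ?thesis unfolding lipschitz_fun_def by blast
qed

section \<open>Inverses and determinants of matrices\<close>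

lemma matrix_inv_inverse:
  fixes A :: "real^'n^'n"
  assumes "invertible A"
  shows "A ** matrix_inv A = mat 1" "matrix_inv A ** A = mat 1"
  using someI_ex[of "\<lambda>B. A ** B = mat 1 \<and> B ** A = mat 1"] assms
  unfolding invertible_def matrix_inv_def by auto

text \<open>Cramer's rule writes each entry as a quotient of polynomials in the entries of
  \<open>A\<close>, so Lipschitz bounds and differentiability carry over from the metric to its
  inverse.\<close>

lemma matrix_inv_cramer:
  fixes A :: "real^'n^'n"
  assumes "invertible A"
  shows "matrix_inv A $ k $ l = det (\<chi> i j. if j = k then axis l 1 $ i else A $ i $ j) / det A"
proof -
  have inv: "A *v (matrix_inv A *v axis l 1) = axis l 1"
    by (subst matrix_vector_mul_assoc, subst matrix_inv_inverse(1)[OF assms], rule matrix_vector_mul_lid)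
  have "det A \<noteq> 0" using assms by (simp add: invertible_det_nz)
  then have "matrix_inv A *v axis l 1
      = (\<chi> k. det (\<chi> i j. if j = k then axis l 1 $ i else A $ i $ j) / det A)"
    by (rule iffD1[OF cramer inv])
  moreover have "matrix_inv A $ k $ l = (matrix_inv A *v axis l 1) $ k"
    by (simp add: matrix_vector_mult_basis column_def)
  ultimately show ?thesis by (simp only: vec_lambda_beta)
qed

lemma differentiable_det:
  fixes A :: "'a::real_normed_vector \<Rightarrow> real^'n^'n"
  assumes "\<And>i j. (\<lambda>x. A x $ i $ j) differentiable (at x within S)"
  shows "(\<lambda>x. det (A x)) differentiable (at x within S)"
proof -
  have "(\<lambda>x. \<Prod>i\<in>UNIV. A x $ i $ p i) differentiable (at x within S)" for p
  proof -
    have "\<forall>i. \<exists>D. ((\<lambda>x. A x $ i $ p i) has_derivative D) (at x within S)"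
      using assms unfolding differentiable_def by blast
    then obtain D where D: "\<And>i. ((\<lambda>x. A x $ i $ p i) has_derivative D i) (at x within S)"
      by (auto dest!: choice)
    show ?thesis unfolding differentiable_def
      using has_derivative_prod[of UNIV "\<lambda>i x. A x $ i $ p i" D x S, OF D] by blast
  qed
  then show ?thesis
    unfolding det_def by (intro differentiable_sum differentiable_mult differentiable_const) auto
qed


subsection \<open>The geodesic vector field\<close>

lemma Ck_on_Suc: "Ck_on (Suc k) f S \<Longrightarrow> Ck_on k f S"
proof (induction k arbitrary: f)
  case 0
  then show ?case by (simp add: differentiable_imp_continuous_on)
qed simp

lemma Ck_on_mono: "l \<le> k \<Longrightarrow> Ck_on k f S \<Longrightarrow> Ck_on l f S"
proof (induction rule: dec_induct)
  case (step n)
  then show ?case using Ck_on_Suc by blast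
qed

lemma bounded_bilinear_matrix_vector:
  "bounded_bilinear ((*v) :: real^'m^'n \<Rightarrow> real^'m \<Rightarrow> real^'n)"
  unfolding bilinear_conv_bounded_bilinear[symmetric] bilinear_def
  by (auto intro!: linearI simp: matrix_vector_mult_add_rdistrib matrix_vector_right_distrib
      matrix_vector_mult_scaleR scaleR_matrix_vector_assoc)

text \<open>The geodesic spray in coordinates, as a first-order system for position and
  velocity.\<close>

definition geodesic_field ::
  "(real^'n \<Rightarrow> real^'n^'n) \<Rightarrow> (real^'n) \<times> (real^'n) \<Rightarrow> (real^'n) \<times> (real^'n)" where
  "geodesic_field g p = (snd p, - christoffel g (fst p) (snd p) (snd p))"

lemma geodesic_on_iff:
  "geodesic_on g J c \<longleftrightarrow> ode_solution (geodesic_field g) J c \<and> (\<forall>t\<in>J. fst (c t) \<in> BM)"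
  unfolding geodesic_on_def ode_solution_def geodesic_field_def by auto

text \<open>Christoffel symbols contain first derivatives of the metric, so two derivatives make
  them Lipschitz on the ball and geodesics unique.\<close>

locale ball_metric =
  fixes g :: "real^'n \<Rightarrow> real^'n^'n"
  assumes C2: "Ck_metric 2 g"
begin

abbreviation Dg :: "real^'n \<Rightarrow> real^'n \<Rightarrow> real^'n^'n" where
  "Dg x \<equiv> frechet_derivative g (at x within BM)"

lemma metric_pos: "x \<in> BM \<Longrightarrow> v \<noteq> 0 \<Longrightarrow> 0 < metric_inner g x v v"
  and metric_transpose: "x \<in> BM \<Longrightarrow> transpose (g x) = g x"
  using C2 by (auto simp: Ck_metric_def)

lemma metric_sym: "x \<in> BM \<Longrightarrow> v \<bullet> (g x *v w) = w \<bullet> (g x *v v)"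
  using metric_transpose[of x] dot_lmul_matrix[of v "g x" w] vector_transpose_matrix[of v "g x"]
  by (simp add: inner_commute)

lemma g_has_derivative: "x \<in> BM \<Longrightarrow> (g has_derivative Dg x) (at x within BM)"
  using C2 by (auto simp: Ck_metric_def numeral_2_eq_2 differentiable_on_def frechet_derivative_works)

lemma Dg_linear: "x \<in> BM \<Longrightarrow> linear (Dg x)"
  using has_derivative_linear[OF g_has_derivative] .

lemma lipschitz_g: "lipschitz_fun BM g"
proof (rule lipschitz_fun_C1)
  show "continuous_on BM (\<lambda>x. Dg x v)" for v
    using C2 by (auto simp: Ck_metric_def numeral_2_eq_2 intro: differentiable_imp_continuous_on)
qed (use C2 in \<open>auto simp: Ck_metric_def numeral_2_eq_2\<close>)

lemma lipschitz_Dg: "lipschitz_fun BM (\<lambda>x. Dg x v)"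
  by (rule lipschitz_fun_C1) (use C2 in \<open>auto simp: Ck_metric_def numeral_2_eq_2\<close>)

lemma continuous_g: "continuous_on BM g"
  using lipschitz_g lipschitz_on_continuous_on unfolding lipschitz_fun_def by blast

lemma metric_invertible:
  assumes "x \<in> BM"
  shows "invertible (g x)"
proof -
  have "v = 0" if "g x *v v = 0" for v
    using metric_pos[OF assms, of v] that by (auto simp: metric_inner_def)
  then have "\<exists>B. B ** g x = mat 1" by (simp add: matrix_left_invertible_ker)
  then show ?thesis using matrix_left_right_inverse unfolding invertible_def by blast
qed

lemma metric_inv:
  assumes "x \<in> BM"
  shows "g x *v (matrix_inv (g x) *v v) = v" "matrix_inv (g x) *v (g x *v v) = v"
  using matrix_inv_inverse[OF metric_invertible[OF assms]]
  by (simp_all add: matrix_vector_mul_assoc)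

text \<open>The segment from the identity to \<open>g x\<close> consists of positive definite matrices, so the
  determinant cannot change sign along it.\<close>

lemma det_metric_pos:
  assumes x: "x \<in> BM"
  shows "0 < det (g x)"
proof (rule ccontr)
  assume neg: "\<not> 0 < det (g x)"
  define A where "A t = (1 - t) *\<^sub>R (mat 1 :: real^'n^'n) + t *\<^sub>R g x" for t :: real
  have "continuous_on {0..1} (\<lambda>t. det (A t))"
    unfolding det_def A_def by (simp add: mat_def) (intro continuous_intros)
  moreover have "det (A 1) \<le> 0" "0 \<le> det (A 0)" using neg by (auto simp: A_def det_I)
  ultimately obtain t where t: "0 \<le> t" "t \<le> 1" "det (A t) = 0"
    using IVT2'[of "\<lambda>t. det (A t)" 1 0 0] by auto
  then have "\<not> invertible (A t)" by (simp add: invertible_det_nz)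
  then have "\<nexists>B. B ** A t = mat 1" using matrix_left_right_inverse unfolding invertible_def by blast
  then obtain v where v: "A t *v v = 0" "v \<noteq> 0" unfolding matrix_left_invertible_ker by blast
  have "v \<bullet> (A t *v v) = (1 - t) * (v \<bullet> v) + t * metric_inner g x v v"
    by (simp add: A_def metric_inner_def matrix_vector_mult_add_rdistrib inner_add_right
        flip: scaleR_matrix_vector_assoc)
  moreover have "0 < (1 - t) * (v \<bullet> v) + t * metric_inner g x v v"
  proof (cases "t = 0")
    case False
    then show ?thesis using t v metric_pos[OF x v(2)] by (intro add_nonneg_pos) auto
  qed (use v in simp)
  ultimately show False using v by simp
qed

lemma continuous_det: "continuous_on BM (\<lambda>x. det (g x))"
  unfolding det_def by (intro continuous_intros continuous_g)

lemma det_lower_bound: obtains m where "0 < m" "\<And>x. x \<in> BM \<Longrightarrow> m \<le> det (g x)"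
proof -
  obtain x where "x \<in> BM" "\<And>y. y \<in> BM \<Longrightarrow> det (g x) \<le> det (g y)"
    using continuous_attains_inf[OF _ _ continuous_det] by auto
  then show ?thesis using det_metric_pos that by blast
qed

lemma lipschitz_matrix_inv: "lipschitz_fun BM (\<lambda>x. matrix_inv (g x) $ k $ l)"
proof -
  obtain m where m: "0 < m" "\<And>x. x \<in> BM \<Longrightarrow> m \<le> det (g x)" using det_lower_bound by blast
  have m': "m \<le> \<bar>det (g x)\<bar>" if "x \<in> BM" for x using m(2)[OF that] by linarith
  let ?N = "\<lambda>x. \<chi> i j. if j = k then axis l 1 $ i else g x $ i $ j"
  have gc: "lipschitz_fun BM (\<lambda>x. g x $ i $ j)" for i j
    using lipschitz_g by (intro lipschitz_fun_component)
  have N: "lipschitz_fun BM (\<lambda>x. ?N x $ i $ j)" for i j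
    using gc[of i j] by (cases "j = k") (auto simp: lipschitz_fun_const)
  have "lipschitz_fun BM (\<lambda>x. det (?N x) * inverse (det (g x)))"
    by (intro lipschitz_fun_mult lipschitz_fun_inverse[OF _ m(1) m'] lipschitz_fun_det N gc) auto
  then show ?thesis
    by (subst lipschitz_fun_cong[where h = "\<lambda>x. det (?N x) * inverse (det (g x))"])
      (auto simp: matrix_inv_cramer[OF metric_invertible] divide_inverse)
qed

lemma differentiable_matrix_inv:
  assumes x: "x \<in> BM"
  shows "(\<lambda>x. matrix_inv (g x) $ k $ l) differentiable (at x within BM)"
proof -
  let ?N = "\<lambda>x. \<chi> i j. if j = k then axis l 1 $ i else g x $ i $ j"
  have gc: "(\<lambda>x. g x $ i $ j) differentiable (at x within BM)" for i j
    unfolding differentiable_def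
    using bounded_linear.has_derivative[OF bounded_linear_vec_nth
        bounded_linear.has_derivative[OF bounded_linear_vec_nth g_has_derivative[OF x]]] by blast
  have N: "(\<lambda>x. ?N x $ i $ j) differentiable (at x within BM)" for i j
    using gc[of i j] by (cases "j = k") auto
  have d: "(\<lambda>x. det (?N x) / det (g x)) differentiable (at x within BM)"
    using det_metric_pos[OF x] by (intro differentiable_divide differentiable_det N gc) auto
  obtain D where D: "((\<lambda>x. det (?N x) / det (g x)) has_derivative D) (at x within BM)"
    using d unfolding differentiable_def by blast
  have "((\<lambda>x. matrix_inv (g x) $ k $ l) has_derivative D) (at x within BM)"
    by (rule has_derivative_transform[OF x _ D]) (rule matrix_inv_cramer[OF metric_invertible])
  then show ?thesis unfolding differentiable_def by blast
qed

lemma lipschitz_christoffel_symbol: "lipschitz_fun BM (\<lambda>x. christoffel_symbol g x i j m)"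
  unfolding christoffel_symbol_def metric_partial_def divide_inverse
  by (intro lipschitz_fun_mult lipschitz_fun_sum lipschitz_fun_const lipschitz_fun_add lipschitz_fun_diff
      lipschitz_matrix_inv lipschitz_fun_component lipschitz_Dg) auto

section \<open>Koszul's formula and conservation of speed\<close>

lemma inner_Dg_expand:
  assumes x: "x \<in> BM"
  shows "a \<bullet> (Dg x v *v b) = (\<Sum>l\<in>UNIV. \<Sum>m\<in>UNIV. \<Sum>j\<in>UNIV. a $ l * b $ m * v $ j * metric_partial g x j l m)"
proof -
  have "Dg x v = Dg x (\<Sum>j\<in>UNIV. v $ j *\<^sub>R axis j 1)"
    by (simp only: basis_expansion flip: scalar_mult_eq_scaleR)
  also have "\<dots> = (\<Sum>j\<in>UNIV. v $ j *\<^sub>R Dg x (axis j 1))"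
    by (simp only: linear_sum[OF Dg_linear[OF x]] linear_scale[OF Dg_linear[OF x]])
  finally have "Dg x v $ l $ m = (\<Sum>j\<in>UNIV. v $ j *\<^sub>R Dg x (axis j 1)) $ l $ m" for l m
    by (rule arg_cong)
  then have *: "Dg x v $ l $ m = (\<Sum>j\<in>UNIV. v $ j * metric_partial g x j l m)" for l m
    by (simp only: metric_partial_def sum_component vector_scaleR_component real_scaleR_def)
  have "a \<bullet> (Dg x v *v b) = (\<Sum>l\<in>UNIV. a $ l * (\<Sum>m\<in>UNIV. Dg x v $ l $ m * b $ m))"
    by (simp add: inner_vec_def matrix_vector_mult_def)
  also have "\<dots> = (\<Sum>l\<in>UNIV. \<Sum>m\<in>UNIV. \<Sum>j\<in>UNIV. a $ l * (v $ j * metric_partial g x j l m * b $ m))"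
    by (simp only: * sum_distrib_left sum_distrib_right)
  finally show ?thesis by (simp only: mult_ac)
qed

text \<open>Koszul's formula for coordinate-constant fields: pairing with \<open>g x\<close> cancels
  the inverse matrix in the Christoffel symbols. The geometric computations below use it in place of
  index sums.\<close>

lemma koszul:
  assumes x: "x \<in> BM"
  shows "u \<bullet> (g x *v christoffel g x v w)
    = (u \<bullet> (Dg x v *v w) + u \<bullet> (Dg x w *v v) - v \<bullet> (Dg x u *v w)) / 2"
proof -
  define T where "T l j m = metric_partial g x j l m + metric_partial g x m l j - metric_partial g x l j m"
    for l j m
  define b where "b = (\<chi> l. \<Sum>j\<in>UNIV. \<Sum>m\<in>UNIV. T l j m * v $ j * w $ m / 2)"
  have "christoffel g x v w = matrix_inv (g x) *v b"
  proof (rule vec_eq_iff[THEN iffD2], rule allI)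
    fix i
    have "christoffel g x v w $ i
        = (\<Sum>j\<in>UNIV. \<Sum>m\<in>UNIV. \<Sum>l\<in>UNIV. matrix_inv (g x) $ i $ l * (T l j m * v $ j * w $ m / 2))"
      unfolding christoffel_def christoffel_symbol_def T_def
      by (simp add: sum_distrib_right sum_divide_distrib mult.assoc)
    also have "\<dots> = (\<Sum>l\<in>UNIV. \<Sum>j\<in>UNIV. \<Sum>m\<in>UNIV. matrix_inv (g x) $ i $ l * (T l j m * v $ j * w $ m / 2))"
      by (subst sum.swap[where A = UNIV and B = UNIV and g = "\<lambda>l j. \<Sum>m\<in>UNIV. _ l j m"])
        (intro sum.cong refl sum.swap)
    also have "\<dots> = (matrix_inv (g x) *v b) $ i"
      by (simp add: matrix_vector_mult_def b_def sum_distrib_left)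
    finally show "christoffel g x v w $ i = (matrix_inv (g x) *v b) $ i" .
  qed
  then have "u \<bullet> (g x *v christoffel g x v w) = u \<bullet> b" using metric_inv[OF x] by simp
  also have "\<dots> = (\<Sum>l\<in>UNIV. \<Sum>j\<in>UNIV. \<Sum>m\<in>UNIV. u $ l * v $ j * w $ m * T l j m) / 2"
    unfolding inner_vec_def b_def by (simp add: sum_distrib_left sum_divide_distrib mult_ac)
  also have "(\<Sum>l\<in>UNIV. \<Sum>j\<in>UNIV. \<Sum>m\<in>UNIV. u $ l * v $ j * w $ m * T l j m)
      = (\<Sum>l\<in>UNIV. \<Sum>j\<in>UNIV. \<Sum>m\<in>UNIV. u $ l * v $ j * w $ m * metric_partial g x j l m)
      + (\<Sum>l\<in>UNIV. \<Sum>j\<in>UNIV. \<Sum>m\<in>UNIV. u $ l * v $ j * w $ m * metric_partial g x m l j)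
      - (\<Sum>l\<in>UNIV. \<Sum>j\<in>UNIV. \<Sum>m\<in>UNIV. u $ l * v $ j * w $ m * metric_partial g x l j m)"
    unfolding T_def by (simp add: algebra_simps sum.distrib sum_subtractf)
  also have "(\<Sum>l\<in>UNIV. \<Sum>j\<in>UNIV. \<Sum>m\<in>UNIV. u $ l * v $ j * w $ m * metric_partial g x j l m)
      = u \<bullet> (Dg x v *v w)"
    unfolding inner_Dg_expand[OF x]
    by (rule sum.cong[OF refl], subst sum.swap, simp only: mult_ac)
  also have "(\<Sum>l\<in>UNIV. \<Sum>j\<in>UNIV. \<Sum>m\<in>UNIV. u $ l * v $ j * w $ m * metric_partial g x m l j)
      = u \<bullet> (Dg x w *v v)"
    unfolding inner_Dg_expand[OF x] by (simp add: mult_ac)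
  also have "(\<Sum>l\<in>UNIV. \<Sum>j\<in>UNIV. \<Sum>m\<in>UNIV. u $ l * v $ j * w $ m * metric_partial g x l j m)
      = v \<bullet> (Dg x u *v w)"
  proof -
    have "(\<Sum>l\<in>UNIV. \<Sum>j\<in>UNIV. \<Sum>m\<in>UNIV. u $ l * v $ j * w $ m * metric_partial g x l j m)
        = (\<Sum>j\<in>UNIV. \<Sum>l\<in>UNIV. \<Sum>m\<in>UNIV. u $ l * v $ j * w $ m * metric_partial g x l j m)"
      by (rule sum.swap)
    also have "\<dots> = (\<Sum>j\<in>UNIV. \<Sum>m\<in>UNIV. \<Sum>l\<in>UNIV. u $ l * v $ j * w $ m * metric_partial g x l j m)"
      by (intro sum.cong refl sum.swap)
    finally show ?thesis unfolding inner_Dg_expand[OF x] by (simp add: mult_ac)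
  qed
  finally show ?thesis .
qed

lemma geodesic_derivatives:
  assumes c: "geodesic_on g J c" and t: "t \<in> J"
  shows "((\<lambda>t. fst (c t)) has_vector_derivative snd (c t)) (at t within J)"
    and "((\<lambda>t. snd (c t)) has_vector_derivative
      - christoffel g (fst (c t)) (snd (c t)) (snd (c t))) (at t within J)"
    and "((\<lambda>t. g (fst (c t))) has_vector_derivative Dg (fst (c t)) (snd (c t))) (at t within J)"
proof -
  have d: "(c has_vector_derivative
      (snd (c t), - christoffel g (fst (c t)) (snd (c t)) (snd (c t)))) (at t within J)"
    using c t by (auto simp: geodesic_on_def)
  show 1: "((\<lambda>t. fst (c t)) has_vector_derivative snd (c t)) (at t within J)"
    using bounded_linear.has_vector_derivative[OF bounded_linear_fst d] by simp
  show "((\<lambda>t. snd (c t)) has_vector_derivative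
      - christoffel g (fst (c t)) (snd (c t)) (snd (c t))) (at t within J)"
    using bounded_linear.has_vector_derivative[OF bounded_linear_snd d] by simp
  have sub: "(\<lambda>t. fst (c t)) ` J \<subseteq> BM" and x: "fst (c t) \<in> BM"
    using c t unfolding geodesic_on_def by blast+
  show "((\<lambda>t. g (fst (c t))) has_vector_derivative Dg (fst (c t)) (snd (c t))) (at t within J)"
    using vector_derivative_diff_chain_within[OF 1 has_derivative_subset[OF g_has_derivative[OF x] sub]]
    by (simp add: o_def)
qed

text \<open>Differentiating the metric along the curve produces
  \<open>v \<bullet> (Dg x v *v v)\<close>, and Koszul's formula with three equal arguments shows
  that the two acceleration terms cancel it. Constant speed is what confines the velocities to a
  compact set.\<close>

lemma geodesic_metric_norm:
  assumes c: "geodesic_on g J c" and J: "convex J" "s \<in> J" "t \<in> J"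
  shows "metric_norm g (fst (c s)) (snd (c s)) = metric_norm g (fst (c t)) (snd (c t))"
proof -
  let ?q = "\<lambda>t. snd (c t) \<bullet> (g (fst (c t)) *v snd (c t))"
  have "(?q has_derivative (\<lambda>h. 0)) (at t within J)" if t: "t \<in> J" for t
  proof -
    let ?x = "fst (c t)" and ?v = "snd (c t)"
    let ?G = "christoffel g ?x ?v ?v"
    note d = geodesic_derivatives[OF c t]
    have x: "?x \<in> BM" using c t by (auto simp: geodesic_on_def)
    have "(?q has_vector_derivative ?v \<bullet> (g ?x *v (- ?G) + Dg ?x ?v *v ?v) + (- ?G) \<bullet> (g ?x *v ?v)) (at t within J)"
      by (rule bounded_bilinear.has_vector_derivative[OF bounded_bilinear_inner d(2)
            bounded_bilinear.has_vector_derivative[OF bounded_bilinear_matrix_vector d(3) d(2)]])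
    moreover have "?v \<bullet> (g ?x *v (- ?G) + Dg ?x ?v *v ?v) + (- ?G) \<bullet> (g ?x *v ?v) = 0"
      using koszul[OF x, of ?v ?v ?v] metric_sym[OF x, of ?G ?v]
      by (simp add: inner_add_right inner_diff_right linear_neg[OF matrix_vector_mul_linear])
    ultimately show ?thesis by (simp add: has_vector_derivative_def)
  qed
  then have "?q s = ?q t" using has_derivative_zero_unique[OF J(1)] J by blast
  then show ?thesis by (simp add: metric_norm_def metric_inner_def)
qed

text \<open>The acceleration is quadratic in the velocity, which is why a bound \<open>R\<close> on
  the velocity enters.\<close>

lemma lipschitz_geodesic_field: "lipschitz_fun (BM \<times> cball 0 R) (geodesic_field g)"
proof -
  let ?K = "BM \<times> cball (0::real^'n) R"
  have b: "bounded ?K" by (simp add: bounded_Times)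
  have sub: "fst ` ?K \<subseteq> BM" by auto
  have "lipschitz_fun ?K (\<lambda>p. christoffel g (fst p) (snd p) (snd p))"
    unfolding christoffel_def
    by (rule lipschitz_fun_vec, simp, intro lipschitz_fun_sum lipschitz_fun_mult b
        lipschitz_fun_compose[OF lipschitz_christoffel_symbol lipschitz_fun_fst sub]
        lipschitz_fun_component[OF lipschitz_fun_snd])
  then show ?thesis unfolding geodesic_field_def
    by (intro lipschitz_fun_Pair lipschitz_fun_snd lipschitz_fun_minus)
qed

end


subsection \<open>Tangency to a strictly convex boundary\<close>

lemma differentiable_vec:
  fixes f :: "'a::real_normed_vector \<Rightarrow> real^'m"
  assumes "\<And>i. (\<lambda>x. f x $ i) differentiable (at x within S)"
  shows "f differentiable (at x within S)"
proof -
  have "(\<lambda>x. \<Sum>i\<in>UNIV. f x $ i *\<^sub>R (axis i 1 :: real^'m)) differentiable (at x within S)"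
    using assms by (intro differentiable_sum differentiable_scaleR) auto
  moreover have "(\<lambda>x. \<Sum>i\<in>UNIV. f x $ i *\<^sub>R (axis i 1 :: real^'m)) = f"
    by (rule ext) (simp only: basis_expansion flip: scalar_mult_eq_scaleR)
  ultimately show ?thesis by (simp only:)
qed

lemma differentiable_component:
  "f differentiable (at x within S) \<Longrightarrow> (\<lambda>x. f x $ i) differentiable (at x within S)"
  unfolding differentiable_def using bounded_linear.has_derivative[OF bounded_linear_vec_nth] by blast

context ball_metric
begin

definition normal_scale :: "real^'n \<Rightarrow> real" where
  "normal_scale x = inverse (metric_norm g x (matrix_inv (g x) *v x))"

lemma outer_normal_eq: "outer_normal g x = normal_scale x *\<^sub>R (matrix_inv (g x) *v x)"
  by (simp add: outer_normal_def normal_scale_def)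

text \<open>Lowering the index of the normal gives a multiple of the position vector. At nonzero
  points the factor is positive, so the metric product of a vector with the normal has the sign of
  its Euclidean product with \<open>x\<close>.\<close>

lemma metric_outer_normal:
  "x \<in> BM \<Longrightarrow> g x *v outer_normal g x = normal_scale x *\<^sub>R x"
  by (simp add: outer_normal_eq matrix_vector_mult_scaleR metric_inv)

lemma inverse_metric_pos:
  assumes "x \<in> BM" "x \<noteq> 0"
  shows "0 < (matrix_inv (g x) *v x) \<bullet> x"
proof -
  have "matrix_inv (g x) *v x \<noteq> 0" using metric_inv(1)[OF assms(1), of x] assms(2) by auto
  then have "0 < metric_inner g x (matrix_inv (g x) *v x) (matrix_inv (g x) *v x)"
    by (rule metric_pos[OF assms(1)])
  then show ?thesis by (simp only: metric_inner_def metric_inv(1)[OF assms(1)])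
qed

lemma normal_scale_eq:
  "x \<in> BM \<Longrightarrow> normal_scale x = inverse (sqrt ((matrix_inv (g x) *v x) \<bullet> x))"
  by (simp add: normal_scale_def metric_norm_def metric_inner_def metric_inv)

lemma normal_scale_pos: "x \<in> BM \<Longrightarrow> x \<noteq> 0 \<Longrightarrow> 0 < normal_scale x"
  using inverse_metric_pos by (simp add: normal_scale_eq)

text \<open>\<open>second_fundamental_form\<close> is stated through
  \<open>frechet_derivative\<close>, which has its intended meaning only where the normal is
  differentiable. Away from the origin the argument of the square root is positive.\<close>

lemma differentiable_normal:
  assumes x: "x \<in> BM" "x \<noteq> 0"
  shows "normal_scale differentiable (at x within BM)"
    and "outer_normal g differentiable (at x within BM)"
proof -
  let ?w = "\<lambda>x. matrix_inv (g x) *v x"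
  have w: "?w differentiable (at x within BM)"
  proof (rule differentiable_vec)
    fix i
    have "(\<lambda>x. \<Sum>j\<in>UNIV. matrix_inv (g x) $ i $ j * x $ j) differentiable (at x within BM)"
      by (intro differentiable_sum differentiable_mult differentiable_matrix_inv[OF x(1)]
          differentiable_component differentiable_ident ballI) auto
    then show "(\<lambda>x. ?w x $ i) differentiable (at x within BM)" by (simp add: matrix_vector_mult_def)
  qed
  then have "(\<lambda>x. ?w x \<bullet> x) differentiable (at x within BM)" by (intro differentiable_inner) auto
  then obtain D where "((\<lambda>x. ?w x \<bullet> x) has_derivative D) (at x within BM)"
    unfolding differentiable_def by blast
  from has_derivative_real_sqrt[OF inverse_metric_pos[OF x] this]
  have "(\<lambda>x. sqrt (?w x \<bullet> x)) differentiable (at x within BM)"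
    unfolding differentiable_def by blast
  then have "(\<lambda>x. inverse (sqrt (?w x \<bullet> x))) differentiable (at x within BM)"
    using inverse_metric_pos[OF x] by (intro differentiable_inverse) auto
  then obtain E where E: "((\<lambda>x. inverse (sqrt (?w x \<bullet> x))) has_derivative E) (at x within BM)"
    unfolding differentiable_def by blast
  have "(normal_scale has_derivative E) (at x within BM)"
    by (rule has_derivative_transform[OF x(1) normal_scale_eq E])
  then show s: "normal_scale differentiable (at x within BM)" unfolding differentiable_def by blast
  have "(\<lambda>x. normal_scale x *\<^sub>R ?w x) differentiable (at x within BM)"
    by (rule differentiable_scaleR[OF s w])
  then show "outer_normal g differentiable (at x within BM)"
    by (simp add: outer_normal_eq[abs_def])
qed

end

locale simple_ball = ball_metric g for g :: "real^'n \<Rightarrow> real^'n^'n" +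
  assumes convex_boundary: "strictly_convex_boundary g" and nontrapping: "nontrapping g"
begin

text \<open>Along a geodesic, \<open>\<lambda>\<tau>. \<nu> (x \<tau>) \<bullet> (g (x \<tau>) *v v)\<close> equals the normal scale times \<open>v \<bullet> x \<tau>\<close>.
  Differentiating this identity expresses the second derivative of \<open>|x|\<^sup>2 / 2\<close> by the second
  fundamental form.\<close>

lemma tangent_second_derivative_pos:
  assumes c: "geodesic_on g {a..b} c" and ab: "a < b" and t: "t \<in> {a..b}"
    and x: "fst (c t) \<in> sphere 0 1" and tangent: "fst (c t) \<bullet> snd (c t) = 0" and v: "snd (c t) \<noteq> 0"
  shows "0 < snd (c t) \<bullet> snd (c t) - fst (c t) \<bullet> christoffel g (fst (c t)) (snd (c t)) (snd (c t))"
proof -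
  define x where "x = fst (c t)"
  define v where "v = snd (c t)"
  define n where "n = outer_normal g x"
  define n' where "n' = frechet_derivative (outer_normal g) (at x within BM) v"
  define \<alpha> where "\<alpha> = normal_scale x"
  define G where "G = christoffel g x v v"
  have xB: "x \<in> BM" and x0: "x \<noteq> 0" and xS: "x \<in> sphere 0 1" using x by (auto simp: x_def)
  have v0: "v \<noteq> 0" using v by (simp add: v_def)
  have xv: "x \<bullet> v = 0" using tangent by (simp add: x_def v_def)
  note d = geodesic_derivatives[OF c t, folded x_def v_def]
  have sub: "(\<lambda>t. fst (c t)) ` {a..b} \<subseteq> BM" using c unfolding geodesic_on_def by blast
  have dn: "(outer_normal g has_derivative frechet_derivative (outer_normal g) (at x within BM)) (at x within BM)"
    using differentiable_normal(2)[OF xB x0] by (simp add: frechet_derivative_works)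
  have nd: "((\<lambda>s. outer_normal g (fst (c s))) has_vector_derivative n') (at t within {a..b})"
    using vector_derivative_diff_chain_within[OF d(1) has_derivative_subset[OF dn sub, unfolded x_def]]
    by (simp add: o_def n'_def x_def)
  obtain D where "(normal_scale has_derivative D) (at x within BM)"
    using differentiable_normal(1)[OF xB x0] unfolding differentiable_def by blast
  then have sd: "((\<lambda>s. normal_scale (fst (c s))) has_vector_derivative D v) (at t within {a..b})"
    using vector_derivative_diff_chain_within[OF d(1) has_derivative_subset[OF _ sub, unfolded x_def], of normal_scale D]
    by (simp add: o_def x_def)
  \<comment> \<open>Freezing \<open>v\<close> at its value at time \<open>t\<close> keeps the
    acceleration out of both derivatives.\<close>
  let ?s = "\<lambda>s. outer_normal g (fst (c s)) \<bullet> (g (fst (c s)) *v v)"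
  have 1: "(?s has_vector_derivative n \<bullet> (g x *v 0 + Dg x v *v v) + n' \<bullet> (g x *v v)) (at t within {a..b})"
    using bounded_bilinear.has_vector_derivative[OF bounded_bilinear_inner nd
        bounded_bilinear.has_vector_derivative[OF bounded_bilinear_matrix_vector d(3) has_vector_derivative_const]]
    by (simp add: n_def x_def)
  have eq: "?s s = normal_scale (fst (c s)) * (fst (c s) \<bullet> v)" if "s \<in> {a..b}" for s
  proof -
    have y: "fst (c s) \<in> BM" using sub that by blast
    show ?thesis using metric_sym[OF y] metric_outer_normal[OF y] by (simp add: inner_commute)
  qed
  have "((\<lambda>s. normal_scale (fst (c s)) * (fst (c s) \<bullet> v)) has_vector_derivative
      \<alpha> * (x \<bullet> 0 + v \<bullet> v) + D v * (x \<bullet> v)) (at t within {a..b})"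
    using bounded_bilinear.has_vector_derivative[OF bounded_bilinear_mult sd
        bounded_bilinear.has_vector_derivative[OF bounded_bilinear_inner d(1) has_vector_derivative_const]]
    by (simp add: \<alpha>_def x_def)
  then have 2: "(?s has_vector_derivative \<alpha> * (x \<bullet> 0 + v \<bullet> v) + D v * (x \<bullet> v)) (at t within {a..b})"
    by (rule has_vector_derivative_transform[where g = ?s, OF t, rotated]) (rule eq)
  have key: "n \<bullet> (Dg x v *v v) + n' \<bullet> (g x *v v) = \<alpha> * (v \<bullet> v)"
    using vector_derivative_unique_within_closed_interval[OF ab, of t] t 1 2 xv by auto
  have gn: "g x *v n = \<alpha> *\<^sub>R x" using metric_outer_normal[OF xB] by (simp add: n_def \<alpha>_def)
  have "v \<bullet> (g x *v n) = 0" using gn xv by (simp add: inner_commute)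
  then have "0 < second_fundamental_form g x v v"
    using convex_boundary xS v0 by (auto simp: strictly_convex_boundary_def metric_inner_def n_def)
  also have "second_fundamental_form g x v v = n' \<bullet> (g x *v v) + v \<bullet> (g x *v christoffel g x v n)"
    using metric_sym[OF xB, of "christoffel g x v n" v]
    by (simp add: second_fundamental_form_def metric_inner_def n'_def n_def inner_add_left)
  \<comment> \<open>The two Koszul instances contain half the derivative of the metric along
    \<open>n\<close> with opposite signs. Their sum is thus
    \<open>n \<bullet> (Dg x v *v v)\<close>, the term that \<open>key\<close> evaluates.\<close>
  also have "\<dots> = \<alpha> * (v \<bullet> v) - n \<bullet> (g x *v G)"
    using key koszul[OF xB, of v v n] koszul[OF xB, of n v v] by (simp add: G_def)
  also have "n \<bullet> (g x *v G) = \<alpha> * (x \<bullet> G)"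
    using metric_sym[OF xB, of n G] gn by (simp add: inner_commute)
  finally have "0 < \<alpha> * (v \<bullet> v - x \<bullet> G)" by (simp add: algebra_simps)
  then show ?thesis
    using normal_scale_pos[OF xB x0] by (simp add: \<alpha>_def x_def v_def G_def zero_less_mult_iff)
qed

lemma geodesic_radial_derivatives:
  assumes c: "geodesic_on g J c" and t: "t \<in> J"
  shows "((\<lambda>t. fst (c t) \<bullet> fst (c t)) has_real_derivative 2 * (fst (c t) \<bullet> snd (c t))) (at t within J)"
    and "((\<lambda>t. fst (c t) \<bullet> snd (c t)) has_real_derivative
      snd (c t) \<bullet> snd (c t) - fst (c t) \<bullet> christoffel g (fst (c t)) (snd (c t)) (snd (c t))) (at t within J)"
proof -
  note d = geodesic_derivatives[OF c t]
  show "((\<lambda>t. fst (c t) \<bullet> fst (c t)) has_real_derivative 2 * (fst (c t) \<bullet> snd (c t))) (at t within J)"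
    using bounded_bilinear.has_vector_derivative[OF bounded_bilinear_inner d(1) d(1)]
    by (simp add: has_real_derivative_iff_has_vector_derivative inner_commute)
  show "((\<lambda>t. fst (c t) \<bullet> snd (c t)) has_real_derivative
      snd (c t) \<bullet> snd (c t) - fst (c t) \<bullet> christoffel g (fst (c t)) (snd (c t)) (snd (c t))) (at t within J)"
    using bounded_bilinear.has_vector_derivative[OF bounded_bilinear_inner d(1) d(2)]
    by (simp add: has_real_derivative_iff_has_vector_derivative)
qed

text \<open>At a tangential boundary point the first derivative of \<open>|x|^2\<close> vanishes and
  the second is positive, so the radius exceeds 1 right next to \<open>t\<close> and the curve has
  left the ball. As \<open>t\<close> may be an endpoint, only one side is used: the right one if
  there is room, otherwise the left one.\<close>

lemma geodesic_not_tangent: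
  assumes c: "geodesic_on g {a..b} c" and ab: "a < b" and t: "t \<in> {a..b}"
    and x: "fst (c t) \<in> sphere 0 1" and v: "snd (c t) \<noteq> 0"
  shows "fst (c t) \<bullet> snd (c t) \<noteq> 0"
proof
  assume tangent: "fst (c t) \<bullet> snd (c t) = 0"
  let ?r = "\<lambda>t. fst (c t) \<bullet> fst (c t)" and ?k = "\<lambda>t. fst (c t) \<bullet> snd (c t)"
  have r1: "?r t = 1" using x by (simp add: dot_square_norm)
  have rle: "?r s \<le> 1" if "s \<in> {a..b}" for s
    using c that by (auto simp: geodesic_on_def dot_square_norm power_le_one)
  have der: "(?r has_real_derivative 2 * ?k s) (at s within {a..b})" if "s \<in> {a..b}" for s
    using geodesic_radial_derivatives(1)[OF c that] .
  have cont: "continuous_on {a..b} ?r"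
    using der DERIV_continuous continuous_on_eq_continuous_within by blast
  note second = geodesic_radial_derivatives(2)[OF c t] tangent_second_derivative_pos[OF c ab t x tangent v]
  show False
  proof (cases "t < b")
    case True
    obtain e where e: "0 < e" "\<And>h. 0 < h \<Longrightarrow> t + h \<in> {a..b} \<Longrightarrow> h < e \<Longrightarrow> 0 < ?k (t + h)"
      using has_real_derivative_pos_inc_right[OF second] tangent by auto
    define u where "u = min b (t + e / 2)"
    have u: "t < u" "u \<le> b" "u < t + e" using True e by (auto simp: u_def)
    have "?r t < ?r u"
    proof (rule DERIV_pos_imp_increasing_open[OF u(1)])
      fix s assume s: "t < s" "s < u"
      have "(?r has_real_derivative 2 * ?k s) (at s)"
        using der[of s] at_within_Icc_at[of a s b] s t u by auto
      moreover have "0 < ?k s" using e(2)[of "s - t"] s t u by auto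
      ultimately show "\<exists>y. (?r has_real_derivative y) (at s) \<and> 0 < y" by (intro exI[of _ "2 * ?k s"]) auto
    qed (rule continuous_on_subset[OF cont], use t u in auto)
    then show False using rle[of u] r1 t u by auto
  next
    case False
    then have "a < t" using t ab by auto
    obtain e where e: "0 < e" "\<And>h. 0 < h \<Longrightarrow> t - h \<in> {a..b} \<Longrightarrow> h < e \<Longrightarrow> ?k (t - h) < 0"
      using has_real_derivative_pos_inc_left[OF second] tangent by auto
    define u where "u = max a (t - e / 2)"
    have u: "u < t" "a \<le> u" "t - e < u" using \<open>a < t\<close> e by (auto simp: u_def)
    have "?r t < ?r u"
    proof (rule DERIV_neg_imp_decreasing_open[OF u(1)])
      fix s assume s: "u < s" "s < t"
      have "(?r has_real_derivative 2 * ?k s) (at s)"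
        using der[of s] at_within_Icc_at[of a s b] s t u by auto
      moreover have "?k s < 0" using e(2)[of "t - s"] s t u by auto
      ultimately show "\<exists>y. (?r has_real_derivative y) (at s) \<and> y < 0" by (intro exI[of _ "2 * ?k s"]) auto
    qed (rule continuous_on_subset[OF cont], use t u in auto)
    then show False using rle[of u] r1 t u by auto
  qed
qed

text \<open>A positive radial velocity would carry the geodesic out of the ball just after
  \<open>t\<close>, and a vanishing one is excluded by strict convexity.\<close>

lemma geodesic_start_inward:
  assumes c: "geodesic_on g {a..b} c" and t: "a \<le> t" "t < b"
    and x: "fst (c t) \<in> sphere 0 1" and v: "snd (c t) \<noteq> 0"
  shows "fst (c t) \<bullet> snd (c t) < 0"
proof (rule ccontr)
  assume "\<not> fst (c t) \<bullet> snd (c t) < 0"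
  moreover have ab: "a < b" and ti: "t \<in> {a..b}" using t by auto
  ultimately have pos: "0 < 2 * (fst (c t) \<bullet> snd (c t))"
    using geodesic_not_tangent[OF c ab ti x v] by linarith
  obtain e where e: "0 < e" "\<And>h. 0 < h \<Longrightarrow> t + h \<in> {a..b} \<Longrightarrow> h < e \<Longrightarrow>
      fst (c t) \<bullet> fst (c t) < fst (c (t + h)) \<bullet> fst (c (t + h))"
    using has_real_derivative_pos_inc_right[OF geodesic_radial_derivatives(1)[OF c ti] pos] by auto
  define h where "h = min (b - t) (e / 2)"
  have h: "0 < h" "t + h \<in> {a..b}" "h < e" using t e by (auto simp: h_def)
  have "fst (c (t + h)) \<in> BM" using c h(2) unfolding geodesic_on_def by blast
  then have "fst (c (t + h)) \<bullet> fst (c (t + h)) \<le> 1" by (simp add: dot_square_norm power_le_one)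
  then show False using e(2)[OF h] x by (simp add: dot_square_norm)
qed

text \<open>Continuing after \<open>t\<close> forces the radial velocity to be negative; just before
  \<open>t\<close> the radius would then exceed 1.\<close>

lemma geodesic_no_interior_touch:
  assumes c: "geodesic_on g {a..b} c" and t: "a < t" "t < b" and v: "snd (c t) \<noteq> 0"
  shows "fst (c t) \<notin> sphere 0 1"
proof
  assume x: "fst (c t) \<in> sphere 0 1"
  have neg: "2 * (fst (c t) \<bullet> snd (c t)) < 0"
    using geodesic_start_inward[OF c _ t(2) x v] t by auto
  have ti: "t \<in> {a..b}" using t by auto
  obtain e where e: "0 < e" "\<And>h. 0 < h \<Longrightarrow> t - h \<in> {a..b} \<Longrightarrow> h < e \<Longrightarrow>
      fst (c t) \<bullet> fst (c t) < fst (c (t - h)) \<bullet> fst (c (t - h))"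
    using has_real_derivative_neg_dec_left[OF geodesic_radial_derivatives(1)[OF c ti] neg] by auto
  define h where "h = min (t - a) (e / 2)"
  have h: "0 < h" "t - h \<in> {a..b}" "h < e" using t e by (auto simp: h_def)
  have "fst (c (t - h)) \<in> BM" using c h(2) unfolding geodesic_on_def by blast
  then have "fst (c (t - h)) \<bullet> fst (c (t - h)) \<le> 1" by (simp add: dot_square_norm power_le_one)
  then show False using e(2)[OF h] x by (simp add: dot_square_norm)
qed

end


subsection \<open>The extended geodesic flow\<close>

context ball_metric
begin

lemma metric_norm_pos: "x \<in> BM \<Longrightarrow> v \<noteq> 0 \<Longrightarrow> 0 < metric_norm g x v"
  using metric_pos by (simp add: metric_norm_def)

lemma continuous_on_metric_norm_bundle:
  "continuous_on (BM \<times> UNIV) (\<lambda>p. metric_norm g (fst p) (snd p))"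
  unfolding metric_norm_def metric_inner_def
  by (intro continuous_intros bounded_bilinear.continuous_on[OF bounded_bilinear_matrix_vector]
      continuous_on_compose2[OF continuous_g]) auto

text \<open>Compactness of the Euclidean sphere bundle over the ball makes the comparison of the two
  norms uniform in the base point.\<close>

lemma speed_bound_exists: "\<exists>R>0. \<forall>x\<in>BM. \<forall>v. norm v \<le> R * metric_norm g x v"
proof -
  let ?S = "BM \<times> sphere (0::real^'n) 1"
  have S: "compact ?S" by (intro compact_Times compact_cball compact_sphere)
  have ne: "?S \<noteq> {}" by simp
  have cont: "continuous_on ?S (\<lambda>p. metric_norm g (fst p) (snd p))"
    by (rule continuous_on_subset[OF continuous_on_metric_norm_bundle]) auto
  obtain q where q: "q \<in> ?S"
    "\<And>p. p \<in> ?S \<Longrightarrow> metric_norm g (fst q) (snd q) \<le> metric_norm g (fst p) (snd p)"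
    using continuous_attains_inf[OF S ne cont] by blast
  define m where "m = metric_norm g (fst q) (snd q)"
  have m: "0 < m" using q(1) unfolding m_def by (intro metric_norm_pos) auto
  have "norm v \<le> inverse m * metric_norm g x v" if x: "x \<in> BM" for x v
  proof (cases "v = 0")
    case False
    then have "m \<le> metric_norm g x (v /\<^sub>R norm v)" using q(2)[of "(x, v /\<^sub>R norm v)"] x by (simp add: m_def)
    also have "\<dots> = metric_norm g x v / norm v" by (subst metric_norm_scaleR) (simp add: divide_inverse mult.commute)
    finally have "norm v * m \<le> metric_norm g x v" using False by (simp add: pos_le_divide_eq mult.commute)
    then have "inverse m * (norm v * m) \<le> inverse m * metric_norm g x v" using m by (intro mult_left_mono) auto
    moreover have "inverse m * (norm v * m) = norm v" using m by simp
    ultimately show ?thesis by (simp only:)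
  qed (simp add: metric_norm_def metric_inner_def)
  then show ?thesis using m by (intro exI[of _ "inverse m"] conjI ballI allI) simp_all
qed

definition speed_bound :: real where
  "speed_bound = (SOME R. 0 < R \<and> (\<forall>x\<in>BM. \<forall>v. norm v \<le> R * metric_norm g x v))"

lemma speed_bound_pos: "0 < speed_bound"
  and norm_le_speed_bound: "x \<in> BM \<Longrightarrow> norm v \<le> speed_bound * metric_norm g x v"
  using someI_ex[OF speed_bound_exists] unfolding speed_bound_def by auto

text \<open>A product with a Euclidean ball rather than the bundle of metric unit balls, because the
  nearest point projection needs a convex set. The radius is large enough to contain all vectors of
  metric norm at most 1.\<close>

definition phase :: "((real^'n) \<times> (real^'n)) set" where
  "phase = BM \<times> cball 0 speed_bound"

lemma phase_props: "compact phase" "convex phase" "closed phase" "phase \<noteq> {}"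
  using speed_bound_pos unfolding phase_def
  by (auto simp: compact_Times convex_Times closed_Times intro: less_imp_le)

lemma phaseI: "x \<in> BM \<Longrightarrow> metric_norm g x v \<le> 1 \<Longrightarrow> (x, v) \<in> phase"
  using order_trans[OF norm_le_speed_bound mult_left_mono[of _ 1 speed_bound]] speed_bound_pos
  by (simp add: phase_def)

text \<open>The nearest point projection onto a closed convex set is 1-Lipschitz, so composing with it
  preserves the Lipschitz constant.\<close>

definition extended_field :: "(real^'n) \<times> (real^'n) \<Rightarrow> (real^'n) \<times> (real^'n)" where
  "extended_field p = geodesic_field g (closest_point phase p)"

lemma extended_field_eq: "p \<in> phase \<Longrightarrow> extended_field p = geodesic_field g p"
  by (simp add: extended_field_def closest_point_self)

lemma extended_field_exists: "\<exists>L B. bounded_lipschitz_field extended_field L B"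
proof -
  obtain L where L: "L-lipschitz_on phase (geodesic_field g)"
    using lipschitz_geodesic_field[of speed_bound] unfolding lipschitz_fun_def phase_def by blast
  have cp: "1-lipschitz_on UNIV (closest_point phase)"
    by (rule lipschitz_onI) (use closest_point_lipschitz[OF phase_props(2-4)] in auto)
  have range: "closest_point phase p \<in> phase" for p
    using closest_point_in_set[OF phase_props(3,4)] .
  have "(L * 1)-lipschitz_on UNIV extended_field"
    unfolding extended_field_def[abs_def]
    by (rule lipschitz_on_compose2[OF cp]) (rule lipschitz_on_subset[OF L], use range in auto)
  moreover obtain B where "\<And>p. p \<in> phase \<Longrightarrow> norm (geodesic_field g p) \<le> B"
    using lipschitz_fun_bounded[OF lipschitz_geodesic_field[of speed_bound]]
      compact_imp_bounded[OF phase_props(1)] unfolding phase_def bounded_iff by blast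
  ultimately show ?thesis
    using range unfolding bounded_lipschitz_field_def extended_field_def by blast
qed

text \<open>The constants are fixed by choice so that the flow lemmas become available once, inside
  the locale.\<close>

definition field_lipschitz :: real where
  "field_lipschitz = (SOME L. \<exists>B. bounded_lipschitz_field extended_field L B)"

definition field_bound :: real where
  "field_bound = (SOME B. bounded_lipschitz_field extended_field field_lipschitz B)"

sublocale field: bounded_lipschitz_field extended_field field_lipschitz field_bound
  using someI_ex[OF extended_field_exists] someI_ex[of "bounded_lipschitz_field extended_field field_lipschitz"]
  unfolding field_bound_def field_lipschitz_def by blast

text \<open>For unit vectors this expresses the existence of a geodesic up to time \<open>t\<close>.
  Phrased through the flow, it involves no choice of a curve and is a closed condition.\<close>

definition reach :: "(real^'n) \<times> (real^'n) \<Rightarrow> real \<Rightarrow> bool" where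
  "reach p t \<longleftrightarrow> (\<forall>s\<in>{0..t}. ode_flow extended_field p s \<in> phase)"

lemma reach_mono: "reach p t \<Longrightarrow> s \<le> t \<Longrightarrow> reach p s"
  by (auto simp: reach_def)

lemma geodesic_in_phase:
  assumes c: "geodesic_on g {0..T} c" and v: "metric_norm g (fst (c 0)) (snd (c 0)) \<le> 1" and t: "t \<in> {0..T}"
  shows "c t \<in> phase"
proof -
  have "metric_norm g (fst (c t)) (snd (c t)) = metric_norm g (fst (c 0)) (snd (c 0))"
    using t by (intro geodesic_metric_norm[OF c]) auto
  moreover have "fst (c t) \<in> BM" using c t by (auto simp: geodesic_on_def)
  ultimately show ?thesis using phaseI[of "fst (c t)" "snd (c t)"] v by simp
qed

lemma geodesic_eq_flow:
  assumes c: "geodesic_on g {0..T} c" and v: "metric_norm g (fst (c 0)) (snd (c 0)) \<le> 1" and t: "t \<in> {0..T}"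
  shows "c t = ode_flow extended_field (c 0) t"
proof -
  have "ode_solution extended_field {0..T} c"
    using c geodesic_in_phase[OF c v] unfolding geodesic_on_iff ode_solution_def
    by (auto simp: extended_field_eq)
  then show ?thesis by (rule field.flow_unique[symmetric]) (rule t)
qed

lemma geodesic_reach:
  assumes c: "geodesic_on g {0..T} c" and v: "metric_norm g (fst (c 0)) (snd (c 0)) \<le> 1"
  shows "reach (c 0) T"
  unfolding reach_def
proof
  fix s assume "s \<in> {0..T}"
  then show "ode_flow extended_field (c 0) s \<in> phase"
    using geodesic_in_phase[OF c v, of s] geodesic_eq_flow[OF c v, of s] by simp
qed

lemma reach_geodesic:
  assumes "reach p T"
  shows "geodesic_on g {0..T} (ode_flow extended_field p)"
  using assms field.flow_solution_Icc[of T p]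
  unfolding reach_def geodesic_on_iff ode_solution_def
  by (auto simp: extended_field_eq phase_def)

lemma reach_metric_norm:
  assumes "reach p T" "t \<in> {0..T}"
  shows "metric_norm g (fst (ode_flow extended_field p t)) (snd (ode_flow extended_field p t))
    = metric_norm g (fst p) (snd p)"
  using geodesic_metric_norm[OF reach_geodesic[OF assms(1)], of t 0] assms by auto

lemma sphere_bundle_norm: "p \<in> sphere_bundle g \<Longrightarrow> metric_norm g (fst p) (snd p) = 1 \<and> fst p \<in> BM"
  by (auto simp: sphere_bundle_def)

lemma reach_sphere_bundle:
  assumes "p \<in> sphere_bundle g" "reach p T" "t \<in> {0..T}"
  shows "ode_flow extended_field p t \<in> sphere_bundle g"
proof -
  have "fst (ode_flow extended_field p t) \<in> BM"
    using assms(2,3) by (auto simp: reach_def phase_def mem_Times_iff)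
  then show ?thesis
    using reach_metric_norm[OF assms(2,3)] sphere_bundle_norm[OF assms(1)]
    by (simp add: sphere_bundle_def case_prod_beta)
qed

lemma reach_0: "p \<in> sphere_bundle g \<Longrightarrow> reach p 0"
  using phaseI[of "fst p" "snd p"] sphere_bundle_norm[of p] by (simp add: reach_def)

lemma geodesic_exists_iff_reach:
  assumes "p \<in> sphere_bundle g"
  shows "(\<exists>c. geodesic_on g {0..T} c \<and> c 0 = p) \<longleftrightarrow> reach p T"
proof
  assume "\<exists>c. geodesic_on g {0..T} c \<and> c 0 = p"
  then show "reach p T" using geodesic_reach sphere_bundle_norm[OF assms] by auto
next
  assume "reach p T"
  then show "\<exists>c. geodesic_on g {0..T} c \<and> c 0 = p"
    using reach_geodesic field.flow_0 by blast
qed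

lemma exit_time_eq_Sup_reach:
  "p \<in> sphere_bundle g \<Longrightarrow> exit_time g p = Sup {T. 0 \<le> T \<and> reach p T}"
  unfolding exit_time_def by (simp add: geodesic_exists_iff_reach)

text \<open>Uniqueness of geodesics gives the definite description in \<open>geodesic_flow\<close>
  its value.\<close>

lemma geodesic_flow_eq:
  assumes p: "p \<in> sphere_bundle g" and t: "0 \<le> t" "reach p t"
  shows "geodesic_flow g t p = ode_flow extended_field p t"
  unfolding geodesic_flow_def
proof (rule the_equality)
  have seg: "closed_segment 0 t = {0..t}" using t by (simp add: closed_segment_eq_real_ivl)
  show "\<exists>c. geodesic_on g (closed_segment 0 t) c \<and> c 0 = p \<and> c t = ode_flow extended_field p t"
    using reach_geodesic[OF t(2)] field.flow_0 seg by auto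
  show "q = ode_flow extended_field p t"
    if "\<exists>c. geodesic_on g (closed_segment 0 t) c \<and> c 0 = p \<and> c t = q" for q
    using that geodesic_eq_flow[of t] sphere_bundle_norm[OF p] t seg by fastforce
qed

definition reverse :: "(real^'n) \<times> (real^'n) \<Rightarrow> (real^'n) \<times> (real^'n)" where
  "reverse p = (fst p, - snd p)"

lemma reverse_simps [simp]: "reverse (x, v) = (x, - v)" "fst (reverse p) = fst p" "snd (reverse p) = - snd p"
  "reverse (reverse p) = p"
  by (simp_all add: reverse_def)

lemma reverse_sphere_bundle [simp]: "reverse p \<in> sphere_bundle g \<longleftrightarrow> p \<in> sphere_bundle g"
  by (simp add: sphere_bundle_def case_prod_beta)

text \<open>The Christoffel term is homogeneous of degree two in the velocity, as is the
  acceleration under a linear change of time. The value \<open>b = -1\<close> reverses a geodesic,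
  and a positive \<open>b\<close> changes its speed.\<close>

lemma geodesic_compose_affine:
  assumes c: "geodesic_on g J c" and I: "(\<lambda>t. a + b * t) ` I \<subseteq> J"
  shows "geodesic_on g I (\<lambda>t. (fst (c (a + b * t)), b *\<^sub>R snd (c (a + b * t))))"
  unfolding geodesic_on_def
proof (intro ballI conjI)
  fix t assume t: "t \<in> I"
  let ?s = "a + b * t"
  have s: "?s \<in> J" using I t by auto
  show "fst (fst (c ?s), b *\<^sub>R snd (c ?s)) \<in> BM" using c s by (simp add: geodesic_on_def)
  have l: "((\<lambda>t. a + b * t) has_vector_derivative b) (at t within I)"
    by (auto intro!: derivative_eq_intros simp flip: has_real_derivative_iff_has_vector_derivative)
  note d = geodesic_derivatives(1,2)[OF c s, THEN has_vector_derivative_within_subset, OF I]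
  note e = d[THEN vector_diff_chain_within[OF l]]
  have "((\<lambda>t. (fst (c (a + b * t)), b *\<^sub>R snd (c (a + b * t)))) has_vector_derivative
      (b *\<^sub>R snd (c ?s), b *\<^sub>R b *\<^sub>R - christoffel g (fst (c ?s)) (snd (c ?s)) (snd (c ?s)))) (at t within I)"
    using has_vector_derivative_Pair[OF e(1) bounded_linear.has_vector_derivative[OF bounded_linear_scaleR_right e(2)]]
    by (simp add: o_def)
  moreover have "christoffel g (fst (c ?s)) (b *\<^sub>R snd (c ?s)) (b *\<^sub>R snd (c ?s))
      = b *\<^sub>R b *\<^sub>R christoffel g (fst (c ?s)) (snd (c ?s)) (snd (c ?s))"
    by (simp add: christoffel_def vec_eq_iff sum_distrib_left mult_ac)
  ultimately show "((\<lambda>t. (fst (c (a + b * t)), b *\<^sub>R snd (c (a + b * t)))) has_vector_derivative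
      (snd (fst (c ?s), b *\<^sub>R snd (c ?s)), - christoffel g (fst (fst (c ?s), b *\<^sub>R snd (c ?s)))
        (snd (fst (c ?s), b *\<^sub>R snd (c ?s))) (snd (fst (c ?s), b *\<^sub>R snd (c ?s))))) (at t within I)"
    by simp
qed

end


subsection \<open>Exit times and entry points\<close>

context ball_metric
begin

lemma closed_sphere_bundle: "closed (sphere_bundle g)"
proof -
  have "closed ((BM \<times> UNIV) \<inter> (\<lambda>p. metric_norm g (fst p) (snd p)) -` {1})"
    by (intro continuous_closed_preimage continuous_on_metric_norm_bundle closed_Times) auto
  also have "(BM \<times> UNIV) \<inter> (\<lambda>p. metric_norm g (fst p) (snd p)) -` {1} = sphere_bundle g"
    by (auto simp: sphere_bundle_def)
  finally show ?thesis .
qed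

lemma compact_sphere_bundle: "compact (sphere_bundle g)"
proof -
  have "sphere_bundle g \<subseteq> phase" by (auto simp: sphere_bundle_def intro: phaseI)
  then have "sphere_bundle g = phase \<inter> sphere_bundle g" by blast
  then show ?thesis using compact_Int_closed[OF phase_props(1) closed_sphere_bundle] by simp
qed

text \<open>Scaling the time by \<open>r \<in> {0..1}\<close> turns the quantifier over \<open>{0..t}\<close> into an intersection of
  closed sets.\<close>

lemma closed_reach: "closed {(p, t). 0 \<le> t \<and> reach p t}"
proof -
  let ?F = "\<lambda>r (p, t). ode_flow extended_field p (max 0 (r * t))"
  have "closed (?F r -` phase)" for r
  proof (rule closed_vimage[OF phase_props(3)])
    have "continuous_on UNIV ((\<lambda>(p, t). ode_flow extended_field p (max 0 t)) \<circ> (\<lambda>z. (fst z, r * snd z)))"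
      by (intro continuous_on_compose continuous_intros continuous_on_subset[OF field.continuous_on_flow]) auto
    then show "continuous_on UNIV (?F r)" by (simp add: o_def case_prod_beta)
  qed
  then have "closed ((UNIV \<times> {0..}) \<inter> (\<Inter>r\<in>{0..1}. ?F r -` phase))"
    by (intro closed_Int closed_INT closed_Times) auto
  also have "(UNIV \<times> {0..}) \<inter> (\<Inter>r\<in>{0..1}. ?F r -` phase) = {(p, t). 0 \<le> t \<and> reach p t}"
  proof (intro equalityI subsetI)
    fix z assume z: "z \<in> (UNIV \<times> {0..}) \<inter> (\<Inter>r\<in>{0..1}. ?F r -` phase)"
    obtain p t where pt: "z = (p, t)" by (cases z)
    have t: "0 \<le> t" using z pt by auto
    have "ode_flow extended_field p s \<in> phase" if s: "s \<in> {0..t}" for s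
    proof -
      have F: "ode_flow extended_field p (max 0 (r * t)) \<in> phase" if "r \<in> {0..1}" for r
        using z pt that by auto
      show ?thesis
      proof (cases "t = 0")
        case True
        then show ?thesis using F[of 0] s by simp
      next
        case False
        then have "s / t \<in> {0..1}" using s t by auto
        then show ?thesis using F[of "s / t"] False s by simp
      qed
    qed
    then show "z \<in> {(p, t). 0 \<le> t \<and> reach p t}" using t pt by (simp add: reach_def)
  next
    fix z assume "z \<in> {(p, t). 0 \<le> t \<and> reach p t}"
    then obtain p t where pt: "z = (p, t)" "0 \<le> t" "reach p t" by auto
    have "r * t \<in> {0..t}" if "r \<in> {0..1}" for r
      using that pt mult_right_mono[of r 1 t] by auto
    then have "ode_flow extended_field p (max 0 (r * t)) \<in> phase" if "r \<in> {0..1}" for r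
      using that pt(3) unfolding reach_def by (simp add: max_def)
    then show "z \<in> (UNIV \<times> {0..}) \<inter> (\<Inter>r\<in>{0..1}. ?F r -` phase)" using pt by auto
  qed
  finally show ?thesis .
qed

end

context simple_ball
begin

lemma sphere_bundle_nonzero: "p \<in> sphere_bundle g \<Longrightarrow> snd p \<noteq> 0"
  using sphere_bundle_norm[of p] by (auto simp: metric_norm_def metric_inner_def)

lemma flow_not_sphere:
  assumes p: "p \<in> sphere_bundle g" and T: "reach p T" and t: "0 < t" "t < T"
  shows "fst (ode_flow extended_field p t) \<notin> sphere 0 1"
  using geodesic_no_interior_touch[OF reach_geodesic[OF T] t]
    sphere_bundle_nonzero[OF reach_sphere_bundle[OF p T, of t]] t by auto

lemma hits_sphere:
  assumes "p \<in> sphere_bundle g"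
  obtains T where "0 \<le> T" "reach p T" "fst (ode_flow extended_field p T) \<in> sphere 0 1"
proof -
  obtain T c where T: "0 \<le> T" and c: "geodesic_on g {0..T} c" "c 0 = p" "fst (c T) \<in> sphere 0 1"
    using nontrapping assms unfolding nontrapping_def by blast
  have v: "metric_norm g (fst (c 0)) (snd (c 0)) \<le> 1" using sphere_bundle_norm[OF assms] c(2) by simp
  have "c T = ode_flow extended_field p T" using geodesic_eq_flow[OF c(1) v, of T] c(2) T by simp
  moreover have "reach p T" using geodesic_reach[OF c(1) v] c(2) by simp
  ultimately show ?thesis using that[of T] T c(3) by simp
qed

text \<open>For \<open>p\<close> on the boundary, the hitting time from nontrapping may be 0.
  Restarting from the orbit at time 1 gives a hit at \<open>1 + T\<close>, strictly inside
  \<open>{0..2 + T}\<close>, where strict convexity forbids it.\<close>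

lemma flow_leaves:
  assumes p: "p \<in> sphere_bundle g"
  obtains T where "0 \<le> T" "\<not> reach p T"
proof -
  have False if all: "\<And>T. 0 \<le> T \<Longrightarrow> reach p T"
  proof -
    let ?q = "ode_flow extended_field p 1"
    have q: "?q \<in> sphere_bundle g" by (rule reach_sphere_bundle[OF p all[of 1]]) auto
    obtain T where T: "0 \<le> T" "fst (ode_flow extended_field ?q T) \<in> sphere 0 1"
      using hits_sphere[OF q] by blast
    have "ode_flow extended_field ?q T = ode_flow extended_field p (1 + T)"
      using field.flow_add[of 1 T p] T by simp
    then show False using flow_not_sphere[OF p all[of "2 + T"], of "1 + T"] T by simp
  qed
  then show ?thesis using that by blast
qed

text \<open>The unit vectors that survive up to time \<open>n\<close> form decreasing compact sets
  with empty intersection, so one of these sets is empty.\<close>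

lemma exit_bound_exists: "\<exists>T\<ge>0. \<forall>p\<in>sphere_bundle g. \<not> reach p T"
proof -
  let ?A = "\<lambda>n::nat. {p \<in> sphere_bundle g. reach p (real n)}"
  have "compact (?A n)" for n
  proof -
    have "closed ((\<lambda>p. (p, real n)) -` {(p, t). 0 \<le> t \<and> reach p t})"
      by (intro closed_vimage closed_reach continuous_intros)
    moreover have "?A n = sphere_bundle g \<inter> (\<lambda>p. (p, real n)) -` {(p, t). 0 \<le> t \<and> reach p t}" by auto
    ultimately show ?thesis using compact_Int_closed[OF compact_sphere_bundle] by simp
  qed
  moreover have "?A n \<subseteq> ?A m" if "m \<le> n" for m n using that reach_mono by auto
  moreover have "\<Inter> (range ?A) = {}"
  proof (intro equals0I)
    fix p assume p: "p \<in> \<Inter> (range ?A)"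
    then have "p \<in> sphere_bundle g" by auto
    then obtain T where T: "0 \<le> T" "\<not> reach p T" using flow_leaves by blast
    obtain n where "T \<le> real n" using real_arch_simple by blast
    moreover have "reach p (real n)" using p by auto
    ultimately show False using T reach_mono by blast
  qed
  ultimately obtain n where n: "?A n = {}" using compact_nest[of ?A] by blast
  then show ?thesis by (intro exI[of _ "real n"]) auto
qed

definition exit_bound :: real where
  "exit_bound = (SOME T. 0 \<le> T \<and> (\<forall>p\<in>sphere_bundle g. \<not> reach p T))"

lemma exit_bound_nonneg: "0 \<le> exit_bound"
  and not_reach_exit_bound: "p \<in> sphere_bundle g \<Longrightarrow> \<not> reach p exit_bound"
  using someI_ex[OF exit_bound_exists] unfolding exit_bound_def by auto

text \<open>The set of reachable times is closed and bounded, so its supremum is attained;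
  \<open>reach_mono\<close> fills in all smaller times.\<close>

lemma reach_iff_exit_time:
  assumes p: "p \<in> sphere_bundle g" and t: "0 \<le> t"
  shows "reach p t \<longleftrightarrow> t \<le> exit_time g p"
proof -
  let ?S = "{T. 0 \<le> T \<and> reach p T}"
  have "closed (Pair p -` {(p, t). 0 \<le> t \<and> reach p t})"
    by (intro closed_vimage closed_reach continuous_intros)
  then have "closed ?S" by (simp add: vimage_def)
  moreover have "?S \<noteq> {}" using reach_0[OF p] by auto
  moreover have bdd: "bdd_above ?S"
  proof (rule bdd_aboveI)
    fix T assume "T \<in> ?S"
    then show "T \<le> exit_bound" using not_reach_exit_bound[OF p] reach_mono[of p T exit_bound] by force
  qed
  ultimately have "Sup ?S \<in> ?S" by (intro closed_contains_Sup)
  then have "reach p (exit_time g p)" by (simp add: exit_time_eq_Sup_reach[OF p])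
  moreover have "t \<le> exit_time g p" if "reach p t"
    unfolding exit_time_eq_Sup_reach[OF p] using t that by (intro cSup_upper bdd) auto
  ultimately show ?thesis using reach_mono by blast
qed

lemma exit_time_nonneg: "p \<in> sphere_bundle g \<Longrightarrow> 0 \<le> exit_time g p"
  using reach_iff_exit_time[of p 0] reach_0 by simp

lemma reach_exit_time: "p \<in> sphere_bundle g \<Longrightarrow> reach p (exit_time g p)"
  using reach_iff_exit_time exit_time_nonneg by simp

lemma exit_time_le_bound: "p \<in> sphere_bundle g \<Longrightarrow> exit_time g p \<le> exit_bound"
  using not_reach_exit_bound[of p] reach_iff_exit_time[of p exit_bound] exit_bound_nonneg by simp

text \<open>For an interior start the boundary time provided by nontrapping is positive. A geodesic
  cannot continue past it, so it is the exit time.\<close>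

lemma exit_point_sphere:
  assumes p: "p \<in> sphere_bundle g" and int: "norm (fst p) < 1"
  shows "0 < exit_time g p" "fst (ode_flow extended_field p (exit_time g p)) \<in> sphere 0 1"
proof -
  obtain T where T: "0 \<le> T" "reach p T" "fst (ode_flow extended_field p T) \<in> sphere 0 1"
    using hits_sphere[OF p] .
  have "T \<noteq> 0" using T(3) int by (intro notI) auto
  then have T0: "0 < T" using T(1) by simp
  have le: "T \<le> exit_time g p" using reach_iff_exit_time[OF p T(1)] T(2) by simp
  have "\<not> T < exit_time g p" using flow_not_sphere[OF p reach_exit_time[OF p] T0] T(3) by blast
  then have "T = exit_time g p" using le by simp
  then show "0 < exit_time g p" "fst (ode_flow extended_field p (exit_time g p)) \<in> sphere 0 1"
    using T T0 by auto
qed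

text \<open>The forward-only substitute for the flow at time
  \<open>- exit_time g (reverse p)\<close>, at which \<open>backprojection\<close> evaluates the
  X-ray transform.\<close>

definition entry_point :: "(real^'n) \<times> (real^'n) \<Rightarrow> (real^'n) \<times> (real^'n)" where
  "entry_point p = reverse (ode_flow extended_field (reverse p) (exit_time g (reverse p)))"

text \<open>Reversal turns geodesics on the interval before 0 into forward geodesics, for which
  uniqueness is known.\<close>

lemma geodesic_flow_entry_point:
  assumes p: "p \<in> sphere_bundle g"
  shows "geodesic_flow g (- exit_time g (reverse p)) p = entry_point p"
  unfolding geodesic_flow_def
proof (rule the_equality)
  let ?T = "exit_time g (reverse p)"
  have p': "reverse p \<in> sphere_bundle g" using p by simp
  have T: "0 \<le> ?T" using exit_time_nonneg[OF p'] .
  have seg: "closed_segment 0 (- ?T) = {- ?T..0}" using T by (simp add: closed_segment_eq_real_ivl)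
  have flip: "(fst z, (-1) *\<^sub>R snd z) = reverse z" for z :: "(real^'n) \<times> (real^'n)" by (simp add: reverse_def)
  have "geodesic_on g {- ?T..0} (\<lambda>t. reverse (ode_flow extended_field (reverse p) (0 + (-1) * t)))"
    using geodesic_compose_affine[OF reach_geodesic[OF reach_exit_time[OF p']], of 0 "-1" "{- ?T..0}"]
    unfolding flip by auto
  then show "\<exists>c. geodesic_on g (closed_segment 0 (- ?T)) c \<and> c 0 = p \<and> c (- ?T) = entry_point p"
    unfolding seg
    by (intro exI[of _ "\<lambda>t. reverse (ode_flow extended_field (reverse p) (0 + (-1) * t))"])
      (simp add: entry_point_def)
  fix q assume "\<exists>c. geodesic_on g (closed_segment 0 (- ?T)) c \<and> c 0 = p \<and> c (- ?T) = q"
  then obtain c where c: "geodesic_on g {- ?T..0} c" "c 0 = p" "c (- ?T) = q" unfolding seg by blast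
  have d: "geodesic_on g {0..?T} (\<lambda>t. reverse (c (0 + (-1) * t)))"
    using geodesic_compose_affine[OF c(1), of 0 "-1" "{0..?T}"] unfolding flip by auto
  have "reverse (c (0 + (-1) * ?T)) = ode_flow extended_field (reverse (c (0 + (-1) * 0))) ?T"
    using T sphere_bundle_norm[OF p] c(2) by (intro geodesic_eq_flow[OF d]) auto
  then have "reverse q = ode_flow extended_field (reverse p) ?T" using c by simp
  then show "q = entry_point p" unfolding entry_point_def by (metis reverse_simps(4))
qed

text \<open>The backward ray, traversed from its end, is a geodesic from the entry point to
  \<open>p\<close>; from there on the flow property takes over.\<close>

lemma flow_entry_point:
  assumes p: "p \<in> sphere_bundle g"
  shows "t \<in> {0..exit_time g (reverse p)} \<Longrightarrow> ode_flow extended_field (entry_point p) t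
      = reverse (ode_flow extended_field (reverse p) (exit_time g (reverse p) - t))"
    and "0 \<le> s \<Longrightarrow> ode_flow extended_field (entry_point p) (exit_time g (reverse p) + s)
      = ode_flow extended_field p s"
    and "entry_point p \<in> sphere_bundle g"
proof -
  let ?T = "exit_time g (reverse p)"
  have p': "reverse p \<in> sphere_bundle g" using p by simp
  have T: "0 \<le> ?T" using exit_time_nonneg[OF p'] .
  show q: "entry_point p \<in> sphere_bundle g"
    unfolding entry_point_def using reach_sphere_bundle[OF p' reach_exit_time[OF p'], of ?T] T by simp
  have flip: "(fst z, (-1) *\<^sub>R snd z) = reverse z" for z :: "(real^'n) \<times> (real^'n)" by (simp add: reverse_def)
  have d: "geodesic_on g {0..?T} (\<lambda>t. reverse (ode_flow extended_field (reverse p) (?T + (-1) * t)))"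
    using geodesic_compose_affine[OF reach_geodesic[OF reach_exit_time[OF p']], of ?T "-1" "{0..?T}"]
    unfolding flip by auto
  have eq: "ode_flow extended_field (entry_point p) t
      = reverse (ode_flow extended_field (reverse p) (?T - t))" if "t \<in> {0..?T}" for t
    using geodesic_eq_flow[OF d _ that] sphere_bundle_norm[OF q] by (simp add: entry_point_def)
  then show "t \<in> {0..?T} \<Longrightarrow> ode_flow extended_field (entry_point p) t
      = reverse (ode_flow extended_field (reverse p) (?T - t))" .
  have "ode_flow extended_field (entry_point p) ?T = p" using eq[of ?T] T by simp
  then show "0 \<le> s \<Longrightarrow> ode_flow extended_field (entry_point p) (?T + s) = ode_flow extended_field p s"
    using field.flow_add[OF T, of s "entry_point p"] by simp
qed

text \<open>The concatenated rays show that the exit time is at least the sum. At that time the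
  geodesic is on the sphere, which it cannot touch at an intermediate time, and this gives the other
  inequality.\<close>

lemma exit_time_entry_point:
  assumes p: "p \<in> sphere_bundle g" and int: "norm (fst p) < 1"
  shows "exit_time g (entry_point p) = exit_time g (reverse p) + exit_time g p"
proof -
  let ?T = "exit_time g (reverse p)" and ?S = "exit_time g p"
  have p': "reverse p \<in> sphere_bundle g" using p by simp
  have T: "0 < ?T" using exit_point_sphere(1)[OF p'] int by simp
  have S: "0 < ?S" using exit_point_sphere(1)[OF p int] .
  note q = flow_entry_point[OF p]
  have rev_phase: "reverse z \<in> phase \<longleftrightarrow> z \<in> phase" for z
    by (cases z) (auto simp: phase_def)
  have "ode_flow extended_field (entry_point p) s \<in> phase" if s: "s \<in> {0..?T + ?S}" for s
  proof (cases "s \<le> ?T")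
    case True
    then show ?thesis using q(1)[of s] s reach_exit_time[OF p'] by (simp add: rev_phase reach_def)
  next
    case False
    then show ?thesis using q(2)[of "s - ?T"] s reach_exit_time[OF p] by (simp add: reach_def)
  qed
  then have "reach (entry_point p) (?T + ?S)" by (simp add: reach_def)
  then have le: "?T + ?S \<le> exit_time g (entry_point p)"
    using reach_iff_exit_time[OF q(3), of "?T + ?S"] T S by simp
  have "fst (ode_flow extended_field (entry_point p) (?T + ?S)) \<in> sphere 0 1"
    using q(2)[of ?S] S exit_point_sphere(2)[OF p int] by simp
  then have "\<not> ?T + ?S < exit_time g (entry_point p)"
    using flow_not_sphere[OF q(3) reach_exit_time[OF q(3)], of "?T + ?S"] T S by auto
  then show ?thesis using le by simp
qed

text \<open>The geodesic continues from its entry point for a positive time, so its radial velocity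
  there is negative. The formula for the normal turns this Euclidean sign into the metric
  one.\<close>

lemma entry_point_inward:
  assumes p: "p \<in> sphere_bundle g" and int: "norm (fst p) < 1"
  shows "entry_point p \<in> inward_bundle g"
proof -
  let ?q = "entry_point p"
  have p': "reverse p \<in> sphere_bundle g" using p by simp
  have q: "?q \<in> sphere_bundle g" by (rule flow_entry_point(3)[OF p])
  have x: "fst ?q \<in> sphere 0 1"
    using exit_point_sphere(2)[OF p'] int by (simp add: entry_point_def)
  have pos: "0 < exit_time g ?q"
    using exit_time_entry_point[OF p int] exit_point_sphere(1)[OF p int] exit_time_nonneg[OF p'] by simp
  have "fst ?q \<bullet> snd ?q < 0"
    using geodesic_start_inward[OF reach_geodesic[OF reach_exit_time[OF q]], of 0] pos x
      sphere_bundle_nonzero[OF q] by simp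
  moreover have xB: "fst ?q \<in> BM" "fst ?q \<noteq> 0" using x by auto
  ultimately have "metric_inner g (fst ?q) (snd ?q) (outer_normal g (fst ?q)) < 0"
    using normal_scale_pos[OF xB] metric_outer_normal[OF xB(1)]
    by (simp add: metric_inner_def inner_commute mult_pos_neg)
  then show ?thesis using q x unfolding inward_bundle_def by (auto simp: case_prod_beta)
qed

end


subsection \<open>Integrals along rays\<close>

text \<open>Only \<open>f'\<close> is assumed measurable: a function that agrees with it almost
  everywhere is measurable for the completion. This covers integrands made from
  \<open>exit_time\<close>, \<open>geodesic_flow\<close> and a Lebesgue measurable
  \<open>f\<close>.\<close>

lemma integral_completion_cong_AE:
  fixes f f' :: "'a \<Rightarrow> 'b::{banach, second_countable_topology}"
  assumes f': "f' \<in> borel_measurable M" and AE: "AE x in M. f x = f' x"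
  shows "integral\<^sup>L (completion M) f = integral\<^sup>L M f'"
proof -
  have AE': "AE x in completion M. f x = f' x" using AE by (rule AE_completion)
  have m': "f' \<in> borel_measurable (completion M)" using f' by (rule measurable_completion)
  have "f \<in> borel_measurable (completion M)"
  proof (rule measurableI)
    fix B :: "'b set" assume B: "B \<in> sets borel"
    have "AE x in completion M. x \<in> f' -` B \<inter> space (completion M) \<longleftrightarrow> x \<in> f -` B \<inter> space (completion M)"
      using AE' by eventually_elim auto
    then show "f -` B \<inter> space (completion M) \<in> sets (completion M)"
      by (rule completion.in_sets_AE) (use measurable_sets[OF m' B] in auto)
  qed simp
  then have "integral\<^sup>L (completion M) f = integral\<^sup>L (completion M) f'"
    by (rule integral_cong_AE[OF _ m' AE'])
  then show ?thesis using integral_completion[OF f'] by simp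
qed

lemma borel_measurable_completion_complex:
  fixes f :: "'a \<Rightarrow> complex"
  assumes "f \<in> borel_measurable (completion M)"
  obtains f' where "f' \<in> borel_measurable M" "AE x in M. f x = f' x"
proof -
  have "(\<lambda>x. Re (f x)) \<in> borel_measurable (completion M)" "(\<lambda>x. Im (f x)) \<in> borel_measurable (completion M)"
    using assms by auto
  then obtain r i where r: "r \<in> borel_measurable M" "AE x in M. Re (f x) = r x"
    and i: "i \<in> borel_measurable M" "AE x in M. Im (f x) = i x"
    using completion_ex_borel_measurable_real by metis
  have "(\<lambda>x. Complex (r x) (i x)) \<in> borel_measurable M"
    using r(1) i(1) by (simp add: Complex_eq)
  moreover have "AE x in M. f x = Complex (r x) (i x)"
    using r(2) i(2) by eventually_elim (simp add: complex_eq_iff)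
  ultimately show ?thesis using that by blast
qed

context ball_metric
begin

abbreviation path :: "(real^'n) \<times> (real^'n) \<Rightarrow> real \<Rightarrow> real^'n" where
  "path p t \<equiv> fst (ode_flow extended_field p (max 0 t))"

lemma flow_measurable [measurable]:
  "(\<lambda>z. ode_flow extended_field (fst z) (max 0 (snd z))) \<in> borel_measurable (borel \<Otimes>\<^sub>M borel)"
  using borel_measurable_continuous_onI[OF field.continuous_on_flow]
  by (simp add: case_prod_beta' borel_prod)

lemma path_measurable [measurable]:
  "(\<lambda>z. path (fst z) (snd z)) \<in> borel_measurable (borel \<Otimes>\<^sub>M borel)"
proof -
  have "fst \<in> borel_measurable (borel :: ((real^'n) \<times> (real^'n)) measure)"
    by (intro borel_measurable_continuous_onI continuous_intros)
  then show ?thesis by (rule measurable_compose[OF flow_measurable])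
qed

lemma domain_measurable [measurable]: "{(p, t). 0 \<le> t \<and> reach p t} \<in> sets (borel \<Otimes>\<^sub>M borel)"
  unfolding borel_prod using closed_reach by (rule borel_closed)

lemma phase_measurable [measurable]: "phase \<in> sets borel"
  using phase_props(3) by simp

text \<open>The range of times is cut out by a closed set of pairs rather than by
  \<open>exit_time\<close>, so measurability in \<open>p\<close> follows from joint measurability of
  the integrand.\<close>

definition ray_nn_integral :: "(real^'n \<Rightarrow> ennreal) \<Rightarrow> (real^'n) \<times> (real^'n) \<Rightarrow> ennreal" where
  "ray_nn_integral u p = (\<integral>\<^sup>+t. indicator {(p, t). 0 \<le> t \<and> reach p t} (p, t) * u (path p t) \<partial>lborel)"

definition ray_integral :: "(real^'n \<Rightarrow> complex) \<Rightarrow> (real^'n) \<times> (real^'n) \<Rightarrow> complex" where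
  "ray_integral h p = (\<integral>t. indicat_real {(p, t). 0 \<le> t \<and> reach p t} (p, t) *\<^sub>R h (path p t) \<partial>lborel)"

lemma ray_nn_integral_measurable [measurable]:
  assumes [measurable]: "u \<in> borel_measurable borel"
  shows "ray_nn_integral u \<in> borel_measurable borel"
proof -
  have "(\<lambda>z. indicator {(p, t). 0 \<le> t \<and> reach p t} z * u (path (fst z) (snd z)) :: ennreal)
      \<in> borel_measurable (borel \<Otimes>\<^sub>M lborel)"
    by measurable
  from lborel.borel_measurable_nn_integral_fst[OF this]
  show ?thesis unfolding ray_nn_integral_def[abs_def] by simp
qed

lemma ray_integral_measurable [measurable]:
  assumes [measurable]: "h \<in> borel_measurable borel"
  shows "ray_integral h \<in> borel_measurable borel"
proof -
  have "(\<lambda>z. indicat_real {(p, t). 0 \<le> t \<and> reach p t} z *\<^sub>R h (path (fst z) (snd z)))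
      \<in> borel_measurable (borel \<Otimes>\<^sub>M lborel)"
    by measurable
  then show ?thesis unfolding ray_integral_def[abs_def]
    by (intro lborel.borel_measurable_lebesgue_integral) (simp add: case_prod_beta')
qed

lemma ray_section_measurable:
  assumes [measurable]: "h \<in> borel_measurable borel"
  shows "(\<lambda>t. h (path p t)) \<in> borel_measurable borel"
    and "(\<lambda>t. indicator {(p, t). 0 \<le> t \<and> reach p t} (p, t) :: 'b::{zero_neq_one, topological_space}) \<in> borel_measurable borel"
proof -
  have P: "Pair p \<in> borel \<rightarrow>\<^sub>M borel \<Otimes>\<^sub>M borel" by simp
  show "(\<lambda>t. h (path p t)) \<in> borel_measurable borel"
    using measurable_compose[OF measurable_compose[OF P path_measurable] assms] by simp
  show "(\<lambda>t. indicator {(p, t). 0 \<le> t \<and> reach p t} (p, t) :: 'b) \<in> borel_measurable borel"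
    using measurable_compose[OF P borel_measurable_indicator[OF domain_measurable]] by simp
qed

text \<open>Only an upper bound for the integral along the ray: times after the exit at which the extended
  flow returns to \<open>phase\<close> count as well.\<close>

definition phase_nn_integral :: "real \<Rightarrow> (real^'n \<Rightarrow> ennreal) \<Rightarrow> (real^'n) \<times> (real^'n) \<Rightarrow> ennreal" where
  "phase_nn_integral T u p
    = (\<integral>\<^sup>+t. indicator {0..T} t * (indicator phase (ode_flow extended_field p (max 0 t)) * u (path p t)) \<partial>lborel)"

lemma phase_nn_integral_integrand_measurable:
  assumes [measurable]: "u \<in> borel_measurable borel"
  shows "(\<lambda>(p, t). indicator {0..T} t * (indicator phase (ode_flow extended_field p (max 0 t)) * u (path p t)) :: ennreal)
    \<in> borel_measurable (borel \<Otimes>\<^sub>M borel)"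
proof -
  have "(\<lambda>z. indicator phase (ode_flow extended_field (fst z) (max 0 (snd z))) :: ennreal)
      \<in> borel_measurable (borel \<Otimes>\<^sub>M borel)"
    by (rule measurable_compose[OF flow_measurable]) measurable
  moreover have "(\<lambda>z. u (path (fst z) (snd z))) \<in> borel_measurable (borel \<Otimes>\<^sub>M borel)"
    by measurable
  ultimately show ?thesis by (simp add: case_prod_beta')
qed

lemma phase_nn_integral_measurable [measurable]:
  assumes "u \<in> borel_measurable borel"
  shows "phase_nn_integral T u \<in> borel_measurable borel"
proof -
  note phase_nn_integral_integrand_measurable[OF assms, of T]
  then show ?thesis unfolding phase_nn_integral_def[abs_def]
    by (intro lborel.borel_measurable_nn_integral) simp
qed

text \<open>Tonelli's theorem exchanges time and phase space. Up to time \<open>T\<close> the flow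
  distorts Lebesgue measure by at most \<open>exp (field_lipschitz * T)\<close> to the power of the
  dimension of phase space. Since \<open>phase\<close> is a product, the velocities contribute only
  the volume of a ball.\<close>

lemma phase_nn_integral_bound:
  assumes u [measurable]: "u \<in> borel_measurable borel" and T: "0 \<le> T"
  obtains C where "C < \<infinity>"
    "(\<integral>\<^sup>+x. \<integral>\<^sup>+v. phase_nn_integral T u (x, v) \<partial>lborel \<partial>lborel)
      \<le> C * (\<integral>\<^sup>+x. indicator BM x * u x \<partial>lborel)"
proof -
  let ?\<psi> = "ode_flow extended_field"
  let ?w = "\<lambda>p. indicator phase p * u (fst p) :: ennreal"
  let ?D = "DIM((real^'n) \<times> (real^'n))"
  let ?C = "ennreal (exp (field_lipschitz * T) ^ ?D)"
  let ?V = "emeasure lborel (cball (0::real^'n) speed_bound)"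
  let ?I = "\<integral>\<^sup>+x. indicator BM x * u x \<partial>lborel"
  have fstm: "fst \<in> borel_measurable (borel :: ((real^'n) \<times> (real^'n)) measure)"
    by (intro borel_measurable_continuous_onI continuous_intros)
  have um: "(\<lambda>p. u (fst p)) \<in> borel_measurable (borel :: ((real^'n) \<times> (real^'n)) measure)"
    by (rule measurable_compose[OF fstm u])
  have w: "?w \<in> borel_measurable borel" using um by measurable
  have L: "0 \<le> field_lipschitz" using lipschitz_on_nonneg[OF field.lipschitz] .
  interpret rev: bounded_lipschitz_field "\<lambda>p. - extended_field p" field_lipschitz field_bound
    by (rule field.uminus_field)
  have step: "(\<integral>\<^sup>+p. ?w (?\<psi> p t) \<partial>lborel) \<le> ?C * (\<integral>\<^sup>+p. ?w p \<partial>lborel)" if t: "t \<in> {0..T}" for t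
  proof -
    have "(\<integral>\<^sup>+p. ?w (?\<psi> p t) \<partial>lborel) \<le> ennreal (exp (field_lipschitz * t) ^ ?D) * (\<integral>\<^sup>+p. ?w p \<partial>lborel)"
      using t by (intro nn_integral_compose_le_of_lipschitz_inverse[OF rev.flow_lipschitz field.flow_reverse
            field.continuous_on_flow_at w]) auto
    also have "\<dots> \<le> ?C * (\<integral>\<^sup>+p. ?w p \<partial>lborel)"
      using t L by (intro mult_right_mono ennreal_leI power_mono) (auto intro: mult_left_mono)
    finally show ?thesis .
  qed
  have W: "(\<integral>\<^sup>+p. ?w p \<partial>lborel) = ?V * ?I"
  proof -
    have "(\<integral>\<^sup>+p. ?w p \<partial>lborel) = (\<integral>\<^sup>+x. \<integral>\<^sup>+v. ?w (x, v) \<partial>lborel \<partial>lborel)"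
      using w by (subst lborel.nn_integral_fst) (auto simp: lborel_prod)
    also have "\<dots> = (\<integral>\<^sup>+x. \<integral>\<^sup>+v. (indicator BM x * u x) * indicator (cball (0::real^'n) speed_bound) v \<partial>lborel \<partial>lborel)"
      by (simp add: phase_def indicator_times mult_ac)
    also have "\<dots> = (\<integral>\<^sup>+x. (indicator BM x * u x) * ?V \<partial>lborel)"
      by (simp add: nn_integral_cmult_indicator)
    also have "\<dots> = ?I * ?V" 
      using u by (intro nn_integral_multc borel_measurable_times_ennreal borel_measurable_indicator) auto
    finally show ?thesis by (simp add: mult.commute)
  qed
  have "(\<integral>\<^sup>+x. \<integral>\<^sup>+v. phase_nn_integral T u (x, v) \<partial>lborel \<partial>lborel) = (\<integral>\<^sup>+p. phase_nn_integral T u p \<partial>lborel)"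
    using phase_nn_integral_measurable[OF u, of T] by (subst lborel.nn_integral_fst) (auto simp: lborel_prod)
  also have "\<dots> = (\<integral>\<^sup>+t. \<integral>\<^sup>+p. indicator {0..T} t * (indicator phase (?\<psi> p (max 0 t)) * u (path p t)) \<partial>lborel \<partial>lborel)"
    unfolding phase_nn_integral_def
    by (rule lborel_pair.Fubini'[symmetric]) (use phase_nn_integral_integrand_measurable[OF u, of T] in simp)
  also have "\<dots> \<le> (\<integral>\<^sup>+t. (?C * (?V * ?I)) * indicator {0..T} t \<partial>lborel)"
  proof (rule nn_integral_mono)
    fix t :: real
    show "(\<integral>\<^sup>+p. indicator {0..T} t * (indicator phase (?\<psi> p (max 0 t)) * u (path p t)) \<partial>lborel)
        \<le> (?C * (?V * ?I)) * indicator {0..T} t"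
      using step[of t] W by (cases "t \<in> {0..T}") (auto simp: max_def)
  qed
  also have "\<dots> = (?C * (?V * ?I)) * ennreal T" using T by (simp add: nn_integral_cmult_indicator)
  also have "\<dots> = (?C * ?V * ennreal T) * ?I" by (simp add: mult_ac)
  finally have le: "(\<integral>\<^sup>+x. \<integral>\<^sup>+v. phase_nn_integral T u (x, v) \<partial>lborel \<partial>lborel) \<le> (?C * ?V * ennreal T) * ?I" .
  have "?V < \<infinity>" by (rule emeasure_bounded_finite) simp
  then have "?C * ?V * ennreal T < \<infinity>" by (simp add: ennreal_mult_less_top)
  then show ?thesis using that le by blast
qed

text \<open>The vector \<open>v\<close> of norm \<open>N\<close> and its normalisation generate the
  same curve, with times related by \<open>s = t / N\<close>. As \<open>1/2 < N \<le> 1\<close>,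
  times up to \<open>T\<close> become times up to \<open>2 * T\<close>, and the substitution factor
  \<open>1 / N\<close> is at least 1.\<close>

lemma ray_nn_integral_le_phase_nn_integral:
  assumes u [measurable]: "u \<in> borel_measurable borel"
    and T: "\<And>p t. p \<in> sphere_bundle g \<Longrightarrow> reach p t \<Longrightarrow> t \<le> T"
    and x: "x \<in> BM" and v: "v \<in> shell g x (1/2)"
  shows "ray_nn_integral u (x, v /\<^sub>R metric_norm g x v) \<le> phase_nn_integral (2 * T) u (x, v)"
proof -
  let ?\<psi> = "ode_flow extended_field"
  define N where "N = metric_norm g x v"
  define p where "p = (x, v /\<^sub>R N)"
  have N: "1/2 < N" "N \<le> 1" using v by (auto simp: shell_def N_def)
  have p: "p \<in> sphere_bundle g"
    using metric_norm_normalize[of g x v] N x by (simp add: p_def N_def sphere_bundle_def)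
  define k where "k s = indicator {0..2 * T} s * (indicator phase (?\<psi> (x, v) (max 0 s)) * u (path (x, v) s))"
    for s :: real
  have k: "k \<in> borel_measurable borel"
    using measurable_compose[OF measurable_Pair1' phase_nn_integral_integrand_measurable[OF u, of "2 * T"], of "(x, v)"]
    unfolding k_def[abs_def] by simp
  have le: "indicator {(p, t). 0 \<le> t \<and> reach p t} (p, t) * u (path p t) \<le> k (0 + inverse N * t)" for t
  proof (cases "0 \<le> t \<and> reach p t")
    case True
    have I: "(\<lambda>s. 0 + N * s) ` {0..inverse N * t} \<subseteq> {0..t}" using N by (auto simp: field_simps)
    define c where "c s = (fst (?\<psi> p (0 + N * s)), N *\<^sub>R snd (?\<psi> p (0 + N * s)))" for s
    have d: "geodesic_on g {0..inverse N * t} c"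
      using geodesic_compose_affine[OF reach_geodesic I] True unfolding c_def[abs_def] by blast
    have start: "c 0 = (x, v)" using N by (simp add: c_def p_def)
    have speed: "metric_norm g (fst (c 0)) (snd (c 0)) \<le> 1" using N by (simp add: start N_def)
    have s: "inverse N * t \<in> {0..inverse N * t}" using True N by auto
    have Nt: "0 + N * (inverse N * t) = t" using N by simp
    have "c (inverse N * t) = ?\<psi> (x, v) (inverse N * t)"
      using geodesic_eq_flow[OF d speed s] start by simp
    moreover have "fst (c (inverse N * t)) = fst (?\<psi> p t)" unfolding c_def Nt by simp
    ultimately have "fst (?\<psi> (x, v) (inverse N * t)) = fst (?\<psi> p t)" by simp
    moreover have "?\<psi> (x, v) (inverse N * t) \<in> phase"
      using geodesic_reach[OF d speed] start s unfolding reach_def by simp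
    moreover have "inverse N * t \<le> 2 * T"
    proof -
      have "t \<le> T" using T[OF p] True by simp
      moreover have "inverse N \<le> 2" using N le_imp_inverse_le[of "1/2" N] by simp
      ultimately show ?thesis using True N by (intro mult_mono) auto
    qed
    ultimately show ?thesis using True s by (simp add: k_def max_def)
  qed simp
  have kN: "(\<lambda>t. k (0 + inverse N * t)) \<in> borel_measurable borel"
    by (rule measurable_compose[OF _ k]) measurable
  have "ray_nn_integral u p \<le> (\<integral>\<^sup>+t. k (0 + inverse N * t) \<partial>lborel)"
    unfolding ray_nn_integral_def by (rule nn_integral_mono) (rule le)
  also have "\<dots> = 1 * (\<integral>\<^sup>+t. k (0 + inverse N * t) \<partial>lborel)" by simp
  also have "\<dots> \<le> ennreal \<bar>inverse N\<bar> * (\<integral>\<^sup>+t. k (0 + inverse N * t) \<partial>lborel)"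
  proof (rule mult_right_mono)
    have "1 \<le> \<bar>inverse N\<bar>" using N one_le_inverse[of N] by simp
    then show "1 \<le> ennreal \<bar>inverse N\<bar>" using ennreal_leI[of 1 "\<bar>inverse N\<bar>"] by simp
  qed simp
  also have "\<dots> = (\<integral>\<^sup>+t. k t \<partial>lborel)"
    using N by (intro nn_integral_real_affine[symmetric] k) auto
  finally show ?thesis unfolding phase_nn_integral_def k_def p_def N_def .
qed

section \<open>Integration over directions\<close>

definition raw_sphere_measure :: "real^'n \<Rightarrow> (real^'n) measure" where
  "raw_sphere_measure x
    = scale_measure (of_nat CARD('n) * ennreal (sqrt (det (g x)))) (shell_measure g x 0)"

lemma sphere_measure_raw: "sphere_measure g x = completion (raw_sphere_measure x)"
  unfolding raw_sphere_measure_def by (rule sphere_measure_eq)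

lemma sets_raw_sphere_measure [measurable_cong]:
  "sets (raw_sphere_measure x) = sets (restrict_space borel {v. metric_norm g x v = 1})"
  by (simp add: raw_sphere_measure_def sets_shell_measure)

lemma space_raw_sphere_measure: "space (raw_sphere_measure x) = {v. metric_norm g x v = 1}"
  by (simp add: raw_sphere_measure_def space_scale_measure space_shell_measure)

lemma raw_sphere_measurable:
  "h \<in> borel_measurable borel \<Longrightarrow> h \<in> borel_measurable (raw_sphere_measure x)"
  by (subst measurable_cong_sets[OF sets_raw_sphere_measure refl]) (rule measurable_restrict_space1)

lemma uminus_raw_sphere_measurable: "uminus \<in> raw_sphere_measure x \<rightarrow>\<^sub>M raw_sphere_measure x"
proof (subst measurable_cong_sets[OF refl sets_raw_sphere_measure], rule measurable_restrict_space2)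
  show "uminus \<in> space (raw_sphere_measure x) \<rightarrow> {v. metric_norm g x v = 1}"
    by (simp add: space_raw_sphere_measure)
  show "uminus \<in> borel_measurable (raw_sphere_measure x)"
    by (rule raw_sphere_measurable) measurable
qed

lemma raw_sphere_measure_uminus:
  "distr (raw_sphere_measure x) (raw_sphere_measure x) uminus = raw_sphere_measure x"
proof (rule measure_eqI)
  fix A assume "A \<in> sets (distr (raw_sphere_measure x) (raw_sphere_measure x) uminus)"
  then have A: "A \<in> sets (raw_sphere_measure x)" by simp
  note m = uminus_raw_sphere_measurable
  have A0: "A \<in> sets (shell_measure g x 0)" using A by (simp add: raw_sphere_measure_def)
  have "A \<subseteq> {v. metric_norm g x v = 1}" using sets.sets_into_space[OF A] space_raw_sphere_measure by simp
  then have "metric_norm g x v = 1" if "- v \<in> A" for v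
    using that metric_norm_uminus[of g x v] by auto
  then have "uminus -` A \<inter> space (raw_sphere_measure x) = uminus -` A"
    unfolding space_raw_sphere_measure by auto
  then show "emeasure (distr (raw_sphere_measure x) (raw_sphere_measure x) uminus) A
      = emeasure (raw_sphere_measure x) A"
    using m A emeasure_shell_measure_uminus[OF order_refl A0]
    by (simp add: emeasure_distr raw_sphere_measure_def)
qed simp

text \<open>Dropping the speeds up to 1/2 costs a factor 2, after which the integral over directions
  is a Lebesgue integral over vectors of controlled speed.\<close>

lemma nn_integral_raw_sphere_le:
  assumes x: "x \<in> BM" and h: "h \<in> borel_measurable borel"
  shows "(\<integral>\<^sup>+v. h v \<partial>raw_sphere_measure x) \<le> of_nat CARD('n) * ennreal (sqrt (det (g x))) *
    (2 * (\<integral>\<^sup>+v. h (v /\<^sub>R metric_norm g x v) * indicator (shell g x (1/2)) v \<partial>lborel))"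
proof -
  have hm: "h \<in> borel_measurable (shell_measure g x a)" for a
    by (subst measurable_cong_sets[OF sets_shell_measure refl]) (rule measurable_restrict_space1[OF h])
  have "(\<integral>\<^sup>+v. h v \<partial>shell_measure g x 0) \<le> (\<integral>\<^sup>+v. h v \<partial>scale_measure 2 (shell_measure g x (1/2)))"
    by (rule nn_integral_mono_measure)
      (use shell_measure_0_le[of g x] metric_pos[OF x] in \<open>auto simp: sets_shell_measure\<close>)
  also have "\<dots> = 2 * (\<integral>\<^sup>+v. h v \<partial>shell_measure g x (1/2))"
    by (rule nn_integral_scale_measure[OF hm])
  also have "(\<integral>\<^sup>+v. h v \<partial>shell_measure g x (1/2))
      = (\<integral>\<^sup>+v. h (v /\<^sub>R metric_norm g x v) \<partial>restrict_space lborel (shell g x (1/2)))"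
    unfolding shell_measure_def
    by (rule nn_integral_distr[OF normalize_measurable]) (auto intro: measurable_restrict_space1 h)
  also have "\<dots> = (\<integral>\<^sup>+v. h (v /\<^sub>R metric_norm g x v) * indicator (shell g x (1/2)) v \<partial>lborel)"
    by (rule nn_integral_restrict_space) simp
  finally show ?thesis
    unfolding raw_sphere_measure_def by (simp add: nn_integral_scale_measure[OF hm] mult_left_mono)
qed

lemma ray_nn_integral_sphere_finite:
  assumes u: "u \<in> borel_measurable borel"
    and T: "\<And>p t. p \<in> sphere_bundle g \<Longrightarrow> reach p t \<Longrightarrow> t \<le> T"
    and x: "x \<in> BM" and fin: "(\<integral>\<^sup>+v. phase_nn_integral (2 * T) u (x, v) \<partial>lborel) < \<infinity>"
  shows "(\<integral>\<^sup>+v. ray_nn_integral u (x, v) \<partial>raw_sphere_measure x) < \<infinity>"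
proof -
  have P: "Pair x \<in> borel_measurable borel" by (intro borel_measurable_continuous_onI continuous_intros)
  have m: "(\<lambda>v. ray_nn_integral u (x, v)) \<in> borel_measurable borel"
    by (rule measurable_compose[OF P ray_nn_integral_measurable[OF u]])
  have "(\<integral>\<^sup>+v. ray_nn_integral u (x, v /\<^sub>R metric_norm g x v) * indicator (shell g x (1/2)) v \<partial>lborel)
      \<le> (\<integral>\<^sup>+v. phase_nn_integral (2 * T) u (x, v) \<partial>lborel)"
    using ray_nn_integral_le_phase_nn_integral[OF u T x]
    by (intro nn_integral_mono) (auto simp: indicator_def)
  then have "(\<integral>\<^sup>+v. ray_nn_integral u (x, v /\<^sub>R metric_norm g x v) * indicator (shell g x (1/2)) v \<partial>lborel) < \<infinity>"
    using fin by (rule le_less_trans)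
  then have "of_nat CARD('n) * ennreal (sqrt (det (g x))) *
      (2 * (\<integral>\<^sup>+v. ray_nn_integral u (x, v /\<^sub>R metric_norm g x v) * indicator (shell g x (1/2)) v \<partial>lborel)) < \<infinity>"
    by (simp add: ennreal_mult_less_top of_nat_less_top)
  with nn_integral_raw_sphere_le[OF x m] show ?thesis by (rule le_less_trans)
qed

end


subsection \<open>The normal operator\<close>

context ball_metric
begin

text \<open>Finite values of \<open>u\<close> certify that \<open>f\<close> agrees with its Borel
  representative on the ball. Square integrability for the Riemannian volume controls the Lebesgue
  integral of \<open>|f|\<close>, since the ball has finite volume and the determinant is bounded
  below.\<close>

lemma L2_representative:
  assumes f: "f \<in> L2_fun (riemannian_volume g)"
  obtains f' u where "f' \<in> borel_measurable borel" "u \<in> borel_measurable borel"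
    "(\<integral>\<^sup>+x. indicator BM x * u x \<partial>lborel) < \<infinity>"
    "\<And>x. ennreal (norm (f' x)) \<le> u x" "\<And>x. x \<in> BM \<Longrightarrow> u x < \<infinity> \<Longrightarrow> f x = f' x"
proof -
  let ?M = "lebesgue_on BM :: (real^'n) measure"
  let ?w = "\<lambda>x. ennreal (sqrt (det (g x)))"
  obtain m where m: "0 < m" "\<And>x. x \<in> BM \<Longrightarrow> m \<le> det (g x)" using det_lower_bound by blast
  have "(\<lambda>x. sqrt (det (g x))) \<in> borel_measurable ?M"
    by (intro continuous_imp_measurable_on_sets_lebesgue continuous_intros continuous_det) auto
  then have w: "?w \<in> borel_measurable ?M" by measurable
  have fm: "f \<in> borel_measurable ?M" using f by (simp add: L2_fun_def riemannian_volume_def)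
  have "integrable (density ?M ?w) (\<lambda>x. (cmod (f x))\<^sup>2)"
    using f by (simp add: L2_fun_def riemannian_volume_def)
  then have "(\<integral>\<^sup>+x. ennreal ((cmod (f x))\<^sup>2) \<partial>density ?M ?w) < \<infinity>"
    by (simp add: integrable_iff_bounded)
  then have fin: "(\<integral>\<^sup>+x. ?w x * ennreal ((cmod (f x))\<^sup>2) \<partial>?M) < \<infinity>"
    using fm w by (simp add: nn_integral_density)
  let ?c = "ennreal (inverse (sqrt m))"
  have "(\<integral>\<^sup>+x. ennreal (norm (f x)) \<partial>?M) \<le> (\<integral>\<^sup>+x. 1 + ?c * (?w x * ennreal ((cmod (f x))\<^sup>2)) \<partial>?M)"
  proof (rule nn_integral_mono)
    fix x assume "x \<in> space ?M"
    then have x: "x \<in> BM" by (simp add: space_restrict_space)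
    have d: "sqrt m \<le> sqrt (det (g x))" using m(2)[OF x] by simp
    have "norm (f x) \<le> 1 + (norm (f x))\<^sup>2" using zero_le_power2[of "norm (f x) - 1/2"]
      by (simp add: power2_eq_square algebra_simps)
    also have "(norm (f x))\<^sup>2 \<le> inverse (sqrt m) * (sqrt (det (g x)) * (norm (f x))\<^sup>2)"
    proof -
      have "1 \<le> inverse (sqrt m) * sqrt (det (g x))" using d m(1) by (simp add: field_simps)
      then show ?thesis
        using mult_right_mono[of 1 "inverse (sqrt m) * sqrt (det (g x))" "(norm (f x))\<^sup>2"] by (simp add: mult.assoc)
    qed
    finally have "ennreal (norm (f x)) \<le> ennreal (1 + inverse (sqrt m) * (sqrt (det (g x)) * (norm (f x))\<^sup>2))"
      by (intro ennreal_leI) simp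
    also have "\<dots> = 1 + ?c * (?w x * ennreal ((cmod (f x))\<^sup>2))"
      using m(1) det_metric_pos[OF x] by (simp add: ennreal_plus ennreal_mult)
    finally show "ennreal (norm (f x)) \<le> 1 + ?c * (?w x * ennreal ((cmod (f x))\<^sup>2))" .
  qed
  also have "\<dots> = emeasure ?M BM + ?c * (\<integral>\<^sup>+x. ?w x * ennreal ((cmod (f x))\<^sup>2) \<partial>?M)"
    using w fm by (subst nn_integral_add) (auto simp: nn_integral_cmult space_restrict_space)
  also have "\<dots> < \<infinity>"
  proof -
    have "emeasure ?M BM = emeasure lborel (BM :: (real^'n) set)" by (simp add: emeasure_restrict_space)
    also have "\<dots> < \<infinity>" by (rule emeasure_bounded_finite) simp
    finally show ?thesis using fin by (simp add: ennreal_mult_less_top)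
  qed
  finally have L1: "(\<integral>\<^sup>+x. ennreal (norm (f x)) \<partial>?M) < \<infinity>" .
  have "(\<lambda>x. indicat_real BM x *\<^sub>R f x) \<in> borel_measurable lebesgue"
    using fm by (subst (asm) borel_measurable_restrict_space_iff) auto
  then obtain f' where f': "f' \<in> borel_measurable lborel" "AE x in lborel. indicat_real BM x *\<^sub>R f x = f' x"
    by (rule borel_measurable_completion_complex)
  obtain N where N: "{x \<in> space lborel. \<not> indicat_real BM x *\<^sub>R f x = f' x} \<subseteq> N" "N \<in> null_sets lborel"
    using f'(2) by (auto elim!: AE_E simp: null_sets_def)
  \<comment> \<open>The value infinity on \<open>N\<close> leaves the Lebesgue integral unchanged,
    but gives an infinite integral to every ray that spends positive time in
    \<open>N\<close>.\<close>
  define u where "u x = ennreal (norm (f' x)) + \<infinity> * indicator N x" for x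
  have eq: "indicat_real BM x *\<^sub>R f x = f' x" if "x \<notin> N" for x using N(1) that by auto
  have [measurable]: "f' \<in> borel_measurable borel" "N \<in> sets borel" using f'(1) N(2) by (auto simp: null_sets_def)
  have "u \<in> borel_measurable borel" unfolding u_def[abs_def] by measurable
  moreover have "(\<integral>\<^sup>+x. indicator BM x * u x \<partial>lborel) < \<infinity>"
  proof -
    have "(\<integral>\<^sup>+x. indicator BM x * u x \<partial>lborel) = (\<integral>\<^sup>+x. ennreal (norm (f x)) * indicator BM x \<partial>lborel)"
    proof (rule nn_integral_cong_AE)
      show "AE x in lborel. indicator BM x * u x = ennreal (norm (f x)) * indicator BM x"
        using AE_not_in[OF N(2)]
      proof eventually_elim
        fix x assume "x \<notin> N"
        then show "indicator BM x * u x = ennreal (norm (f x)) * indicator BM x"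
          using eq[of x] by (auto simp: u_def indicator_def)
      qed
    qed
    also have "\<dots> = (\<integral>\<^sup>+x. ennreal (norm (f x)) * indicator BM x \<partial>lebesgue)"
      by (rule nn_integral_completion[symmetric])
    also have "\<dots> = (\<integral>\<^sup>+x. ennreal (norm (f x)) \<partial>?M)"
      by (rule nn_integral_restrict_space[symmetric]) auto
    finally show ?thesis using L1 by simp
  qed
  moreover have "ennreal (norm (f' x)) \<le> u x" for x by (simp add: u_def)
  moreover have "f x = f' x" if "x \<in> BM" "u x < \<infinity>" for x
  proof -
    have "x \<notin> N" using that(2) by (auto simp: u_def)
    then show ?thesis using eq[of x] that(1) by simp
  qed
  ultimately show ?thesis using that \<open>f' \<in> borel_measurable borel\<close> by blast
qed

lemma reach_path: "0 \<le> t \<Longrightarrow> reach p t \<Longrightarrow> path p t \<in> BM"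
  by (auto simp: reach_def phase_def mem_Times_iff max_def)

end

context simple_ball
begin

lemma indicator_reach_eq:
  "p \<in> sphere_bundle g \<Longrightarrow> indicator {(p, t). 0 \<le> t \<and> reach p t} (p, t) = indicator {0..exit_time g p} t"
  using reach_iff_exit_time[of p t] by (auto simp: indicator_def)

lemma ray_integrable:
  assumes h: "h \<in> borel_measurable borel" and u: "u \<in> borel_measurable borel" "\<And>x. ennreal (norm (h x)) \<le> u x"
    and p: "p \<in> sphere_bundle g" and fin: "ray_nn_integral u p < \<infinity>"
  shows "integrable lborel (\<lambda>t. indicat_real {0..exit_time g p} t *\<^sub>R h (path p t))"
    and "ennreal (norm (ray_integral h p)) \<le> ray_nn_integral u p"
proof -
  let ?h = "\<lambda>t. indicat_real {0..exit_time g p} t *\<^sub>R h (path p t)"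
  have m: "?h \<in> borel_measurable borel" using ray_section_measurable(1)[OF h, of p] by measurable
  have le: "(\<integral>\<^sup>+t. ennreal (norm (?h t)) \<partial>lborel) \<le> ray_nn_integral u p"
    unfolding ray_nn_integral_def indicator_reach_eq[OF p]
    by (rule nn_integral_mono) (auto simp: indicator_def u(2))
  show int: "integrable lborel ?h"
    by (rule integrableI_bounded) (use m le fin in \<open>auto intro: le_less_trans\<close>)
  have "ennreal (norm (ray_integral h p)) \<le> (\<integral>\<^sup>+t. ennreal (norm (?h t)) \<partial>lborel)"
    unfolding ray_integral_def indicator_reach_eq[OF p] by (rule integral_norm_bound_ennreal[OF int])
  then show "ennreal (norm (ray_integral h p)) \<le> ray_nn_integral u p" using le by (rule order_trans)
qed

text \<open>A finite integral of \<open>u\<close> along the ray forces \<open>u\<close> to be finite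
  at almost every time, and there \<open>f\<close> equals \<open>h\<close>.\<close>

lemma integral_along_ray:
  assumes h: "h \<in> borel_measurable borel" and u: "u \<in> borel_measurable borel"
    and f: "\<And>x. x \<in> BM \<Longrightarrow> u x < \<infinity> \<Longrightarrow> f x = h x"
    and p: "p \<in> sphere_bundle g" and fin: "ray_nn_integral u p < \<infinity>"
  shows "(LINT t|lebesgue_on {0..exit_time g p}. f (fst (geodesic_flow g t p))) = ray_integral h p"
proof -
  let ?I = "{0..exit_time g p}"
  have m: "(\<lambda>t. indicator ?I t * u (path p t)) \<in> borel_measurable borel"
    using ray_section_measurable(1)[OF u, of p] by measurable
  have "AE t in lborel. indicator ?I t * u (path p t) \<noteq> \<infinity>"
    by (rule nn_integral_PInf_AE) (use m fin in \<open>auto simp: ray_nn_integral_def indicator_reach_eq[OF p]\<close>)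
  then have AE: "AE t in lborel. indicat_real ?I t *\<^sub>R f (fst (geodesic_flow g t p))
      = indicat_real ?I t *\<^sub>R h (path p t)"
  proof eventually_elim
    fix t assume ne: "indicator ?I t * u (path p t) \<noteq> \<infinity>"
    show "indicat_real ?I t *\<^sub>R f (fst (geodesic_flow g t p)) = indicat_real ?I t *\<^sub>R h (path p t)"
    proof (cases "t \<in> ?I")
      case True
      then have t: "0 \<le> t" "reach p t" using reach_iff_exit_time[OF p, of t] by auto
      have "fst (geodesic_flow g t p) = path p t" using geodesic_flow_eq[OF p t] t(1) by (simp add: max_def)
      moreover have "f (path p t) = h (path p t)"
        using ne True by (intro f reach_path t) (simp add: less_top)
      ultimately show ?thesis by simp
    qed simp
  qed
  have hm: "(\<lambda>t. indicat_real ?I t *\<^sub>R h (path p t)) \<in> borel_measurable lborel"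
    using ray_section_measurable(1)[OF h, of p] by measurable
  have "(LINT t|lebesgue_on ?I. f (fst (geodesic_flow g t p)))
      = (LINT t|lebesgue. indicat_real ?I t *\<^sub>R f (fst (geodesic_flow g t p)))"
    by (rule integral_restrict_space) simp
  also have "\<dots> = (LINT t|lborel. indicat_real ?I t *\<^sub>R h (path p t))"
    by (rule integral_completion_cong_AE[OF hm AE])
  finally show ?thesis by (simp add: ray_integral_def indicator_reach_eq[OF p])
qed

text \<open>The ray from the entry point consists of the reversed backward ray followed by the forward ray;
  the two pieces overlap in a single time only.\<close>

lemma path_entry_point:
  fixes h :: "real^'n \<Rightarrow> 'b::monoid_add"
  assumes p: "p \<in> sphere_bundle g" and int: "norm (fst p) < 1"
    and t: "t \<noteq> exit_time g (reverse p)"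
  shows "(if t \<in> {0..exit_time g (entry_point p)} then h (path (entry_point p) t) else 0)
    = (if exit_time g (reverse p) - t \<in> {0..exit_time g (reverse p)}
        then h (path (reverse p) (exit_time g (reverse p) - t)) else 0)
      + (if t - exit_time g (reverse p) \<in> {0..exit_time g p}
        then h (path p (t - exit_time g (reverse p))) else 0)"
proof -
  let ?T = "exit_time g (reverse p)"
  have T: "0 \<le> ?T" "0 \<le> exit_time g p" using exit_time_nonneg[of "reverse p"] exit_time_nonneg[OF p] p by auto
  note E = exit_time_entry_point[OF p int]
  consider "t < 0" | "0 \<le> t" "t < ?T" | "?T < t" using t by linarith
  then show ?thesis
  proof cases
    case 1
    then show ?thesis using T by auto
  next
    case 2
    then have "path (entry_point p) t = path (reverse p) (?T - t)"
      using flow_entry_point(1)[OF p, of t] by (simp add: max_def)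
    then show ?thesis using 2 T E by auto
  next
    case 3
    then have "path (entry_point p) t = path p (t - ?T)"
      using flow_entry_point(2)[OF p, of "t - ?T"] T by (simp add: max_def)
    then show ?thesis using 3 T E by auto
  qed
qed

lemma ray_nn_integral_eq:
  "p \<in> sphere_bundle g \<Longrightarrow> ray_nn_integral u p
    = (\<integral>\<^sup>+t. (if t \<in> {0..exit_time g p} then u (path p t) else 0) \<partial>lborel)"
  unfolding ray_nn_integral_def indicator_reach_eq
  by (intro nn_integral_cong) (auto simp: indicator_reach_eq)

lemma ray_integral_eq:
  "p \<in> sphere_bundle g \<Longrightarrow> ray_integral h p
    = (\<integral>t. (if t \<in> {0..exit_time g p} then h (path p t) else 0) \<partial>lborel)"
  unfolding ray_integral_def
  by (intro Bochner_Integration.integral_cong) (auto simp: indicator_reach_eq)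

lemma ray_integrand_measurable:
  assumes h: "h \<in> borel_measurable borel"
  shows "(\<lambda>t. if t \<in> {0..exit_time g p} then h (path p t) else 0) \<in> borel_measurable borel"
  using ray_section_measurable(1)[OF h, of p] by (intro measurable_If) auto

text \<open>Time shifts and time reversal preserve Lebesgue measure, and the overlapping time is
  null. If both halves are finite, this makes \<open>integral_along_ray\<close> applicable at the
  entry point.\<close>

lemma ray_nn_integral_entry_point:
  assumes u: "u \<in> borel_measurable borel"
    and p: "p \<in> sphere_bundle g" and int: "norm (fst p) < 1"
  shows "ray_nn_integral u (entry_point p) = ray_nn_integral u p + ray_nn_integral u (reverse p)"
proof -
  let ?T = "exit_time g (reverse p)"
  let ?r = "\<lambda>p t. if t \<in> {0..exit_time g p} then u (path p t) else 0"
  have p': "reverse p \<in> sphere_bundle g" using p by simp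
  have m: "?r p \<in> borel_measurable borel" for p by (rule ray_integrand_measurable[OF u])
  have aff: "(\<lambda>t. ?r p (a + c * t)) \<in> borel_measurable lborel" for p a c
    using measurable_compose[OF _ m, of "\<lambda>t. a + c * t" lborel] by simp
  have "ray_nn_integral u (entry_point p)
      = (\<integral>\<^sup>+t. ?r (reverse p) (?T + (-1) * t) + ?r p (- ?T + 1 * t) \<partial>lborel)"
    unfolding ray_nn_integral_eq[OF flow_entry_point(3)[OF p]]
    by (rule nn_integral_cong_AE, rule eventually_mono[OF AE_lborel_singleton[of ?T]])
      (subst path_entry_point[OF p int], auto)
  also have "\<dots> = (\<integral>\<^sup>+t. ?r (reverse p) (?T + (-1) * t) \<partial>lborel) + (\<integral>\<^sup>+t. ?r p (- ?T + 1 * t) \<partial>lborel)"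
    by (rule nn_integral_add[OF aff aff])
  also have "(\<integral>\<^sup>+t. ?r (reverse p) (?T + (-1) * t) \<partial>lborel) = (\<integral>\<^sup>+t. ?r (reverse p) t \<partial>lborel)"
    using nn_integral_real_affine[OF m, of "-1" "reverse p" ?T] by simp
  also have "(\<integral>\<^sup>+t. ?r p (- ?T + 1 * t) \<partial>lborel) = (\<integral>\<^sup>+t. ?r p t \<partial>lborel)"
    using nn_integral_real_affine[OF m, of 1 p "- ?T"] by simp
  finally show ?thesis by (simp only: ray_nn_integral_eq[OF p] ray_nn_integral_eq[OF p'] add.commute)
qed

text \<open>Additivity of the Bochner integral requires each half to be integrable; this is where
  finiteness on both rays enters.\<close>

lemma ray_integral_entry_point:
  assumes h: "h \<in> borel_measurable borel" and u: "u \<in> borel_measurable borel" "\<And>x. ennreal (norm (h x)) \<le> u x"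
    and p: "p \<in> sphere_bundle g" and int: "norm (fst p) < 1"
    and fin: "ray_nn_integral u p < \<infinity>" "ray_nn_integral u (reverse p) < \<infinity>"
  shows "ray_integral h (entry_point p) = ray_integral h p + ray_integral h (reverse p)"
proof -
  let ?T = "exit_time g (reverse p)"
  let ?r = "\<lambda>p t. if t \<in> {0..exit_time g p} then h (path p t) else 0"
  have p': "reverse p \<in> sphere_bundle g" using p by simp
  have m: "?r p \<in> borel_measurable borel" for p by (rule ray_integrand_measurable[OF h])
  have I: "integrable lborel (?r p)" if "p \<in> sphere_bundle g" "ray_nn_integral u p < \<infinity>" for p
    using ray_integrable(1)[OF h u that] by (rule Bochner_Integration.integrable_cong[THEN iffD1, rotated 2])
      (auto simp: indicator_def)
  have I1: "integrable lborel (\<lambda>t. ?r (reverse p) (?T + (-1) * t))"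
    by (rule lborel_integrable_real_affine[OF I[OF p' fin(2)]]) simp
  have I2: "integrable lborel (\<lambda>t. ?r p (- ?T + 1 * t))"
    by (rule lborel_integrable_real_affine[OF I[OF p fin(1)]]) simp
  have "ray_integral h (entry_point p)
      = (\<integral>t. ?r (reverse p) (?T + (-1) * t) + ?r p (- ?T + 1 * t) \<partial>lborel)"
    unfolding ray_integral_eq[OF flow_entry_point(3)[OF p]]
  proof (rule integral_cong_AE)
    show "?r (entry_point p) \<in> borel_measurable lborel" using m by simp
    show "(\<lambda>t. ?r (reverse p) (?T + (-1) * t) + ?r p (- ?T + 1 * t)) \<in> borel_measurable lborel"
      using I1 I2 by (intro borel_measurable_add borel_measurable_integrable)
    show "AE t in lborel. ?r (entry_point p) t = ?r (reverse p) (?T + (-1) * t) + ?r p (- ?T + 1 * t)"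
      by (rule eventually_mono[OF AE_lborel_singleton[of ?T]])
        (subst path_entry_point[OF p int], auto)
  qed
  also have "\<dots> = (\<integral>t. ?r (reverse p) (?T + (-1) * t) \<partial>lborel) + (\<integral>t. ?r p (- ?T + 1 * t) \<partial>lborel)"
    by (rule Bochner_Integration.integral_add[OF I1 I2])
  also have "(\<integral>t. ?r (reverse p) (?T + (-1) * t) \<partial>lborel) = (\<integral>t. ?r (reverse p) t \<partial>lborel)"
    using lborel_integral_real_affine[of "-1" "?r (reverse p)" ?T] by simp
  also have "(\<integral>t. ?r p (- ?T + 1 * t) \<partial>lborel) = (\<integral>t. ?r p t \<partial>lborel)"
    using lborel_integral_real_affine[of 1 "?r p" "- ?T"] by simp
  finally show ?thesis by (simp only: ray_integral_eq[OF p] ray_integral_eq[OF p'] add.commute)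
qed

text \<open>Outside a null set of directions the rays of \<open>v\<close> and \<open>- v\<close>
  both carry a finite integral of \<open>u\<close>, and there the integrands of both operators are
  expressed by \<open>ray_integral h\<close>.\<close>

lemma backprojection_xray_at:
  assumes h: "h \<in> borel_measurable borel" and u: "u \<in> borel_measurable borel" "\<And>x. ennreal (norm (h x)) \<le> u x"
    and f: "\<And>x. x \<in> BM \<Longrightarrow> u x < \<infinity> \<Longrightarrow> f x = h x"
    and x: "norm x < 1" and fin: "(\<integral>\<^sup>+v. ray_nn_integral u (x, v) \<partial>raw_sphere_measure x) < \<infinity>"
  shows "backprojection g (xray_transform g f) x = normal_operator g f x"
proof -
  let ?\<sigma> = "raw_sphere_measure x"
  have xB: "x \<in> BM" using x by simp
  have P: "Pair x \<in> borel_measurable borel" by (intro borel_measurable_continuous_onI continuous_intros)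
  have Fm: "(\<lambda>v. ray_integral h (x, v)) \<in> borel_measurable ?\<sigma>"
    by (rule raw_sphere_measurable[OF measurable_compose[OF P ray_integral_measurable[OF h]]])
  have Jm: "(\<lambda>v. ray_nn_integral u (x, v)) \<in> borel_measurable ?\<sigma>"
    by (rule raw_sphere_measurable[OF measurable_compose[OF P ray_nn_integral_measurable[OF u(1)]]])
  have Fm': "(\<lambda>v. ray_integral h (x, - v)) \<in> borel_measurable ?\<sigma>"
    by (rule measurable_compose[OF uminus_raw_sphere_measurable Fm])
  have Jm': "(\<lambda>v. ray_nn_integral u (x, - v)) \<in> borel_measurable ?\<sigma>"
    by (rule measurable_compose[OF uminus_raw_sphere_measurable Jm])
  have fin': "(\<integral>\<^sup>+v. ray_nn_integral u (x, - v) \<partial>?\<sigma>) < \<infinity>"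
  proof -
    have "(\<integral>\<^sup>+v. ray_nn_integral u (x, - v) \<partial>?\<sigma>) = (\<integral>\<^sup>+v. ray_nn_integral u (x, v) \<partial>distr ?\<sigma> ?\<sigma> uminus)"
      by (rule nn_integral_distr[OF uminus_raw_sphere_measurable, symmetric]) (use Jm in simp)
    then show ?thesis using fin by (simp add: raw_sphere_measure_uminus)
  qed
  have AE1: "AE v in ?\<sigma>. ray_nn_integral u (x, v) \<noteq> \<infinity>"
    by (rule nn_integral_PInf_AE[OF Jm]) (use fin in simp)
  have AE2: "AE v in ?\<sigma>. ray_nn_integral u (x, - v) \<noteq> \<infinity>"
    by (rule nn_integral_PInf_AE[OF Jm']) (use fin' in simp)
  have mem: "(x, v) \<in> sphere_bundle g" if "v \<in> space ?\<sigma>" for v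
    using that xB by (simp add: space_raw_sphere_measure sphere_bundle_def)
  have F: "AE v in ?\<sigma>. (LINT t|lebesgue_on {0..exit_time g (x, v)}. f (fst (geodesic_flow g t (x, v))))
      = ray_integral h (x, v)"
    using AE1 AE_space
  proof eventually_elim
    case (elim v)
    then show ?case using integral_along_ray[OF h u(1) f mem, of v] by (simp add: less_top)
  qed
  have B: "AE v in ?\<sigma>. xray_transform g f (geodesic_flow g (- exit_time g (x, - v)) (x, v))
      = ray_integral h (x, v) + ray_integral h (x, - v)"
    using AE1 AE2 AE_space
  proof eventually_elim
    case (elim v)
    let ?p = "(x, v)"
    have p: "?p \<in> sphere_bundle g" by (rule mem[OF elim(3)])
    have int: "norm (fst ?p) < 1" using x by simp
    have fin: "ray_nn_integral u ?p < \<infinity>" "ray_nn_integral u (reverse ?p) < \<infinity>"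
      using elim by (simp_all add: less_top)
    have q: "entry_point ?p \<in> inward_bundle g" by (rule entry_point_inward[OF p int])
    have "ray_nn_integral u (entry_point ?p) < \<infinity>"
      using ray_nn_integral_entry_point[OF u(1) p int] fin by simp
    then have "xray_transform g f (entry_point ?p) = ray_integral h (entry_point ?p)"
      using integral_along_ray[OF h u(1) f flow_entry_point(3)[OF p]] q
      by (simp add: xray_transform_def)
    also have "\<dots> = ray_integral h ?p + ray_integral h (reverse ?p)"
      by (rule ray_integral_entry_point[OF h u p int fin])
    finally show ?case using geodesic_flow_entry_point[OF p] by simp
  qed
  have I: "integrable ?\<sigma> (\<lambda>v. ray_integral h (x, v))"
  proof (rule integrableI_bounded[OF Fm])
    have "(\<integral>\<^sup>+v. ennreal (norm (ray_integral h (x, v))) \<partial>?\<sigma>) \<le> (\<integral>\<^sup>+v. ray_nn_integral u (x, v) \<partial>?\<sigma>)"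
    proof (rule nn_integral_mono_AE)
      show "AE v in ?\<sigma>. ennreal (norm (ray_integral h (x, v))) \<le> ray_nn_integral u (x, v)"
        using AE1 AE_space
      proof eventually_elim
        case (elim v)
        then show ?case using ray_integrable(2)[OF h u mem, of v] by (simp add: less_top)
      qed
    qed
    then show "(\<integral>\<^sup>+v. ennreal (norm (ray_integral h (x, v))) \<partial>?\<sigma>) < \<infinity>" using fin by (rule le_less_trans)
  qed
  have sym: "integrable ?\<sigma> (\<lambda>v. ray_integral h (x, - v))"
    "(\<integral>v. ray_integral h (x, - v) \<partial>?\<sigma>) = (\<integral>v. ray_integral h (x, v) \<partial>?\<sigma>)"
    using integrable_distr_eq[OF uminus_raw_sphere_measurable Fm] integral_distr[OF uminus_raw_sphere_measurable Fm] I
    by (simp_all add: raw_sphere_measure_uminus)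
  have "backprojection g (xray_transform g f) x
      = (\<integral>v. ray_integral h (x, v) + ray_integral h (x, - v) \<partial>?\<sigma>)"
    unfolding backprojection_def sphere_measure_raw
    by (rule integral_completion_cong_AE[OF borel_measurable_add[OF Fm Fm'] B])
  also have "\<dots> = 2 * (\<integral>v. ray_integral h (x, v) \<partial>?\<sigma>)"
    using I sym by simp
  also have "(\<integral>v. ray_integral h (x, v) \<partial>?\<sigma>) = (LINT v|sphere_measure g x.
      LINT t|lebesgue_on {0..exit_time g (x, v)}. f (fst (geodesic_flow g t (x, v))))"
    unfolding sphere_measure_raw by (rule integral_completion_cong_AE[OF Fm F, symmetric])
  finally show ?thesis by (simp add: normal_operator_def)
qed

lemma reach_le_exit_bound: "p \<in> sphere_bundle g \<Longrightarrow> reach p t \<Longrightarrow> t \<le> exit_bound"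
  using reach_iff_exit_time[of p t] exit_time_le_bound[of p] exit_bound_nonneg by (cases "0 \<le> t") auto

lemma backprojection_xray:
  assumes f: "f \<in> L2_fun (riemannian_volume g)"
  shows "AE x in riemannian_volume g. backprojection g (xray_transform g f) x = normal_operator g f x"
proof -
  obtain h u where h: "h \<in> borel_measurable borel" and u: "u \<in> borel_measurable borel"
    "(\<integral>\<^sup>+x. indicator BM x * u x \<partial>lborel) < \<infinity>" "\<And>x. ennreal (norm (h x)) \<le> u x"
    and fh: "\<And>x. x \<in> BM \<Longrightarrow> u x < \<infinity> \<Longrightarrow> f x = h x"
    using L2_representative[OF f] by blast
  let ?P = "\<lambda>x. backprojection g (xray_transform g f) x = normal_operator g f x"
  \<comment> \<open>The factor 2 in the time accounts for the slower vectors of the shell, with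
    speeds down to 1/2.\<close>
  let ?G = "\<lambda>x. \<integral>\<^sup>+v. phase_nn_integral (2 * exit_bound) u (x, v) \<partial>lborel"
  obtain C where C: "C < \<infinity>" "(\<integral>\<^sup>+x. ?G x \<partial>lborel) \<le> C * (\<integral>\<^sup>+x. indicator BM x * u x \<partial>lborel)"
    using phase_nn_integral_bound[OF u(1), of "2 * exit_bound"] exit_bound_nonneg by auto
  have Gm: "?G \<in> borel_measurable lborel"
    using phase_nn_integral_measurable[OF u(1), of "2 * exit_bound"]
    by (intro lborel.borel_measurable_nn_integral) (simp add: lborel_prod)
  have "(\<integral>\<^sup>+x. ?G x \<partial>lborel) \<noteq> \<infinity>"
    using C u(2) by (auto simp: ennreal_mult_eq_top_iff top_unique)
  then have AE1: "AE x in lborel. ?G x \<noteq> \<infinity>" by (rule nn_integral_PInf_AE[OF Gm])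
  \<comment> \<open>At a boundary point the entry vector may be tangent and thus outside
    \<open>inward_bundle\<close>, so the identity is established at interior points.\<close>
  have "sphere (0::real^'n) 1 \<in> null_sets lborel"
    using negligible_sphere[of "0::real^'n" 1] by (simp add: negligible_iff_null_sets null_sets_completion_iff)
  then have AE2: "AE x in lborel. x \<notin> sphere (0::real^'n) 1" by (rule AE_not_in)
  have "AE x in lborel. x \<in> BM \<longrightarrow> ?P x"
    using AE1 AE2
  proof eventually_elim
    case (elim x)
    show ?case
    proof
      assume xB: "x \<in> BM"
      then have x: "norm x < 1" using elim(2) by auto
      have fin: "(\<integral>\<^sup>+v. ray_nn_integral u (x, v) \<partial>raw_sphere_measure x) < \<infinity>"
        by (rule ray_nn_integral_sphere_finite[OF u(1) reach_le_exit_bound xB])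
          (use elim(1) in \<open>auto simp: less_top\<close>)
      show "?P x" by (rule backprojection_xray_at[OF h u(1,3) fh x fin])
    qed
  qed
  then have "AE x in lebesgue. x \<in> BM \<longrightarrow> ?P x" by (rule AE_completion)
  then have "AE x in lebesgue_on BM. ?P x" by (subst AE_restrict_space_iff) auto
  moreover have "(\<lambda>x. sqrt (det (g x))) \<in> borel_measurable (lebesgue_on BM)"
    by (intro continuous_imp_measurable_on_sets_lebesgue continuous_intros continuous_det) auto
  ultimately show ?thesis
    unfolding riemannian_volume_def by (subst AE_density) (auto elim: eventually_mono)
qed

end

theorem proposition2:
  fixes g :: "real^'n \<Rightarrow> real^'n^'n" and k :: nat and f :: "real^'n \<Rightarrow> complex"
  assumes "k \<ge> 2"
    and "simple_manifold k g"
    and "f \<in> L2_fun (riemannian_volume g)"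
  shows "AE x in riemannian_volume g.
           backprojection g (xray_transform g f) x = normal_operator g f x"
proof -
  have "Ck_metric 2 g"
    using assms(1,2) Ck_on_mono[of 2 k g BM] by (simp add: simple_manifold_def Ck_metric_def)
  then interpret simple_ball g
    using assms(2) by unfold_locales (simp_all add: simple_manifold_def)
  show ?thesis by (rule backprojection_xray[OF assms(3)])
qed

end
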